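(* Let $K$ be a field and let $G$ be an unmixed graph with $2n$ vertices, none of which is isolated, and with $\operatorname{height} I(G) = n$. Then the following conditions are equivalent: (1) $G$ is Cohen-Macaulay. (2) $\Delta(G)$ is strongly connected. (3) There is a unique perfect matching in $G$. (4) $\Delta(G)$ is shellable.
   Context: All graphs are finite simple graphs (no loops or multiple edges), with vertex set $V(G)$ and edge set $E(G)$. For a field $K$, let $S$ be the polynomial ring over $K$ whose variables are the vertices of $G$; the edge ideal $I(G)\subset S$ is generated by all products $uv$ with $uv\in E(G)$. $G$ is Cohen-Macaulay if $S/I(G)$ is a Cohen-Macaulay ring. A vertex cover of $G$ is a set of vertices meeting every edge; it is minimal if no proper subset is a vertex cover. $G$ is unmixed if all its minimal vertex covers have the same cardinality. $\operatorname{height} I(G)$ equals the smallest cardinality of a minimal vertex cover of $G$. $\Delta(G)$ is the simplicial complex on $V(G)$ whose faces are the independent sets of $G$ (sets of pairwise non-adjacent vertices). A facet is a maximal face; $\dim F=\sharp F-1$; a complex is pure if all its facets have the same dimension. A pure complex $\Delta$ is shellable if its facets can be linearly ordered $F_1,\dots,F_m$ such that for all $1\le j<i\le m$ there exist $v\in F_i\setminus F_j$ and $k\in\{1,\dots,i-1\}$ with $F_i\setminus F_k=\{v\}$. A pure complex $\Delta$ is strongly connected if for every two facets $F,F'$ there is a sequence of facets $F=F_0,F_1,\dots,F_m=F'$ with $\dim(F_i\cap F_{i+1})=\dim\Delta-1$ for each $i=0,\dots,m-1$. *)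

theory Defs
  imports
    "HOL-Library.Poly_Mapping"
    "HOL-Library.Extended_Nat"
    "HOL-Library.Disjoint_Sets"
    "HOL-Algebra.QuotRing"
    "HOL-Algebra.Ring_Divisibility"
    "HOL-Algebra.Algebraic_Closure_Type"
begin

section \<open>Cohen--Macaulay rings\<close>

definition prime_height :: "('a, 'b) ring_scheme \<Rightarrow> 'a set \<Rightarrow> enat" where
  "prime_height R P =
     Sup {enat r |r. \<exists>Q :: nat \<Rightarrow> 'a set.
       (\<forall>i\<le>r. primeideal (Q i) R) \<and> (\<forall>i<r. Q i \<subset> Q (Suc i)) \<and> Q r = P}"

definition ideal_height :: "('a, 'b) ring_scheme \<Rightarrow> 'a set \<Rightarrow> enat" where
  "ideal_height R J = Inf {prime_height R P |P. primeideal P R \<and> J \<subseteq> P}"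

definition regular_sequence :: "('a, 'b) ring_scheme \<Rightarrow> 'a list \<Rightarrow> bool" where
  "regular_sequence R xs \<longleftrightarrow>
     set xs \<subseteq> carrier R \<and>
     (\<forall>i<length xs. \<forall>a\<in>carrier R.
        xs ! i \<otimes>\<^bsub>R\<^esub> a \<in> Idl\<^bsub>R\<^esub> (set (take i xs)) \<longrightarrow> a \<in> Idl\<^bsub>R\<^esub> (set (take i xs))) \<and>
     Idl\<^bsub>R\<^esub> (set xs) \<noteq> carrier R"

definition ideal_depth :: "('a, 'b) ring_scheme \<Rightarrow> 'a set \<Rightarrow> enat" where
  "ideal_depth R J = Sup {enat (length xs) |xs. regular_sequence R xs \<and> set xs \<subseteq> J}"

text \<open>
  This is the definition of D. Eisenbud, Commutative Algebra with a View Toward Algebraic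
  Geometry, Section 18.2: a Noetherian ring is Cohen--Macaulay if the depth of every maximal
  ideal equals its codimension (height). The depth and the height of a maximal ideal \<open>M\<close> of
  \<open>R\<close> are the depth and the dimension of the localization of \<open>R\<close> at \<open>M\<close>.
\<close>

definition cohen_macaulay_ring :: "('a, 'b) ring_scheme \<Rightarrow> bool" where
  "cohen_macaulay_ring R \<longleftrightarrow>
     cring R \<and> noetherian_ring R \<and>
     (\<forall>M. maximalideal M R \<longrightarrow> ideal_depth R M = ideal_height R M)"


section \<open>Simplicial complexes\<close>

definition facet :: "'v set set \<Rightarrow> 'v set \<Rightarrow> bool" where
  "facet \<Delta> F \<longleftrightarrow> F \<in> \<Delta> \<and> (\<forall>H\<in>\<Delta>. F \<subseteq> H \<longrightarrow> F = H)"

text \<open>The empty face has dimension \<open>-1\<close>, hence dimensions are integers.\<close>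

definition face_dim :: "'v set \<Rightarrow> int" where
  "face_dim F = int (card F) - 1"

definition complex_dim :: "'v set set \<Rightarrow> int" where
  "complex_dim \<Delta> = Max (face_dim ` \<Delta>)"

definition pure_complex :: "'v set set \<Rightarrow> bool" where
  "pure_complex \<Delta> \<longleftrightarrow> (\<forall>F H. facet \<Delta> F \<longrightarrow> facet \<Delta> H \<longrightarrow> face_dim F = face_dim H)"

definition strongly_connected_complex :: "'v set set \<Rightarrow> bool" where
  "strongly_connected_complex \<Delta> \<longleftrightarrow>
     pure_complex \<Delta> \<and>
     (\<forall>F H. facet \<Delta> F \<longrightarrow> facet \<Delta> H \<longrightarrow>
        (\<exists>m. \<exists>Fs :: nat \<Rightarrow> 'v set.
           (\<forall>i\<le>m. facet \<Delta> (Fs i)) \<and> Fs 0 = F \<and> Fs m = H \<and>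
           (\<forall>i<m. face_dim (Fs i \<inter> Fs (Suc i)) = complex_dim \<Delta> - 1)))"

definition shellable_complex :: "'v set set \<Rightarrow> bool" where
  "shellable_complex \<Delta> \<longleftrightarrow>
     pure_complex \<Delta> \<and>
     (\<exists>Fs. distinct Fs \<and> set Fs = {F. facet \<Delta> F} \<and>
        (\<forall>i<length Fs. \<forall>j<i.
           \<exists>v \<in> Fs ! i - Fs ! j. \<exists>k<i. Fs ! i - Fs ! k = {v}))"


section \<open>Graphs\<close>

definition simple_graph :: "'v set \<Rightarrow> 'v set set \<Rightarrow> bool" where
  "simple_graph V E \<longleftrightarrow> finite V \<and> (\<forall>e\<in>E. e \<subseteq> V \<and> card e = 2)"

definition no_isolated_vertex :: "'v set \<Rightarrow> 'v set set \<Rightarrow> bool" where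
  "no_isolated_vertex V E \<longleftrightarrow> (\<forall>v\<in>V. \<exists>e\<in>E. v \<in> e)"

definition vertex_cover :: "'v set \<Rightarrow> 'v set set \<Rightarrow> 'v set \<Rightarrow> bool" where
  "vertex_cover V E C \<longleftrightarrow> C \<subseteq> V \<and> (\<forall>e\<in>E. e \<inter> C \<noteq> {})"

definition minimal_vertex_cover :: "'v set \<Rightarrow> 'v set set \<Rightarrow> 'v set \<Rightarrow> bool" where
  "minimal_vertex_cover V E C \<longleftrightarrow>
     vertex_cover V E C \<and> (\<forall>D. D \<subset> C \<longrightarrow> \<not> vertex_cover V E D)"

definition unmixed_graph :: "'v set \<Rightarrow> 'v set set \<Rightarrow> bool" where
  "unmixed_graph V E \<longleftrightarrow>
     (\<forall>C D. minimal_vertex_cover V E C \<longrightarrow> minimal_vertex_cover V E D \<longrightarrow> card C = card D)"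

definition perfect_matching :: "'v set \<Rightarrow> 'v set set \<Rightarrow> 'v set set \<Rightarrow> bool" where
  "perfect_matching V E M \<longleftrightarrow> M \<subseteq> E \<and> disjoint M \<and> \<Union>M = V"

definition independence_complex :: "'v set \<Rightarrow> 'v set set \<Rightarrow> 'v set set" where
  "independence_complex V E = {F. F \<subseteq> V \<and> (\<forall>u\<in>F. \<forall>v\<in>F. {u, v} \<notin> E)}"


section \<open>Edge ideals\<close>

text \<open>
  A polynomial is a finitely supported map from exponent vectors to coefficients; the
  multiplication of \<^typ>\<open>('v \<Rightarrow>\<^sub>0 nat) \<Rightarrow>\<^sub>0 'k::field\<close> is the convolution product.
  The carrier consists of the polynomials in which only variables from \<open>V\<close> occur.
\<close>

definition mpoly_ring :: "'k::field itself \<Rightarrow> 'v set \<Rightarrow> (('v \<Rightarrow>\<^sub>0 nat) \<Rightarrow>\<^sub>0 'k) ring" where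
  "mpoly_ring K V =
     ring_of_type_algebra\<lparr>carrier := {p. \<forall>m\<in>Poly_Mapping.keys p. Poly_Mapping.keys m \<subseteq> V}\<rparr>"

definition mpoly_var :: "'k::field itself \<Rightarrow> 'v \<Rightarrow> (('v \<Rightarrow>\<^sub>0 nat) \<Rightarrow>\<^sub>0 'k)" where
  "mpoly_var K v = Poly_Mapping.single (Poly_Mapping.single v 1) 1"

definition edge_ideal ::
    "'k::field itself \<Rightarrow> 'v set \<Rightarrow> 'v set set \<Rightarrow> (('v \<Rightarrow>\<^sub>0 nat) \<Rightarrow>\<^sub>0 'k) set" where
  "edge_ideal K V E =
     Idl\<^bsub>mpoly_ring K V\<^esub> {mpoly_var K u \<otimes>\<^bsub>mpoly_ring K V\<^esub> mpoly_var K v |u v. {u, v} \<in> E}"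

definition cohen_macaulay_graph :: "'k::field itself \<Rightarrow> 'v set \<Rightarrow> 'v set set \<Rightarrow> bool" where
  "cohen_macaulay_graph K V E \<longleftrightarrow>
     cohen_macaulay_ring (mpoly_ring K V Quot edge_ideal K V E)"

end

theory Submission
  imports Defs
begin

text \<open>
  Hall's theorem gives a perfect matching \<open>y \<mapsto> p y\<close> between a facet \<open>Y\<close> and its complement, and by
  unmixedness every facet contains exactly one of \<open>y\<close> and \<open>p y\<close>. The relation ``\<open>p x\<close> is adjacent to
  \<open>y\<close>'' is a preorder on \<open>Y\<close>, and each of the four conditions is equivalent to its antisymmetry.

  If \<open>x \<noteq> y\<close> are equivalent, then the facets through \<open>x, y\<close> and those through \<open>p x, p y\<close> split the
  edge ideal as \<open>A \<inter> B\<close> with \<open>S/(A + B)\<close> of dimension at most \<open>n - 2\<close>, which a regular sequence of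
  length \<open>n\<close> forbids by a quantitative version of Hartshorne's connectedness theorem. Conversely,
  let \<open>M\<close> be a maximal ideal. By Zariski's lemma it contains a monic polynomial \<open>h\<^sub>y\<close> in
  \<open>\<theta>\<^sub>y = y + p y\<close> for every \<open>y \<in> Y\<close>. A shelling makes \<open>S/I\<close> free over \<open>K[\<theta>\<^sub>y]\<close> on the monomials of the
  restriction sets, hence free over \<open>K[h\<^sub>y]\<close>, and so the \<open>h\<^sub>y\<close> form a regular sequence of length \<open>n\<close>.
  Heights are at most \<open>n\<close> because a chain of primes yields algebraically independent elements.
\<close>

section \<open>Ideals of a commutative ring\<close>

text \<open>The definition of Cohen-Macaulay ranges over all maximal ideals of \<open>S/I\<close>,
  and \<open>K\<close> need not be algebraically closed. The elements \<open>\<theta> y\<close> lie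
  in only some of these ideals and in general cannot be moved into the others by subtracting
  constants. A monic polynomial in \<open>\<theta> y\<close> can always be found there, which is why
  Zariski's lemma is proved and why freeness is shown for such polynomials. The converse examines
  only the ideal of polynomials without constant term. The preorder is transitive by unmixedness: if
  \<open>p x\<close> is adjacent to \<open>y\<close> and \<open>p y\<close> to \<open>z\<close>, but
  \<open>p x\<close> is not adjacent to \<open>z\<close>, then a facet through \<open>p x\<close>
  and \<open>z\<close> misses both \<open>y\<close> and \<open>p y\<close>. The height of
  \<open>I\<close> serves to show that a facet has at least half of the vertices, so that Hall's
  injection is onto. Localizations never appear as rings of fractions: an ideal of the localization
  at \<open>M\<close> is represented by its contraction to \<open>S\<close>, a saturated
  ideal.\<close>

locale comm_subring =
  fixes S :: "'a::comm_ring_1 set"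
  assumes zero_mem [simp]: "0 \<in> S" and one_mem [simp]: "1 \<in> S"
    and add_mem [simp]: "a \<in> S \<Longrightarrow> b \<in> S \<Longrightarrow> a + b \<in> S"
    and mult_mem [simp]: "a \<in> S \<Longrightarrow> b \<in> S \<Longrightarrow> a * b \<in> S"
    and uminus_mem [simp]: "a \<in> S \<Longrightarrow> - a \<in> S"
begin

lemma diff_mem [simp]: "a \<in> S \<Longrightarrow> b \<in> S \<Longrightarrow> a - b \<in> S"
  using add_mem[of a "- b"] uminus_mem by simp

lemma power_mem [simp]: "a \<in> S \<Longrightarrow> a ^ k \<in> S"
  by (induction k) auto

lemma sum_mem: "(\<And>i. i \<in> A \<Longrightarrow> f i \<in> S) \<Longrightarrow> sum f A \<in> S"
  by (induction A rule: infinite_finite_induct) auto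

lemma prod_mem: "(\<And>i. i \<in> A \<Longrightarrow> f i \<in> S) \<Longrightarrow> prod f A \<in> S"
  by (induction A rule: infinite_finite_induct) auto

definition is_ideal :: "'a set \<Rightarrow> bool" where
  "is_ideal J \<longleftrightarrow> J \<subseteq> S \<and> 0 \<in> J \<and> (\<forall>a\<in>J. \<forall>b\<in>J. a + b \<in> J) \<and> (\<forall>s\<in>S. \<forall>a\<in>J. s * a \<in> J)"

definition is_prime :: "'a set \<Rightarrow> bool" where
  "is_prime Q \<longleftrightarrow> is_ideal Q \<and> 1 \<notin> Q \<and> (\<forall>a\<in>S. \<forall>b\<in>S. a * b \<in> Q \<longrightarrow> a \<in> Q \<or> b \<in> Q)"

text \<open>The top prime only has to lie inside \<open>M\<close>, so that chains can be lengthened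
  at the bottom without looking at the top; \<open>prime_chain_end\<close> later replaces it by
  \<open>M\<close>.\<close>

definition prime_chain :: "'a set \<Rightarrow> 'a set \<Rightarrow> nat \<Rightarrow> bool" where
  "prime_chain J M d \<longleftrightarrow> (\<exists>Q :: nat \<Rightarrow> 'a set. (\<forall>i\<le>d. is_prime (Q i)) \<and>
     (\<forall>i<d. Q i \<subset> Q (Suc i)) \<and> J \<subseteq> Q 0 \<and> Q d \<subseteq> M)"

definition add_principal :: "'a set \<Rightarrow> 'a \<Rightarrow> 'a set" where
  "add_principal Z z = {a + z * r |a r. a \<in> Z \<and> r \<in> S}"

definition nonzerodivisor_on :: "'a set \<Rightarrow> 'a \<Rightarrow> bool" where
  "nonzerodivisor_on Z z \<longleftrightarrow> (\<forall>r\<in>S. z * r \<in> Z \<longrightarrow> r \<in> Z)"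

lemma ideal_sub: "is_ideal J \<Longrightarrow> a \<in> J \<Longrightarrow> a \<in> S"
  by (auto simp: is_ideal_def)

lemma ideal_zero: "is_ideal J \<Longrightarrow> 0 \<in> J"
  by (auto simp: is_ideal_def)

lemma ideal_add: "is_ideal J \<Longrightarrow> a \<in> J \<Longrightarrow> b \<in> J \<Longrightarrow> a + b \<in> J"
  by (auto simp: is_ideal_def)

lemma ideal_mult: "is_ideal J \<Longrightarrow> s \<in> S \<Longrightarrow> a \<in> J \<Longrightarrow> s * a \<in> J"
  by (auto simp: is_ideal_def)

lemma ideal_mult_right: "is_ideal J \<Longrightarrow> s \<in> S \<Longrightarrow> a \<in> J \<Longrightarrow> a * s \<in> J"
  using ideal_mult[of J s a] by (simp add: mult.commute)

lemma ideal_uminus: "is_ideal J \<Longrightarrow> a \<in> J \<Longrightarrow> - a \<in> J"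
  using ideal_mult[of J "-1" a] by simp

lemma ideal_diff: "is_ideal J \<Longrightarrow> a \<in> J \<Longrightarrow> b \<in> J \<Longrightarrow> a - b \<in> J"
  using ideal_add[of J a "- b"] ideal_uminus by simp

lemma ideal_diff_iff: "is_ideal J \<Longrightarrow> a - b \<in> J \<Longrightarrow> a \<in> J \<longleftrightarrow> b \<in> J"
  using ideal_add[of J "a - b" b] ideal_diff[of J a "a - b"] by auto

lemma ideal_sum: "is_ideal J \<Longrightarrow> (\<And>i. i \<in> A \<Longrightarrow> f i \<in> J) \<Longrightarrow> sum f A \<in> J"
  by (induction A rule: infinite_finite_induct) (auto intro: ideal_add ideal_zero)

lemma prime_ideal: "is_prime Q \<Longrightarrow> is_ideal Q"
  by (simp add: is_prime_def)

lemma prime_cases: "is_prime Q \<Longrightarrow> a * b \<in> Q \<Longrightarrow> a \<in> S \<Longrightarrow> b \<in> S \<Longrightarrow> a \<in> Q \<or> b \<in> Q"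
  by (auto simp: is_prime_def)

lemma in_add_principal: "a \<in> Z \<Longrightarrow> r \<in> S \<Longrightarrow> a + z * r \<in> add_principal Z z"
  by (auto simp: add_principal_def)

lemma add_principal_ideal:
  assumes "is_ideal Z" "z \<in> S" shows "is_ideal (add_principal Z z)"
  unfolding is_ideal_def
proof (intro conjI ballI)
  show "add_principal Z z \<subseteq> S"
    using assms by (auto simp: add_principal_def dest: ideal_sub)
  show "0 \<in> add_principal Z z"
    using in_add_principal[of 0 Z 0 z] assms ideal_zero by auto
  fix a b assume "a \<in> add_principal Z z" "b \<in> add_principal Z z"
  then obtain x r y t where "a = x + z * r" "b = y + z * t" "x \<in> Z" "y \<in> Z" "r \<in> S" "t \<in> S"
    by (auto simp: add_principal_def)
  then show "a + b \<in> add_principal Z z"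
    using in_add_principal[of "x + y" Z "r + t" z] assms ideal_add by (auto simp: algebra_simps)
next
  fix s a assume s: "s \<in> S" and "a \<in> add_principal Z z"
  then obtain x r where "a = x + z * r" "x \<in> Z" "r \<in> S"
    by (auto simp: add_principal_def)
  then show "s * a \<in> add_principal Z z"
    using in_add_principal[of "s * x" Z "s * r" z] assms s ideal_mult by (auto simp: algebra_simps)
qed

lemma add_principal_sub: "Z \<subseteq> add_principal Z z"
  using in_add_principal[of _ Z 0 z] by auto

lemma add_principal_self: "is_ideal Z \<Longrightarrow> z \<in> add_principal Z z"
  using in_add_principal[of 0 Z 1 z] ideal_zero by auto

lemma add_principal_least:
  "is_ideal J \<Longrightarrow> Z \<subseteq> J \<Longrightarrow> z \<in> J \<Longrightarrow> add_principal Z z \<subseteq> J"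
  by (auto simp: add_principal_def intro!: ideal_add ideal_mult_right)

lemma ideal_Union_chain:
  assumes "C \<noteq> {}" "subset.chain {J. is_ideal J} C"
  shows "is_ideal (\<Union>C)"
  unfolding is_ideal_def
proof (intro conjI ballI)
  have id: "J \<in> C \<Longrightarrow> is_ideal J" for J
    using assms by (auto simp: subset.chain_def)
  show "\<Union>C \<subseteq> S" using id ideal_sub by blast
  show "0 \<in> \<Union>C" using id ideal_zero assms by blast
  show "s * a \<in> \<Union>C" if "s \<in> S" "a \<in> \<Union>C" for s a
    using that id ideal_mult by blast
  fix a b assume "a \<in> \<Union>C" "b \<in> \<Union>C"
  then obtain A B where AB: "a \<in> A" "b \<in> B" "A \<in> C" "B \<in> C" by auto
  moreover from AB have "A \<subseteq> B \<or> B \<subseteq> A"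
    using assms by (auto simp: subset.chain_def)
  ultimately show "a + b \<in> \<Union>C" using id ideal_add by (meson UnionI subsetD)
qed

text \<open>An ideal that is maximal among those missing \<open>W\<close> is prime. If neither
  \<open>a\<close> nor \<open>b\<close> lies in it, adding either of them gives an ideal that meets
  \<open>W\<close>; the product of the two common elements lies in \<open>W\<close> and, if
  \<open>a * b\<close> is in the ideal, also in the ideal.\<close>

lemma prime_avoiding_exists:
  assumes J: "is_ideal J" and W: "W \<subseteq> S" "1 \<in> W" "\<And>a b. a \<in> W \<Longrightarrow> b \<in> W \<Longrightarrow> a * b \<in> W"
    and dis: "J \<inter> W = {}"
  obtains Q where "is_prime Q" "J \<subseteq> Q" "Q \<inter> W = {}"
proof -
  define \<A> where "\<A> = {Q. is_ideal Q \<and> J \<subseteq> Q \<and> Q \<inter> W = {}}"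
  have "\<exists>Q\<in>\<A>. \<forall>Y\<in>\<A>. Q \<subseteq> Y \<longrightarrow> Y = Q"
  proof (rule subset_Zorn_nonempty)
    show "\<A> \<noteq> {}" using J dis by (auto simp: \<A>_def)
    fix C assume C: "C \<noteq> {}" "subset.chain \<A> C"
    then have "is_ideal (\<Union>C)"
      by (intro ideal_Union_chain) (auto simp: subset.chain_def \<A>_def)
    moreover have "\<forall>Q\<in>C. J \<subseteq> Q \<and> Q \<inter> W = {}"
      using C by (auto simp: subset.chain_def \<A>_def)
    then have "J \<subseteq> \<Union>C" "\<Union>C \<inter> W = {}"
      using C(1) by blast+
    ultimately show "\<Union>C \<in> \<A>" by (simp add: \<A>_def)
  qed
  then obtain Q where Q: "is_ideal Q" "J \<subseteq> Q" "Q \<inter> W = {}"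
    and max: "\<And>Y. is_ideal Y \<Longrightarrow> J \<subseteq> Y \<Longrightarrow> Y \<inter> W = {} \<Longrightarrow> Q \<subseteq> Y \<Longrightarrow> Y = Q"
    by (auto simp: \<A>_def)
  have meets: "\<exists>x\<in>Q. \<exists>r\<in>S. x + a * r \<in> W" if "a \<in> S" "a \<notin> Q" for a
  proof (rule ccontr)
    assume "\<not> ?thesis"
    then have "add_principal Q a \<inter> W = {}" by (auto simp: add_principal_def)
    then have "add_principal Q a = Q"
      using max[of "add_principal Q a"] add_principal_ideal[of Q a] add_principal_sub[of Q a] Q that
      by auto
    then show False using add_principal_self[of Q a] Q that by auto
  qed
  have "is_prime Q"
    unfolding is_prime_def
  proof (intro conjI ballI impI)
    show "is_ideal Q" "1 \<notin> Q" using Q W by auto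
    fix a b assume ab: "a \<in> S" "b \<in> S" "a * b \<in> Q"
    show "a \<in> Q \<or> b \<in> Q"
    proof (rule ccontr)
      assume "\<not> ?thesis"
      then obtain x r y t where xy: "x \<in> Q" "r \<in> S" "x + a * r \<in> W" "y \<in> Q" "t \<in> S" "y + b * t \<in> W"
        using meets[of a] meets[of b] ab by blast
      have "(x + a * r) * (y + b * t) = (y + b * t) * x + (a * r) * y + (r * t) * (a * b)"
        by (simp add: algebra_simps)
      moreover have "\<dots> \<in> Q"
        using xy ab Q(1) ideal_sub[OF Q(1)] ideal_mult[OF Q(1), of "y + b * t" x]
          ideal_mult[OF Q(1), of "a * r" y] ideal_mult[OF Q(1), of "r * t" "a * b"]
        by (auto intro!: ideal_add[OF Q(1)])
      ultimately show False using W(3)[of "x + a * r" "y + b * t"] xy Q by auto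
    qed
  qed
  then show ?thesis using Q that by blast
qed

text \<open>A prime that is minimal over \<open>J\<close> contains no nonzerodivisor on
  \<open>J\<close>. Minimal primes are avoided here: the products of a power of \<open>z\<close>
  with an element outside \<open>Q\<close> form a multiplicative set that misses \<open>J\<close>,
  and a prime avoiding this set lies in \<open>Q\<close> without containing
  \<open>z\<close>.\<close>

lemma prime_below:
  assumes J: "is_ideal J" and z: "nonzerodivisor_on J z" and Q: "is_prime Q" "J \<subseteq> Q" "z \<in> Q"
  obtains Q' where "is_prime Q'" "J \<subseteq> Q'" "Q' \<subset> Q"
proof -
  have zS: "z \<in> S" using Q ideal_sub prime_ideal by blast
  define W where "W = {s * z ^ k |s k. s \<in> S - Q}"
  have W: "W \<subseteq> S" using zS by (auto simp: W_def)
  have one: "1 \<in> S - Q" using Q by (auto simp: is_prime_def)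
  have "1 \<in> W" unfolding W_def using one by (intro CollectI exI[of _ 1] exI[of _ 0]) auto
  moreover have "a * b \<in> W" if "a \<in> W" "b \<in> W" for a b
  proof -
    from that obtain s k t l where "a = s * z ^ k" "b = t * z ^ l" "s \<in> S - Q" "t \<in> S - Q"
      by (auto simp: W_def)
    moreover from this have "s * t \<in> S - Q" using Q by (auto simp: is_prime_def)
    ultimately show ?thesis unfolding W_def
      by (intro CollectI exI[of _ "s * t"] exI[of _ "k + l"]) (auto simp: power_add algebra_simps)
  qed
  moreover have "J \<inter> W = {}"
  proof -
    have "s * z ^ k \<in> J \<Longrightarrow> s \<in> S \<Longrightarrow> s \<in> J" for s k
    proof (induction k)
      case (Suc k)
      have "z * (s * z ^ k) \<in> J" using Suc.prems by (simp add: algebra_simps)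
      then have "s * z ^ k \<in> J" using z Suc.prems zS by (auto simp: nonzerodivisor_on_def)
      then show ?case using Suc by simp
    qed simp
    then show ?thesis using Q by (auto simp: W_def)
  qed
  ultimately obtain Q' where Q': "is_prime Q'" "J \<subseteq> Q'" "Q' \<inter> W = {}"
    using prime_avoiding_exists[OF J W] by metis
  have "z \<in> W" unfolding W_def using one by (intro CollectI exI[of _ 1] exI[of _ 1]) auto
  moreover have "S - Q \<subseteq> W"
  proof
    fix s assume "s \<in> S - Q"
    then have "s * z ^ 0 \<in> W" unfolding W_def by blast
    then show "s \<in> W" by simp
  qed
  ultimately have "Q' \<subset> Q" using Q' Q ideal_sub prime_ideal by blast
  then show ?thesis using that Q' by blast
qed

text \<open>Turns an element of a regular sequence into one more prime: below the bottom prime of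
  the chain, which contains \<open>z\<close>, there is another one over \<open>J\<close>.\<close>

lemma prime_chain_extend:
  assumes J: "is_ideal J" and z: "nonzerodivisor_on J z"
    and ch: "prime_chain J' M d" and "J \<subseteq> J'" "z \<in> J'"
  shows "prime_chain J M (Suc d)"
proof -
  obtain Q where Q: "\<forall>i\<le>d. is_prime (Q i)" "\<forall>i<d. Q i \<subset> Q (Suc i)" "J' \<subseteq> Q 0" "Q d \<subseteq> M"
    using ch by (auto simp: prime_chain_def)
  obtain P where P: "is_prime P" "J \<subseteq> P" "P \<subset> Q 0"
    using prime_below[OF J z, of "Q 0"] Q assms by blast
  show ?thesis unfolding prime_chain_def
  proof (intro exI[of _ "\<lambda>i. if i = 0 then P else Q (i - 1)"] conjI allI impI)
    fix i assume "i < Suc d"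
    then show "(if i = 0 then P else Q (i - 1)) \<subset> (if Suc i = 0 then P else Q (Suc i - 1))"
      using P Q by (cases i) auto
  qed (use P Q in auto)
qed

lemma prime_chain_mono: "prime_chain J' M d \<Longrightarrow> J \<subseteq> J' \<Longrightarrow> prime_chain J M d"
  unfolding prime_chain_def by blast

end

section \<open>Regular sequences and chains of primes in a localization\<close>

locale localized_subring = comm_subring S for S :: "'a::comm_ring_1 set" +
  fixes M :: "'a set"
  assumes M_prime: "is_prime M"
    and acc: "\<And>\<A>. \<A> \<noteq> {} \<Longrightarrow> (\<And>J. J \<in> \<A> \<Longrightarrow> is_ideal J) \<Longrightarrow> \<exists>J\<in>\<A>. \<forall>J'\<in>\<A>. J \<subseteq> J' \<longrightarrow> J' = J"
begin

text \<open>The contraction to \<open>S\<close> of the ideal generated by \<open>J\<close> in the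
  localization at \<open>M\<close>. Saturated ideals are exactly the contracted ones and stand for
  the ideals of the local ring; the elements of \<open>S - M\<close> stand for its units.\<close>

definition loc :: "'a set \<Rightarrow> 'a set" where
  "loc J = {r \<in> S. \<exists>s\<in>S - M. s * r \<in> J}"

definition saturated :: "'a set \<Rightarrow> bool" where
  "saturated J \<longleftrightarrow> is_ideal J \<and> (\<forall>s\<in>S - M. \<forall>r\<in>S. s * r \<in> J \<longrightarrow> r \<in> J)"

text \<open>The ideal is made saturated again after each element, so that every stage is an ideal of
  the local ring.\<close>

fun loc_regular :: "'a set \<Rightarrow> 'a list \<Rightarrow> bool" where
  "loc_regular Z [] \<longleftrightarrow> True"
| "loc_regular Z (z # zs) \<longleftrightarrow> nonzerodivisor_on Z z \<and> loc_regular (loc (add_principal Z z)) zs"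

lemma M_ideal: "is_ideal M" using M_prime prime_ideal by blast

lemma M_sub: "z \<in> M \<Longrightarrow> z \<in> S" using M_ideal ideal_sub by blast

lemma nonM_mult: "s \<in> S - M \<Longrightarrow> t \<in> S - M \<Longrightarrow> s * t \<in> S - M"
  using M_prime by (auto simp: is_prime_def)

lemma one_nonM: "1 \<in> S - M"
  using M_prime by (auto simp: is_prime_def)

text \<open>In the local ring: a unit minus a nonunit is a unit.\<close>

lemma nonM_diff: "s \<in> S - M \<Longrightarrow> z \<in> M \<Longrightarrow> s - z \<in> S - M"
  using M_ideal ideal_add[of M "s - z" z] M_sub by auto

lemma saturated_ideal: "saturated J \<Longrightarrow> is_ideal J"
  by (simp add: saturated_def)

lemma saturatedD: "saturated J \<Longrightarrow> s * r \<in> J \<Longrightarrow> s \<in> S - M \<Longrightarrow> r \<in> S \<Longrightarrow> r \<in> J"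
  by (auto simp: saturated_def)

lemma locI: "r \<in> S \<Longrightarrow> s \<in> S - M \<Longrightarrow> s * r \<in> J \<Longrightarrow> r \<in> loc J"
  by (auto simp: loc_def)

lemma locE: assumes "r \<in> loc J" obtains s where "s \<in> S - M" "r \<in> S" "s * r \<in> J"
  using assms by (auto simp: loc_def)

lemma loc_ideal: assumes J: "is_ideal J" shows "is_ideal (loc J)"
  unfolding is_ideal_def
proof (intro conjI ballI)
  show "loc J \<subseteq> S" by (auto simp: loc_def)
  show "0 \<in> loc J" using locI[OF _ one_nonM, of 0 J] J ideal_zero by auto
  fix a b assume "a \<in> loc J" "b \<in> loc J"
  then obtain s t where st: "s \<in> S - M" "t \<in> S - M" "a \<in> S" "b \<in> S" "s * a \<in> J" "t * b \<in> J"
    by (elim locE)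
  have "s * t * (a + b) = t * (s * a) + s * (t * b)" by (simp add: algebra_simps)
  also have "\<dots> \<in> J" using st J by (auto intro!: ideal_add ideal_mult)
  finally show "a + b \<in> loc J" using st nonM_mult[of s t] by (intro locI) auto
next
  fix s a assume s: "s \<in> S" and "a \<in> loc J"
  then obtain t where t: "t \<in> S - M" "a \<in> S" "t * a \<in> J" by (elim locE)
  have "t * (s * a) = s * (t * a)" by (simp add: algebra_simps)
  also have "\<dots> \<in> J" using s t J by (auto intro!: ideal_mult)
  finally show "s * a \<in> loc J" using s t by (intro locI) auto
qed

lemma loc_saturated: assumes J: "is_ideal J" shows "saturated (loc J)"
  unfolding saturated_def
proof (intro conjI ballI impI loc_ideal[OF J])
  fix s r assume sr: "s \<in> S - M" "r \<in> S" "s * r \<in> loc J"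
  then obtain t where "t \<in> S - M" "t * (s * r) \<in> J" by (elim locE)
  then show "r \<in> loc J" using locI[of r "t * s" J] sr nonM_mult[of t s] by (simp add: mult.assoc)
qed

lemma loc_sub: "is_ideal J \<Longrightarrow> J \<subseteq> loc J"
  using locI[OF _ one_nonM, of _ J] ideal_sub by auto

lemma loc_mono: "J \<subseteq> J' \<Longrightarrow> loc J \<subseteq> loc J'"
  by (auto simp: loc_def)

lemma loc_least: "saturated J' \<Longrightarrow> J \<subseteq> J' \<Longrightarrow> loc J \<subseteq> J'"
  by (auto elim!: locE intro: saturatedD)

text \<open>This replaces Krull's intersection theorem and Nakayama's lemma: an element that can be
  divided by \<open>z\<close> again and again yields an ascending chain of ideals.\<close>

lemma not_infinitely_divisible:
  assumes Z: "saturated Z" and z: "z \<in> M" and Y: "Y \<subseteq> S" "Y \<inter> Z = {}" "Y \<noteq> {}"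
  obtains w where "w \<in> Y" "\<And>s r. s \<in> S - M \<Longrightarrow> r \<in> Y \<Longrightarrow> s * w - z * r \<notin> Z"
proof -
  let ?A = "(\<lambda>w. loc (add_principal Z w)) ` Y"
  have id: "is_ideal (add_principal Z w)" if "w \<in> Y" for w
    using add_principal_ideal[of Z w] saturated_ideal[OF Z] Y that by auto
  have "\<exists>J\<in>?A. \<forall>J'\<in>?A. J \<subseteq> J' \<longrightarrow> J' = J"
    by (rule acc) (use Y id loc_ideal in auto)
  then obtain w where w: "w \<in> Y" and max: "\<And>r. r \<in> Y \<Longrightarrow>
      loc (add_principal Z w) \<subseteq> loc (add_principal Z r) \<Longrightarrow>
      loc (add_principal Z r) = loc (add_principal Z w)" by auto
  have "s * w - z * r \<notin> Z" if s: "s \<in> S - M" and r: "r \<in> Y" for s r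
  proof
    assume sw: "s * w - z * r \<in> Z"
    have wS: "w \<in> S" "r \<in> S" "z \<in> S" using Y w r z M_sub by auto
    have "s * w \<in> add_principal Z r"
      using in_add_principal[OF sw, of z r] wS by (simp add: algebra_simps)
    then have "w \<in> loc (add_principal Z r)" using s wS by (intro locI) auto
    then have "loc (add_principal Z w) \<subseteq> loc (add_principal Z r)"
      using add_principal_sub[of Z r] loc_sub[OF id[OF r]] loc_saturated[OF id[OF r]]
      by (intro loc_least[OF loc_saturated[OF id[OF r]] add_principal_least[OF loc_ideal[OF id[OF r]]]])
        auto
    then have "r \<in> loc (add_principal Z w)"
      using max[OF r] loc_sub[OF id[OF r]] add_principal_self[of Z r] saturated_ideal[OF Z] by auto
    then obtain t where t: "t \<in> S - M" "t * r \<in> add_principal Z w" by (elim locE)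
    then obtain a u where au: "t * r = a + w * u" "a \<in> Z" "u \<in> S" by (auto simp: add_principal_def)
    \<comment> \<open>Up to elements of \<open>Z\<close>, \<open>s * w = z * r\<close> and, by
      maximality of the ideal of \<open>w\<close>, \<open>t * r = w * u\<close>. Hence
      \<open>s * t - z * u\<close> annihilates \<open>r\<close>, and it is a unit of the local ring
      because \<open>z\<close> lies in \<open>M\<close>.\<close>
    have "(s * t - z * u) * r = s * (t * r) - z * u * r" by (simp add: algebra_simps)
    also have "\<dots> = s * (a + w * u) - z * u * r" by (simp only: au)
    also have "\<dots> = s * a + u * (s * w - z * r)" by (simp add: algebra_simps)
    also have "\<dots> \<in> Z" using saturated_ideal[OF Z] au s sw by (auto intro!: ideal_add ideal_mult)
    finally have "(s * t - z * u) * r \<in> Z" .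
    moreover have "s * t - z * u \<in> S - M"
      using nonM_mult[OF s t(1)] z au ideal_mult_right[OF M_ideal] by (intro nonM_diff) auto
    ultimately have "r \<in> Z" using saturatedD[OF Z] wS by blast
    then show False using r Y by auto
  qed
  then show ?thesis using that w by blast
qed

lemma colon_ideal:
  assumes Z: "is_ideal Z" and w: "w \<in> S" shows "is_ideal {r \<in> S. r * w \<in> Z}"
  unfolding is_ideal_def
  using assms by (auto simp: distrib_right mult.assoc intro: ideal_add ideal_mult ideal_zero)

text \<open>The inequality between the depth and the dimension of an associated prime, with an
  annihilator in place of the prime. Replace \<open>w\<close> by an element \<open>v\<close> that
  has at least the same annihilator and is not divisible by \<open>z\<close>. It survives modulo
  \<open>z\<close>, so induction gives a chain over its annihilator there. This annihilator contains
  \<open>z\<close>, while \<open>z\<close> is a nonzerodivisor on the annihilator of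
  \<open>v\<close> modulo \<open>Z\<close>; so one more prime fits below.\<close>

lemma chain_of_annihilator:
  assumes "saturated Z" "loc_regular Z zs" "set zs \<subseteq> M" "w \<in> S" "w \<notin> Z"
  shows "prime_chain {r \<in> S. r * w \<in> Z} M (length zs)"
  using assms
proof (induction zs arbitrary: Z w)
  case Nil
  have "{r \<in> S. r * w \<in> Z} \<subseteq> M" using Nil saturatedD[of Z _ w] by auto
  then show ?case using M_prime by (auto simp: prime_chain_def intro!: exI[of _ "\<lambda>_. M"])
next
  case (Cons z zs)
  note Zi = saturated_ideal[OF Cons.prems(1)]
  have z: "z \<in> M" "z \<in> S" "nonzerodivisor_on Z z" using Cons.prems M_sub by auto
  define J where "J = {r \<in> S. r * w \<in> Z}"
  define Y where "Y = {v \<in> S. v \<notin> Z \<and> (\<forall>r\<in>J. r * v \<in> Z)}"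
  have Y: "Y \<subseteq> S" "Y \<inter> Z = {}" "w \<in> Y" using Cons.prems by (auto simp: Y_def J_def)
  then obtain v where v: "v \<in> Y" and nd: "\<And>s r. s \<in> S - M \<Longrightarrow> r \<in> Y \<Longrightarrow> s * v - z * r \<notin> Z"
    using not_infinitely_divisible[OF Cons.prems(1) z(1) Y(1,2)] by blast
  let ?Z = "loc (add_principal Z z)"
  have vS: "v \<in> S" "v \<notin> Z" using v Y by auto
  have Z'i: "is_ideal (add_principal Z z)" using Zi z add_principal_ideal by blast
  have "v \<notin> ?Z"
  proof
    assume "v \<in> ?Z"
    then obtain s where s: "s \<in> S - M" "s * v \<in> add_principal Z z" by (elim locE)
    then obtain a u where au: "s * v = a + z * u" "a \<in> Z" "u \<in> S" by (auto simp: add_principal_def)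
    \<comment> \<open>If \<open>v\<close> vanished modulo \<open>z\<close> locally, the quotient
      \<open>u\<close> would again be outside \<open>Z\<close> and killed by \<open>J\<close>, since
      \<open>z\<close> can be cancelled; this contradicts the choice of \<open>v\<close>.\<close>
    have "u \<in> Y" unfolding Y_def
    proof (intro CollectI conjI ballI au)
      show "u \<notin> Z"
      proof
        assume "u \<in> Z"
        then have "s * v \<in> Z" using au Zi z by (auto intro!: ideal_add ideal_mult)
        then show False using saturatedD[OF Cons.prems(1)] s vS by blast
      qed
      fix r assume r: "r \<in> J"
      then have rS: "r \<in> S" "r * v \<in> Z" using v by (auto simp: J_def Y_def)
      have "z * (r * u) = r * (s * v) - r * a" by (simp add: au algebra_simps)
      also have "r * (s * v) = s * (r * v)" by (simp add: algebra_simps)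
      finally have "z * (r * u) \<in> Z" using rS s au Zi by (auto intro!: ideal_diff ideal_mult)
      then show "r * u \<in> Z" using z au rS by (auto simp: nonzerodivisor_on_def)
    qed
    then show False using nd[OF s(1), of u] au by (simp add: algebra_simps)
  qed
  then have ch: "prime_chain {r \<in> S. r * v \<in> ?Z} M (length zs)"
    using Cons.prems vS loc_saturated[OF Z'i] by (intro Cons.IH) auto
  have Zsub: "Z \<subseteq> ?Z" "z \<in> ?Z"
    using add_principal_sub[of Z z] loc_sub[OF Z'i] add_principal_self[OF Zi] by auto
  have "prime_chain {r \<in> S. r * v \<in> Z} M (Suc (length zs))"
  proof (rule prime_chain_extend[OF _ _ ch])
    show "is_ideal {r \<in> S. r * v \<in> Z}" using colon_ideal Zi vS by blast
    show "nonzerodivisor_on {r \<in> S. r * v \<in> Z} z"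
      using z vS by (auto simp: nonzerodivisor_on_def mult.assoc)
    show "{r \<in> S. r * v \<in> Z} \<subseteq> {r \<in> S. r * v \<in> ?Z}" using Zsub by auto
    show "z \<in> {r \<in> S. r * v \<in> ?Z}"
      using Zsub z vS ideal_mult_right[OF loc_ideal[OF Z'i]] by auto
  qed
  moreover have "{r \<in> S. r * w \<in> Z} \<subseteq> {r \<in> S. r * v \<in> Z}" using v by (auto simp: Y_def J_def)
  ultimately show ?case using prime_chain_mono by fastforce
qed

lemma loc_regular_loc:
  assumes "is_ideal Z" "z \<in> S"
  shows "loc (add_principal (loc Z) z) = loc (add_principal Z z)"
proof
  have i: "is_ideal (add_principal Z z)" using assms add_principal_ideal by blast
  show "loc (add_principal Z z) \<subseteq> loc (add_principal (loc Z) z)"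
    using loc_sub[OF assms(1)] by (intro loc_mono) (auto simp: add_principal_def)
  have "loc Z \<subseteq> loc (add_principal Z z)" using add_principal_sub loc_mono by blast
  moreover have "z \<in> loc (add_principal Z z)"
    using add_principal_self[OF assms(1)] loc_sub[OF i] by auto
  ultimately show "loc (add_principal (loc Z) z) \<subseteq> loc (add_principal Z z)"
    by (intro loc_least[OF loc_saturated[OF i] add_principal_least[OF loc_ideal[OF i]]])
qed

lemma nonzerodivisor_on_loc:
  assumes "is_ideal Z" "z \<in> S" "nonzerodivisor_on Z z" shows "nonzerodivisor_on (loc Z) z"
  unfolding nonzerodivisor_on_def
proof (intro ballI impI)
  fix r assume r: "r \<in> S" "z * r \<in> loc Z"
  then obtain s where s: "s \<in> S - M" "s * (z * r) \<in> Z" by (elim locE)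
  then have "z * (s * r) \<in> Z" by (simp add: algebra_simps)
  then have "s * r \<in> Z" using assms s r by (auto simp: nonzerodivisor_on_def)
  then show "r \<in> loc Z" using s r by (intro locI)
qed

lemma loc_regular_of_regular:
  assumes "is_ideal Z" "set zs \<subseteq> S"
    and "\<And>i. i < length zs \<Longrightarrow> nonzerodivisor_on (foldl add_principal Z (take i zs)) (zs ! i)"
  shows "loc_regular (loc Z) zs"
  using assms
proof (induction zs arbitrary: Z)
  case (Cons z zs)
  have "nonzerodivisor_on (loc Z) z"
    using Cons.prems(3)[of 0] Cons.prems by (intro nonzerodivisor_on_loc) auto
  moreover have "loc_regular (loc (add_principal Z z)) zs"
  proof (rule Cons.IH)
    show "is_ideal (add_principal Z z)" "set zs \<subseteq> S" using Cons.prems add_principal_ideal by auto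
    show "nonzerodivisor_on (foldl add_principal (add_principal Z z) (take i zs)) (zs ! i)"
      if "i < length zs" for i
      using Cons.prems(3)[of "Suc i"] that by simp
  qed
  ultimately show ?case using loc_regular_loc Cons.prems by simp
qed simp

text \<open>The colon ideal of \<open>A\<close> by all powers of \<open>z\<close>, on which
  \<open>z\<close> becomes a nonzerodivisor; \<open>chain_of_disconnection\<close> replaces both
  components by it.\<close>

lemma iterated_colon:
  assumes A: "saturated A" and z: "z \<in> S"
  shows "saturated {r \<in> S. \<exists>k. z ^ k * r \<in> A}"
  unfolding saturated_def is_ideal_def
proof (intro conjI ballI impI)
  note Ai = saturated_ideal[OF A]
  show "0 \<in> {r \<in> S. \<exists>k. z ^ k * r \<in> A}" using ideal_zero[OF Ai] by auto
  fix a b assume "a \<in> {r \<in> S. \<exists>k. z ^ k * r \<in> A}" "b \<in> {r \<in> S. \<exists>k. z ^ k * r \<in> A}"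
  then obtain k l where kl: "a \<in> S" "b \<in> S" "z ^ k * a \<in> A" "z ^ l * b \<in> A" by auto
  have "z ^ (k + l) * (a + b) = z ^ l * (z ^ k * a) + z ^ k * (z ^ l * b)"
    by (simp add: power_add algebra_simps)
  also have "\<dots> \<in> A" using kl z ideal_mult[OF Ai] by (auto intro!: ideal_add[OF Ai])
  finally show "a + b \<in> {r \<in> S. \<exists>k. z ^ k * r \<in> A}" using kl(1,2) by (auto intro!: exI[of _ "k + l"])
next
  note Ai = saturated_ideal[OF A]
  fix s a assume s: "s \<in> S" and "a \<in> {r \<in> S. \<exists>k. z ^ k * r \<in> A}"
  then obtain k where k: "a \<in> S" "z ^ k * a \<in> A" by auto
  have "z ^ k * (s * a) = s * (z ^ k * a)" by (simp add: algebra_simps)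
  also have "\<dots> \<in> A" using k s ideal_mult[OF Ai] by blast
  finally show "s * a \<in> {r \<in> S. \<exists>k. z ^ k * r \<in> A}" using k s by auto
next
  fix s r assume s: "s \<in> S - M" "r \<in> S" and "s * r \<in> {r \<in> S. \<exists>k. z ^ k * r \<in> A}"
  then obtain k where "z ^ k * (s * r) \<in> A" by auto
  then have "s * (z ^ k * r) \<in> A" by (simp add: algebra_simps)
  then show "r \<in> {r \<in> S. \<exists>k. z ^ k * r \<in> A}"
    using saturatedD[OF A, of s "z ^ k * r"] s z by auto
qed auto

text \<open>Otherwise every element of \<open>A - Z\<close> would locally be \<open>z\<close> times
  an element of \<open>A - Z\<close>, since \<open>z\<close> can be cancelled on \<open>A\<close>,
  against \<open>not_infinitely_divisible\<close>. So a component that is nonzero in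
  \<open>S/Z\<close> stays nonzero modulo \<open>z\<close>.\<close>

lemma not_sub_add_principal:
  assumes Z: "saturated Z" and A: "saturated A" "Z \<subset> A" and z: "z \<in> M" "nonzerodivisor_on A z"
  shows "\<not> A \<subseteq> loc (add_principal Z z)"
proof
  assume sub: "A \<subseteq> loc (add_principal Z z)"
  have Ai: "is_ideal A" using A saturated_ideal by blast
  have "A - Z \<subseteq> S" "(A - Z) \<inter> Z = {}" "A - Z \<noteq> {}" using A Ai ideal_sub by auto
  then obtain w where w: "w \<in> A - Z" and nd: "\<And>s r. s \<in> S - M \<Longrightarrow> r \<in> A - Z \<Longrightarrow> s * w - z * r \<notin> Z"
    using not_infinitely_divisible[OF Z z(1)] by blast
  obtain s where s: "s \<in> S - M" "s * w \<in> add_principal Z z" using w sub by (auto elim: locE)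
  then obtain a u where au: "s * w = a + z * u" "a \<in> Z" "u \<in> S" by (auto simp: add_principal_def)
  have "s * w - a \<in> A" using w s A au(2) ideal_mult[OF Ai, of s w] by (intro ideal_diff[OF Ai]) auto
  then have "z * u \<in> A" by (simp add: au)
  then have "u \<in> A" using z au by (auto simp: nonzerodivisor_on_def)
  moreover have "u \<notin> Z"
  proof
    assume "u \<in> Z"
    then have "s * w \<in> Z"
      using au saturated_ideal[OF Z] z M_sub by (auto intro!: ideal_add ideal_mult)
    then show False using saturatedD[OF Z, of s w] w s Ai ideal_sub by blast
  qed
  ultimately show False using nd[OF s(1), of u] au by (simp add: algebra_simps)
qed

text \<open>A quantitative form of Hartshorne's connectedness theorem: \<open>S/Z\<close> embeds into
  \<open>S/A \<times> S/B\<close> with cokernel \<open>S/(A + B)\<close>. If the first element \<open>z\<close> of the regular sequence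
  is a nonzerodivisor on the cokernel, it can be divided out; otherwise the snake lemma yields
  a nonzero element of \<open>S/(Z + z)\<close> that is annihilated by \<open>A + B\<close>.\<close>

lemma chain_of_disconnection:
  assumes "saturated Z" "saturated A" "saturated B" "A \<inter> B = Z" "A \<noteq> Z" "B \<noteq> Z"
    and "loc_regular Z zs" "set zs \<subseteq> M"
  shows "prime_chain (A \<union> B) M (length zs - 1)"
  using assms
proof (induction zs arbitrary: Z A B rule: length_induct)
  case (1 zs)
  \<comment> \<open>An element of \<open>A\<close> outside \<open>M\<close> would be a unit of the
    local ring and force \<open>B\<close> into \<open>A \<inter> B = Z\<close>.\<close>
  have base: "A \<subseteq> M" if "saturated Z" "saturated A" "saturated B" "A \<inter> B = Z" "B \<noteq> Z" for Z A B
  proof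
    fix s assume s: "s \<in> A"
    show "s \<in> M"
    proof (rule ccontr)
      assume sM: "s \<notin> M"
      have "b \<in> Z" if b: "b \<in> B" for b
      proof -
        have "s \<in> S" "b \<in> S" using s b that ideal_sub saturated_ideal[OF \<open>saturated A\<close>]
          saturated_ideal[OF \<open>saturated B\<close>] by blast+
        moreover from this have "s * b \<in> A" "s * b \<in> B"
          using s b saturated_ideal[OF \<open>saturated A\<close>] saturated_ideal[OF \<open>saturated B\<close>]
          by (auto intro: ideal_mult ideal_mult_right)
        ultimately show ?thesis
          using saturatedD[OF \<open>saturated Z\<close>, of s b] sM that \<open>A \<inter> B = Z\<close> by blast
      qed
      then show False using that by blast
    qed
  qed
  show ?case
  proof (cases "length zs \<le> 1")
    case True
    have "A \<union> B \<subseteq> M" using base[of Z A B] base[of Z B A] "1.prems" by blast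
    then show ?thesis using M_prime True by (auto simp: prime_chain_def intro!: exI[of _ "\<lambda>_. M"])
  next
    case False
    then obtain z ys where zs: "zs = z # ys" "ys \<noteq> []" by (cases zs) (auto simp: Suc_le_eq)
    note Z = "1.prems"(1) note Zi = saturated_ideal[OF Z]
    have z: "z \<in> M" "z \<in> S" "nonzerodivisor_on Z z" using "1.prems" zs M_sub by auto
    \<comment> \<open>The colon ideals by the powers of \<open>z\<close> make \<open>z\<close> a
      nonzerodivisor on both components. Their intersection is still \<open>Z\<close>, because
      \<open>z\<close> is a nonzerodivisor on \<open>Z\<close>, and a chain over the larger ideals
      is also one over \<open>A \<union> B\<close>.\<close>
    define A' where "A' = {r \<in> S. \<exists>k. z ^ k * r \<in> A}"
    define B' where "B' = {r \<in> S. \<exists>k. z ^ k * r \<in> B}"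
    have A': "saturated A'" and B': "saturated B'"
      unfolding A'_def B'_def using iterated_colon "1.prems" z by blast+
    note A'i = saturated_ideal[OF A'] and B'i = saturated_ideal[OF B']
    have "A \<subseteq> A'" "B \<subseteq> B'"
    proof -
      have "C \<subseteq> {r \<in> S. \<exists>k. z ^ k * r \<in> C}" if "C \<subseteq> S" for C
      proof
        fix r assume r: "r \<in> C"
        then have "z ^ 0 * r \<in> C" by simp
        then show "r \<in> {r \<in> S. \<exists>k. z ^ k * r \<in> C}" using r that by blast
      qed
      moreover have "A \<subseteq> S" "B \<subseteq> S" using "1.prems" saturated_ideal ideal_sub by blast+
      ultimately show "A \<subseteq> A'" "B \<subseteq> B'" unfolding A'_def B'_def by blast+
    qed
    have colon: "z ^ k * r \<in> Z \<Longrightarrow> r \<in> S \<Longrightarrow> r \<in> Z" for k r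
    proof (induction k)
      case (Suc k)
      have "z * (z ^ k * r) \<in> Z" using Suc.prems(1) by (simp add: algebra_simps)
      then have "z ^ k * r \<in> Z" using Suc.prems(2) z by (simp add: nonzerodivisor_on_def)
      then show ?case using Suc.IH Suc.prems(2) by blast
    qed simp
    have int: "A' \<inter> B' = Z"
    proof
      show "Z \<subseteq> A' \<inter> B'" using \<open>A \<subseteq> A'\<close> \<open>B \<subseteq> B'\<close> "1.prems" by blast
      show "A' \<inter> B' \<subseteq> Z"
      proof
        fix r assume "r \<in> A' \<inter> B'"
        then obtain k l where r: "r \<in> S" "z ^ k * r \<in> A" "z ^ l * r \<in> B"
          by (auto simp: A'_def B'_def)
        have "z ^ (k + l) * r = z ^ l * (z ^ k * r)" "z ^ (k + l) * r = z ^ k * (z ^ l * r)"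
          by (simp_all add: power_add algebra_simps)
        moreover have "z ^ l * (z ^ k * r) \<in> A" "z ^ k * (z ^ l * r) \<in> B"
          using r z ideal_mult[OF saturated_ideal[OF "1.prems"(2)]]
            ideal_mult[OF saturated_ideal[OF "1.prems"(3)]] by auto
        ultimately have "z ^ (k + l) * r \<in> Z" using "1.prems"(4) by (metis IntI)
        then show "r \<in> Z" using colon r by blast
      qed
    qed
    have ne: "Z \<subset> A'" "Z \<subset> B'" using \<open>A \<subseteq> A'\<close> \<open>B \<subseteq> B'\<close> "1.prems" int by blast+
    have "nonzerodivisor_on {r \<in> S. \<exists>k. z ^ k * r \<in> C} z" for C
      unfolding nonzerodivisor_on_def
    proof (intro ballI impI)
      fix r assume r: "r \<in> S" "z * r \<in> {r \<in> S. \<exists>k. z ^ k * r \<in> C}"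
      then obtain k where "z ^ k * (z * r) \<in> C" by auto
      then have "z ^ Suc k * r \<in> C" by (simp add: algebra_simps)
      then show "r \<in> {r \<in> S. \<exists>k. z ^ k * r \<in> C}" using r by blast
    qed
    then have zA: "nonzerodivisor_on A' z" and zB: "nonzerodivisor_on B' z"
      unfolding A'_def B'_def by blast+
    define J where "J = {a + b |a b. a \<in> A' \<and> b \<in> B'}"
    have J: "is_ideal J" unfolding is_ideal_def
    proof (intro conjI ballI)
      show "J \<subseteq> S" using ideal_sub[OF A'i] ideal_sub[OF B'i] by (auto simp: J_def)
      have "0 + 0 \<in> J" unfolding J_def using ideal_zero A'i B'i by blast
      then show "0 \<in> J" by simp
      show "x + y \<in> J" if x: "x \<in> J" and y: "y \<in> J" for x y
      proof -
        obtain a b c d where "x = a + b" "y = c + d" "a \<in> A'" "b \<in> B'" "c \<in> A'" "d \<in> B'"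
          using x y by (auto simp: J_def)
        moreover from this have "x + y = (a + c) + (b + d)" by simp
        ultimately show ?thesis unfolding J_def using ideal_add A'i B'i by blast
      qed
      show "s * x \<in> J" if s: "s \<in> S" and x: "x \<in> J" for s x
      proof -
        obtain a b where "x = a + b" "a \<in> A'" "b \<in> B'" using x by (auto simp: J_def)
        moreover from this have "s * x = s * a + s * b" by (simp add: algebra_simps)
        ultimately show ?thesis unfolding J_def using s ideal_mult A'i B'i by blast
      qed
    qed
    have A'J: "A' \<subseteq> J" "B' \<subseteq> J"
    proof -
      have "a + 0 \<in> J" if "a \<in> A'" for a unfolding J_def using that ideal_zero[OF B'i] by blast
      then show "A' \<subseteq> J" by auto
      have "0 + b \<in> J" if "b \<in> B'" for b unfolding J_def using that ideal_zero[OF A'i] by blast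
      then show "B' \<subseteq> J" by auto
    qed
    let ?l = "\<lambda>C. loc (add_principal C z)"
    have Zz: "saturated (?l Z)" using loc_saturated add_principal_ideal Zi z by blast
    have reg: "loc_regular (?l Z) ys" "set ys \<subseteq> M" using "1.prems" zs by auto
    have "prime_chain (A' \<union> B') M (length ys)"
    proof (cases "nonzerodivisor_on (loc J) z")
      case True
      have sat: "saturated (?l A')" "saturated (?l B')"
        using loc_saturated add_principal_ideal A'i B'i z by blast+
      have sub: "?l Z \<subseteq> ?l A'" "?l Z \<subseteq> ?l B'"
        using ne by (intro loc_mono; auto simp: add_principal_def)+
      have "?l A' \<inter> ?l B' \<subseteq> ?l Z"
      proof
        fix r assume "r \<in> ?l A' \<inter> ?l B'"
        then obtain s t where st: "s \<in> S - M" "t \<in> S - M" "r \<in> S" "s * r \<in> add_principal A' z"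
          "t * r \<in> add_principal B' z" by (auto simp: loc_def)
        then obtain a p b q where ab: "s * r = a + z * p" "a \<in> A'" "p \<in> S"
          "t * r = b + z * q" "b \<in> B'" "q \<in> S" by (auto simp: add_principal_def)
        have abS: "a \<in> S" "b \<in> S" using ab A'i B'i ideal_sub by blast+
        \<comment> \<open>There are two expressions of \<open>r\<close>, one for each component.
          Comparing them puts \<open>z * (s * q - t * p)\<close> into \<open>J\<close>. After
          cancelling \<open>z\<close>, the difference of the quotients splits into a part from
          \<open>A'\<close> and one from \<open>B'\<close>, which corrects the remainder until it
          lies in both components.\<close>
        have "z * (s * q - t * p) = t * (s * r - z * p) - s * (t * r - z * q)"
          by (simp add: algebra_simps)
        also have "\<dots> = t * a + (- s) * b" by (simp add: ab(1,4))
        also have "\<dots> \<in> J" unfolding J_def using ab st A'i B'i ideal_mult uminus_mem by blast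
        finally have "z * (s * q - t * p) \<in> loc J" using loc_sub[OF J] by blast
        then have "s * q - t * p \<in> loc J"
          using True st ab by (auto simp: nonzerodivisor_on_def)
        then obtain u where u: "u \<in> S - M" "u * (s * q - t * p) \<in> J" by (elim locE)
        then obtain a' b' where ab': "u * (s * q - t * p) = a' + b'" "a' \<in> A'" "b' \<in> B'"
          by (auto simp: J_def)
        have ab'S: "a' \<in> S" "b' \<in> S" using ab' A'i B'i ideal_sub by blast+
        let ?e = "u * t * a - z * a'"
        have "?e = u * t * (s * r - z * p) - z * a'" by (simp add: ab(1))
        also have "\<dots> = u * s * (t * r - z * q) + z * (u * (s * q - t * p)) - z * a'"
          by (simp add: algebra_simps)
        also have "t * r - z * q = b" by (simp add: ab(4))
        also have "u * s * b + z * (u * (s * q - t * p)) - z * a' = u * s * b + z * b'"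
          unfolding ab'(1) by (simp add: algebra_simps)
        finally have e: "?e = u * s * b + z * b'" .
        have "?e \<in> A'" using ab(2) ab'(2) u st z ideal_mult[OF A'i, of "u * t" a]
            ideal_mult[OF A'i, of z a'] by (intro ideal_diff[OF A'i]) auto
        moreover have "?e \<in> B'" unfolding e using ab(5) ab'(3) u st z
            ideal_mult[OF B'i, of "u * s" b] ideal_mult[OF B'i, of z b'] by (intro ideal_add[OF B'i]) auto
        ultimately have "?e \<in> Z" using int by blast
        moreover have "u * t * s * r = ?e + z * (a' + u * t * p)"
        proof -
          have "u * t * s * r = u * t * (s * r)" by (simp add: algebra_simps)
          also have "\<dots> = u * t * (a + z * p)" by (simp only: ab(1))
          finally show ?thesis by (simp add: algebra_simps)
        qed
        moreover have "a' + u * t * p \<in> S" using ab'S u st ab by auto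
        ultimately have "(u * t * s) * r \<in> add_principal Z z"
          using in_add_principal by metis
        then show "r \<in> ?l Z" using st u nonM_mult by (intro locI) auto
      qed
      then have int': "?l A' \<inter> ?l B' = ?l Z" using sub by blast
      have "\<not> A' \<subseteq> ?l Z" "\<not> B' \<subseteq> ?l Z"
        using not_sub_add_principal[OF Z] A' B' ne z zA zB by blast+
      moreover have A'l: "A' \<subseteq> ?l A'" "B' \<subseteq> ?l B'"
        using add_principal_sub loc_sub add_principal_ideal A'i B'i z by blast+
      ultimately have "?l A' \<noteq> ?l Z" "?l B' \<noteq> ?l Z" by blast+
      then have "prime_chain (?l A' \<union> ?l B') M (length ys - 1)"
        using "1.IH" zs Zz sat int' reg by auto
      moreover have "loc J \<subseteq> loc (add_principal J z)" using add_principal_sub loc_mono by blast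
      \<comment> \<open>The chain obtained modulo \<open>z\<close> starts above \<open>J\<close> and
        \<open>z\<close>. As \<open>z\<close> is a nonzerodivisor on \<open>loc J\<close>, one prime
        over \<open>J\<close> can be added below, which makes up for the element lost in the
        induction.\<close>
      moreover have "loc J \<subseteq> J''" if "is_prime J''" "?l A' \<union> ?l B' \<subseteq> J''" "J'' \<subseteq> M" for J''
      proof
        fix r assume "r \<in> loc J"
        then obtain s where s: "s \<in> S - M" "r \<in> S" "s * r \<in> J" by (elim locE)
        then obtain a b where "s * r = a + b" "a \<in> A'" "b \<in> B'" by (auto simp: J_def)
        moreover from this have "a \<in> J''" "b \<in> J''" using A'l that(2) by blast+
        ultimately have "s * r \<in> J''" using prime_ideal[OF that(1)] ideal_add[of J'' a b] by simp
        then show "r \<in> J''" using that s prime_cases[of J'' s r] by auto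
      qed
      ultimately have "prime_chain (loc J \<union> ?l A') M (length ys - 1)"
        unfolding prime_chain_def
      proof (elim exE conjE)
        fix Q assume Q: "\<forall>i\<le>length ys - 1. is_prime (Q i)" "\<forall>i<length ys - 1. Q i \<subset> Q (Suc i)"
          "?l A' \<union> ?l B' \<subseteq> Q 0" "Q (length ys - 1) \<subseteq> M"
        have "Q 0 \<subseteq> Q i" if "i \<le> length ys - 1" for i
          using that Q(2) by (induction i) (auto simp: Suc_le_eq)
        then have "Q 0 \<subseteq> M" using Q by blast
        then have "loc J \<subseteq> Q 0"
          using Q \<open>\<And>J''. is_prime J'' \<Longrightarrow> ?l A' \<union> ?l B' \<subseteq> J'' \<Longrightarrow> J'' \<subseteq> M \<Longrightarrow> loc J \<subseteq> J''\<close> by simp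
        then show "\<exists>Q. (\<forall>i\<le>length ys - 1. is_prime (Q i)) \<and> (\<forall>i<length ys - 1. Q i \<subset> Q (Suc i)) \<and>
            loc J \<union> ?l A' \<subseteq> Q 0 \<and> Q (length ys - 1) \<subseteq> M" using Q by blast
      qed
      then have "prime_chain (loc J) M (Suc (length ys - 1))"
      proof (rule prime_chain_extend[OF loc_ideal[OF J] True])
        have "z \<in> ?l A'"
          using add_principal_self[OF A'i] loc_sub add_principal_ideal[OF A'i z(2)] by blast
        then show "z \<in> loc J \<union> ?l A'" by blast
      qed auto
      then show ?thesis using zs A'J loc_sub[OF J] by (auto elim!: prime_chain_mono)
    next
      case False
      then obtain c where c: "c \<in> S" "z * c \<in> loc J" "c \<notin> loc J"
        by (auto simp: nonzerodivisor_on_def)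
      then obtain s where s: "s \<in> S - M" "s * (z * c) \<in> J" by (elim locE)
      then obtain a b where "s * (z * c) = a + b" and ab: "a \<in> A'" "b \<in> B'"
        by (auto simp: J_def)
      then have zc: "z * (s * c) = a + b" by (simp add: algebra_simps)
      have scJ: "s * c \<notin> loc J"
        using c s saturatedD[OF loc_saturated[OF J], of s c] by blast
      have abS: "a \<in> S" "b \<in> S" using ab A'i B'i ideal_sub by blast+
      \<comment> \<open>\<open>a\<close> represents the image of \<open>s * c\<close> under the
        connecting homomorphism; if it vanished modulo \<open>z\<close>, then \<open>s * c\<close>
        would be a sum from \<open>A'\<close> and \<open>B'\<close> up to a unit and lie in
        \<open>loc J\<close>.\<close>
      have "a \<notin> ?l Z"
      proof
        assume "a \<in> ?l Z"
        then obtain t where t: "t \<in> S - M" "t * a \<in> add_principal Z z" by (elim locE)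
        then obtain x u where xu: "t * a = x + z * u" "x \<in> Z" "u \<in> S"
          by (auto simp: add_principal_def)
        have xAB: "x \<in> A'" "x \<in> B'" using xu int by auto
        have "z * u = t * a - x" by (simp add: xu)
        also have "\<dots> \<in> A'" using ab t xAB A'i by (auto intro!: ideal_diff ideal_mult)
        finally have uA: "u \<in> A'" using zA xu by (auto simp: nonzerodivisor_on_def)
        have "z * (t * (s * c) - u) = t * (z * (s * c)) - z * u" by (simp add: algebra_simps)
        also have "\<dots> = t * a + t * b - z * u" by (simp only: zc distrib_left)
        also have "\<dots> = x + t * b" by (simp add: xu)
        also have "\<dots> \<in> B'" using ab t xAB B'i by (auto intro!: ideal_add ideal_mult)
        finally have uB: "t * (s * c) - u \<in> B'"
          using zB xu t s c by (auto simp: nonzerodivisor_on_def)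
        have "t * (s * c) \<in> J"
          using ideal_add[OF J, of "t * (s * c) - u" u] uA uB A'J by auto
        then have "s * c \<in> loc J" using t s c by (intro locI[of _ t]) auto
        then show False using scJ by blast
      qed
      then have "prime_chain {r \<in> S. r * a \<in> ?l Z} M (length ys)"
        using chain_of_annihilator[OF Zz reg] abS by blast
      \<comment> \<open>\<open>B'\<close> kills \<open>a\<close>, since the products lie in both
        components. Likewise \<open>A'\<close> kills \<open>b\<close>, and hence also
        \<open>a\<close>, which is \<open>- b\<close> modulo \<open>z\<close>.\<close>
      moreover have "A' \<union> B' \<subseteq> {r \<in> S. r * a \<in> ?l Z}"
      proof -
        have Zl: "Z \<subseteq> ?l Z" "add_principal Z z \<subseteq> ?l Z"
          using add_principal_sub loc_sub add_principal_ideal[OF Zi z(2)] by blast+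
        have "r * a \<in> ?l Z" if r: "r \<in> B'" for r
        proof -
          have "r * a \<in> A'" using r ab A'i B'i ideal_mult ideal_sub by blast
          moreover have "r * a \<in> B'" using r abS B'i ideal_mult_right by blast
          ultimately show ?thesis using int Zl by blast
        qed
        moreover have "r * a \<in> ?l Z" if r: "r \<in> A'" for r
        proof -
          have rS: "r \<in> S" using r A'i ideal_sub by blast
          have "r * b \<in> A'" using r abS A'i ideal_mult_right by blast
          moreover have "r * b \<in> B'" using r ab rS B'i ideal_mult by blast
          ultimately have rb: "- (r * b) \<in> Z" using int Zi ideal_uminus by blast
          have "r * a = r * (a + b) - r * b" by (simp add: algebra_simps)
          also have "a + b = z * (s * c)" by (simp only: zc)
          also have "r * (z * (s * c)) - r * b = - (r * b) + z * (r * (s * c))" by (simp add: algebra_simps)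
          also have "\<dots> \<in> add_principal Z z" using rb rS s c by (intro in_add_principal) auto
          finally show ?thesis using Zl by blast
        qed
        ultimately show ?thesis using ideal_sub A'i B'i by blast
      qed
      ultimately show ?thesis using prime_chain_mono by blast
    qed
    then show ?thesis using \<open>A \<subseteq> A'\<close> \<open>B \<subseteq> B'\<close> zs by (auto elim!: prime_chain_mono)
  qed
qed

end

section \<open>Polynomials over a field\<close>

type_synonym ('v, 'k) mpoly = "('v \<Rightarrow>\<^sub>0 nat) \<Rightarrow>\<^sub>0 'k"

definition Const :: "'k::field \<Rightarrow> ('v, 'k) mpoly" where
  "Const c = Poly_Mapping.single 0 c"

definition monomial :: "('v \<Rightarrow>\<^sub>0 nat) \<Rightarrow> ('v, 'k::field) mpoly" where
  "monomial m = Poly_Mapping.single m 1"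

definition indet :: "'v \<Rightarrow> ('v, 'k::field) mpoly" where
  "indet v = monomial (Poly_Mapping.single v 1)"

definition total_deg :: "('v \<Rightarrow>\<^sub>0 nat) \<Rightarrow> nat" where
  "total_deg m = (\<Sum>v\<in>Poly_Mapping.keys m. Poly_Mapping.lookup m v)"

definition restrict_mono :: "(('v \<Rightarrow>\<^sub>0 nat) \<Rightarrow> bool) \<Rightarrow> ('v, 'k::field) mpoly \<Rightarrow> ('v, 'k) mpoly" where
  "restrict_mono P f = Poly_Mapping.mapp (\<lambda>m c. c when P m) f"

lemma Const_simps [simp]: "Const 0 = 0" "Const 1 = 1"
  by (simp_all add: Const_def)

lemma Const_add: "Const (a + b) = Const a + Const b"
  by (simp add: Const_def single_add)

lemma Const_mult: "Const (a * b) = Const a * Const b"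
  by (simp add: Const_def mult_single)

lemma Const_uminus: "Const (- a) = - Const a"
  by (simp add: Const_def single_uminus)

lemma monomial_zero [simp]: "monomial 0 = 1"
  by (simp add: monomial_def)

lemma monomial_add: "monomial (m + m') = monomial m * monomial m'"
  by (simp add: monomial_def mult_single)

lemma Const_monomial: "Const c * monomial m = Poly_Mapping.single m c"
  by (simp add: Const_def monomial_def mult_single)

lemma keys_monomial [simp]: "Poly_Mapping.keys (monomial m :: ('v, 'k::field) mpoly) = {m}"
  by (simp add: monomial_def)

lemma keys_Const: "Poly_Mapping.keys (Const c) \<subseteq> {0}"
  by (simp add: Const_def)

lemma keys_add_nat: "Poly_Mapping.keys (m + m' :: 'v \<Rightarrow>\<^sub>0 nat) = Poly_Mapping.keys m \<union> Poly_Mapping.keys m'"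
  by (auto simp: in_keys_iff lookup_add)

lemma lookup_restrict_mono:
  "Poly_Mapping.lookup (restrict_mono P f) m = (Poly_Mapping.lookup f m when P m)"
  by (auto simp: restrict_mono_def lookup_mapp when_def in_keys_iff)

lemma keys_restrict_mono: "Poly_Mapping.keys (restrict_mono P f) = {m \<in> Poly_Mapping.keys f. P m}"
  by (auto simp: in_keys_iff lookup_restrict_mono when_def split: if_splits)

lemma poly_sum_monos: "(f :: ('v, 'k::field) mpoly) =
    (\<Sum>m\<in>Poly_Mapping.keys f. Const (Poly_Mapping.lookup f m) * monomial m)"
proof (rule poly_mapping_eqI)
  fix k
  have "Poly_Mapping.lookup (\<Sum>m\<in>Poly_Mapping.keys f. Const (Poly_Mapping.lookup f m) * monomial m) k
      = (\<Sum>m\<in>Poly_Mapping.keys f. if m = k then Poly_Mapping.lookup f k else 0)"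
    by (auto simp: lookup_sum Const_monomial lookup_single when_def intro!: sum.cong)
  also have "\<dots> = Poly_Mapping.lookup f k" by (auto simp: in_keys_iff)
  finally show "Poly_Mapping.lookup f k =
      Poly_Mapping.lookup (\<Sum>m\<in>Poly_Mapping.keys f. Const (Poly_Mapping.lookup f m) * monomial m) k" by simp
qed

lemma total_deg_sum: "finite A \<Longrightarrow> Poly_Mapping.keys m \<subseteq> A \<Longrightarrow> total_deg m = (\<Sum>v\<in>A. Poly_Mapping.lookup m v)"
  unfolding total_deg_def by (intro sum.mono_neutral_left) (auto simp: in_keys_iff)

lemma total_deg_add: "total_deg (m + m') = total_deg m + total_deg m'"
proof -
  let ?A = "Poly_Mapping.keys m \<union> Poly_Mapping.keys m'"
  show ?thesis
    using total_deg_sum[of ?A m] total_deg_sum[of ?A m'] total_deg_sum[of ?A "m + m'"]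
    by (simp add: keys_add_nat lookup_add sum.distrib)
qed

lemma total_deg_single [simp]: "total_deg (Poly_Mapping.single v k) = k"
  by (simp add: total_deg_def)

lemma total_deg_zero [simp]: "total_deg 0 = 0"
  by (simp add: total_deg_def)

lemma lookup_le_total_deg: "Poly_Mapping.lookup m v \<le> total_deg m"
  unfolding total_deg_def by (cases "v \<in> Poly_Mapping.keys m") (auto intro: member_le_sum simp: in_keys_iff)

subsection \<open>The polynomial ring on a finite set of variables\<close>

definition polys :: "'v set \<Rightarrow> ('v, 'k::field) mpoly set" where
  "polys W = {p. \<forall>m\<in>Poly_Mapping.keys p. Poly_Mapping.keys m \<subseteq> W}"

lemma polys_closed: "p \<in> polys W \<Longrightarrow> q \<in> polys W \<Longrightarrow> p + q \<in> polys W"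
  "p \<in> polys W \<Longrightarrow> q \<in> polys W \<Longrightarrow> p * q \<in> polys W"
  "p \<in> polys W \<Longrightarrow> - p \<in> polys W"
proof -
  assume pq: "p \<in> polys W" "q \<in> polys W"
  show "p + q \<in> polys W" using pq Poly_Mapping.keys_add[of p q] by (fastforce simp: polys_def)
  show "p * q \<in> polys W" using pq keys_mult[of p q] by (fastforce simp: polys_def keys_add_nat)
qed (simp add: polys_def)

interpretation polys: comm_subring "polys W :: ('v, 'k::field) mpoly set" for W
  by unfold_locales (auto simp: polys_closed, auto simp: polys_def)

lemma polys_monomial_mem: "monomial m \<in> polys W \<longleftrightarrow> Poly_Mapping.keys m \<subseteq> W"
  by (auto simp: polys_def)

lemma polys_Const [simp]: "Const c \<in> polys W"
  using keys_Const[of c] by (fastforce simp: polys_def)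

lemma polys_indet: "v \<in> W \<Longrightarrow> indet v \<in> polys W"
  by (auto simp: indet_def polys_def)

lemma polys_mono: "W \<subseteq> W' \<Longrightarrow> polys W \<subseteq> polys W'"
  by (fastforce simp: polys_def)

lemma polys_restrict: "f \<in> polys W \<Longrightarrow> restrict_mono P f \<in> polys W"
  by (auto simp: polys_def keys_restrict_mono)

section \<open>Lexicographic order, leading monomials and the Hilbert basis theorem\<close>

definition less_expo :: "'v list \<Rightarrow> ('v \<Rightarrow>\<^sub>0 nat) \<Rightarrow> ('v \<Rightarrow>\<^sub>0 nat) \<Rightarrow> bool" where
  "less_expo vs m m' \<longleftrightarrow>
     (\<exists>i<length vs. (\<forall>j<i. Poly_Mapping.lookup m (vs ! j) = Poly_Mapping.lookup m' (vs ! j)) \<and>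
        Poly_Mapping.lookup m (vs ! i) < Poly_Mapping.lookup m' (vs ! i))"

text \<open>Exponents are compared as lists of the fixed length of \<open>vs\<close>, on which the
  lexicographic order is well-founded; coordinates outside \<open>vs\<close> are ignored.\<close>

lemma wfp_less_expo: "wfp (less_expo vs)"
proof -
  have "(map (Poly_Mapping.lookup m) vs, map (Poly_Mapping.lookup m') vs) \<in> lex less_than"
    if lt: "less_expo vs m m'" for m m'
  proof -
    obtain i where i: "i < length vs" "\<forall>j<i. Poly_Mapping.lookup m (vs ! j) = Poly_Mapping.lookup m' (vs ! j)"
      "Poly_Mapping.lookup m (vs ! i) < Poly_Mapping.lookup m' (vs ! i)"
      using lt by (auto simp: less_expo_def)
    let ?f = "Poly_Mapping.lookup m" and ?g = "Poly_Mapping.lookup m'"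
    have "map h vs = map h (take i vs) @ h (vs ! i) # map h (drop (Suc i) vs)" for h :: "'a \<Rightarrow> nat"
      using i(1) by (metis id_take_nth_drop list.simps(9) map_append)
    moreover have "map ?f (take i vs) = map ?g (take i vs)"
      using i by (auto simp: list_eq_iff_nth_eq)
    ultimately show ?thesis
      unfolding lex_conv using i(3)
      by (auto intro!: exI[of _ "map ?f (take i vs)"])
  qed
  then have "{(m, m'). less_expo vs m m'} \<subseteq> inv_image (lex less_than) (\<lambda>m. map (Poly_Mapping.lookup m) vs)"
    by (auto simp: inv_image_def)
  then show ?thesis
    unfolding wfp_def using wf_subset wf_inv_image wf_lex wf_less_than by blast
qed

lemma less_expo_trans: "less_expo vs a b \<Longrightarrow> less_expo vs b c \<Longrightarrow> less_expo vs a c"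
proof -
  assume "less_expo vs a b" "less_expo vs b c"
  then obtain i j where i: "i < length vs" "\<forall>k<i. Poly_Mapping.lookup a (vs ! k) = Poly_Mapping.lookup b (vs ! k)"
      "Poly_Mapping.lookup a (vs ! i) < Poly_Mapping.lookup b (vs ! i)"
    and j: "j < length vs" "\<forall>k<j. Poly_Mapping.lookup b (vs ! k) = Poly_Mapping.lookup c (vs ! k)"
      "Poly_Mapping.lookup b (vs ! j) < Poly_Mapping.lookup c (vs ! j)"
    by (auto simp: less_expo_def)
  have "\<forall>k<min i j. Poly_Mapping.lookup a (vs ! k) = Poly_Mapping.lookup c (vs ! k)" using i(2) j(2) by simp
  moreover have "Poly_Mapping.lookup a (vs ! min i j) < Poly_Mapping.lookup c (vs ! min i j)"
  proof (cases i j rule: linorder_cases)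
    case less
    then have "Poly_Mapping.lookup b (vs ! i) = Poly_Mapping.lookup c (vs ! i)" using j(2) by blast
    then show ?thesis using i(3) less by (simp add: min_def)
  next
    case equal
    then show ?thesis using i(3) j(3) by simp
  next
    case greater
    then have "Poly_Mapping.lookup a (vs ! j) = Poly_Mapping.lookup b (vs ! j)" using i(2) by blast
    then show ?thesis using j(3) greater by (simp add: min_def)
  qed
  moreover have "min i j < length vs" using i(1) by simp
  ultimately show "less_expo vs a c" unfolding less_expo_def by (intro exI[of _ "min i j"] conjI)
qed

lemma less_expo_irrefl: "\<not> less_expo vs a a"
  by (auto simp: less_expo_def)

lemma less_expo_add: "less_expo vs a b \<Longrightarrow> less_expo vs (a + c) (b + c)"
  by (simp add: less_expo_def lookup_add)

lemma less_expo_total: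
  assumes "Poly_Mapping.keys a \<subseteq> set vs" "Poly_Mapping.keys b \<subseteq> set vs" "a \<noteq> b"
  shows "less_expo vs a b \<or> less_expo vs b a"
proof -
  have "\<exists>v. Poly_Mapping.lookup a v \<noteq> Poly_Mapping.lookup b v"
    using assms(3) by (metis poly_mapping_eqI)
  then obtain v where v: "Poly_Mapping.lookup a v \<noteq> Poly_Mapping.lookup b v" ..
  then have "v \<in> Poly_Mapping.keys a \<union> Poly_Mapping.keys b" by (auto simp: in_keys_iff)
  then have "v \<in> set vs" using assms by blast
  then have ex: "\<exists>i. i < length vs \<and> Poly_Mapping.lookup a (vs ! i) \<noteq> Poly_Mapping.lookup b (vs ! i)"
    using v by (auto simp: in_set_conv_nth)
  define i where "i = (LEAST i. i < length vs \<and> Poly_Mapping.lookup a (vs ! i) \<noteq> Poly_Mapping.lookup b (vs ! i))"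
  have i: "i < length vs" "Poly_Mapping.lookup a (vs ! i) \<noteq> Poly_Mapping.lookup b (vs ! i)"
    using LeastI_ex[OF ex] by (auto simp: i_def)
  have "\<forall>j<i. Poly_Mapping.lookup a (vs ! j) = Poly_Mapping.lookup b (vs ! j)"
  proof (intro allI impI)
    fix j assume "j < i"
    then show "Poly_Mapping.lookup a (vs ! j) = Poly_Mapping.lookup b (vs ! j)"
      using not_less_Least[of j "\<lambda>i. i < length vs \<and> Poly_Mapping.lookup a (vs ! i) \<noteq> Poly_Mapping.lookup b (vs ! i)"] i(1)
      by (simp add: i_def)
  qed
  then show ?thesis using i unfolding less_expo_def
    by (cases "Poly_Mapping.lookup a (vs ! i) < Poly_Mapping.lookup b (vs ! i)")
      (blast, metis linorder_neqE_nat)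
qed

definition lead_mono :: "'v list \<Rightarrow> ('v, 'k::field) mpoly \<Rightarrow> ('v \<Rightarrow>\<^sub>0 nat)" where
  "lead_mono vs f = (SOME m. m \<in> Poly_Mapping.keys f \<and> (\<forall>m'\<in>Poly_Mapping.keys f. m' = m \<or> less_expo vs m' m))"

lemma lead_mono:
  assumes f: "f \<in> polys (set vs)" "f \<noteq> 0"
  shows "lead_mono vs f \<in> Poly_Mapping.keys f"
    and "m' \<in> Poly_Mapping.keys f \<Longrightarrow> m' = lead_mono vs f \<or> less_expo vs m' (lead_mono vs f)"
proof -
  have "\<exists>m\<in>A. \<forall>m'\<in>A. m' = m \<or> less_expo vs m' m"
    if "finite A" "A \<noteq> {}" "\<forall>m\<in>A. Poly_Mapping.keys m \<subseteq> set vs" for A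
    using that
  proof (induction A rule: finite_ne_induct)
    case (insert x F)
    then obtain m where m: "m \<in> F" "\<forall>m'\<in>F. m' = m \<or> less_expo vs m' m" by auto
    show ?case
    proof (cases "less_expo vs m x")
      case True
      have "m' = x \<or> less_expo vs m' x" if "m' \<in> insert x F" for m'
        using that m True less_expo_trans[of vs m' m x] by auto
      then show ?thesis by (intro bexI[of _ x]) auto
    next
      case False
      then have "x = m \<or> less_expo vs x m" using less_expo_total[of x vs m] insert m by auto
      then show ?thesis using m by blast
    qed
  qed auto
  from this[of "Poly_Mapping.keys f"] f
  have "\<exists>m. m \<in> Poly_Mapping.keys f \<and> (\<forall>m'\<in>Poly_Mapping.keys f. m' = m \<or> less_expo vs m' m)"
    by (auto simp: polys_def)
  from someI_ex[OF this] show "lead_mono vs f \<in> Poly_Mapping.keys f"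
    "m' \<in> Poly_Mapping.keys f \<Longrightarrow> m' = lead_mono vs f \<or> less_expo vs m' (lead_mono vs f)"
    by (auto simp: lead_mono_def)
qed

text \<open>Every other pair of monomials has a strictly smaller sum, so this coefficient is the
  product of the two leading coefficients.\<close>

lemma lookup_lead_mono_mult:
  fixes f g :: "('v, 'k::field) mpoly"
  assumes "f \<in> polys (set vs)" "g \<in> polys (set vs)" "f \<noteq> 0" "g \<noteq> 0"
  shows "Poly_Mapping.lookup (f * g) (lead_mono vs f + lead_mono vs g) \<noteq> 0"
proof -
  define a b where "a = lead_mono vs f" and "b = lead_mono vs g"
  have a: "a \<in> Poly_Mapping.keys f" "\<And>m. m \<in> Poly_Mapping.keys f \<Longrightarrow> m = a \<or> less_expo vs m a"
    and b: "b \<in> Poly_Mapping.keys g" "\<And>m. m \<in> Poly_Mapping.keys g \<Longrightarrow> m = b \<or> less_expo vs m b"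
    using lead_mono[of f vs] lead_mono[of g vs] assms by (auto simp: a_def b_def)
  let ?cf = "Poly_Mapping.lookup f a" and ?cg = "Poly_Mapping.lookup g b"
  define f' g' where "f' = restrict_mono (\<lambda>m. m \<noteq> a) f" and "g' = restrict_mono (\<lambda>m. m \<noteq> b) g"
  have fg: "f = Poly_Mapping.single a ?cf + f'" "g = Poly_Mapping.single b ?cg + g'"
    by (auto simp: f'_def g'_def lookup_add lookup_single lookup_restrict_mono when_def intro!: poly_mapping_eqI)
  have less: "less_expo vs (m + m') (a + b)"
    if "m = a \<or> less_expo vs m a" "m' = b \<or> less_expo vs m' b" "m \<noteq> a \<or> m' \<noteq> b" for m m'
    using that less_expo_add[of vs m a m'] less_expo_add[of vs m' b a] less_expo_trans[of vs "m + m'" "a + m'" "a + b"]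
    by (auto simp: add.commute)
  have nk: "a + b \<notin> Poly_Mapping.keys (p * q)"
    if "\<forall>m\<in>Poly_Mapping.keys p. m = a \<or> less_expo vs m a" "\<forall>m\<in>Poly_Mapping.keys q. m = b \<or> less_expo vs m b"
      "a \<notin> Poly_Mapping.keys p \<or> b \<notin> Poly_Mapping.keys q" for p q :: "('v, 'k) mpoly"
  proof
    assume "a + b \<in> Poly_Mapping.keys (p * q)"
    then obtain m m' where "a + b = m + m'" "m \<in> Poly_Mapping.keys p" "m' \<in> Poly_Mapping.keys q"
      using keys_mult[of p q] by blast
    moreover from this have "less_expo vs (m + m') (a + b)" using that by (intro less) auto
    ultimately show False using less_expo_irrefl by metis
  qed
  have kf': "\<forall>m\<in>Poly_Mapping.keys f'. m = a \<or> less_expo vs m a" "a \<notin> Poly_Mapping.keys f'"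
    and kg': "\<forall>m\<in>Poly_Mapping.keys g'. m = b \<or> less_expo vs m b" "b \<notin> Poly_Mapping.keys g'"
    using a b by (auto simp: f'_def g'_def keys_restrict_mono)
  have "f * g = Poly_Mapping.single (a + b) (?cf * ?cg) + (Poly_Mapping.single a ?cf * g' + f' * g)"
  proof -
    have "f * g = Poly_Mapping.single a ?cf * g + f' * g" by (subst fg(1)) (simp add: distrib_right)
    also have "Poly_Mapping.single a ?cf * g = Poly_Mapping.single a ?cf * (Poly_Mapping.single b ?cg + g')"
      using fg(2) by simp
    finally show ?thesis by (simp add: distrib_left mult_single add.assoc)
  qed
  then have "Poly_Mapping.lookup (f * g) (a + b) = ?cf * ?cg + (Poly_Mapping.lookup (Poly_Mapping.single a ?cf * g') (a + b)
      + Poly_Mapping.lookup (f' * g) (a + b))"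
    by (simp add: lookup_add)
  moreover have "Poly_Mapping.lookup (Poly_Mapping.single a ?cf * g') (a + b) = 0"
    using nk[of "Poly_Mapping.single a ?cf" g'] kg' by (simp add: in_keys_iff split: if_splits)
  moreover have "Poly_Mapping.lookup (f' * g) (a + b) = 0"
    using nk[of f' g] kf' b by (simp add: in_keys_iff)
  ultimately have "Poly_Mapping.lookup (f * g) (a + b) \<noteq> 0" using a(1) b(1) by (simp add: in_keys_iff)
  then show ?thesis by (simp add: a_def b_def)
qed

lemma polys_no_zero_divisors:
  fixes f g :: "('v, 'k::field) mpoly"
  assumes "finite W" "f \<in> polys W" "g \<in> polys W" "f \<noteq> 0" "g \<noteq> 0"
  shows "f * g \<noteq> 0"
proof -
  obtain vs where "set vs = W" using finite_list assms by blast
  then show ?thesis using lookup_lead_mono_mult[of f vs g] assms by auto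
qed

text \<open>Let \<open>B\<close> serve for the other coordinates and let \<open>N\<close> bound its
  values at \<open>v\<close>. An element with value at least \<open>N\<close> at \<open>v\<close>
  lies above a member of \<open>B\<close> in all coordinates; the finitely many slices with a
  smaller value are served separately by the induction hypothesis.\<close>

lemma dickson:
  fixes A :: "('v \<Rightarrow>\<^sub>0 nat) set"
  assumes "finite V"
  shows "\<exists>B\<subseteq>A. finite B \<and> (\<forall>a\<in>A. \<exists>b\<in>B. \<forall>v\<in>V. Poly_Mapping.lookup b v \<le> Poly_Mapping.lookup a v)"
  using assms
proof (induction V arbitrary: A rule: finite_induct)
  case empty
  show ?case
  proof (cases "A = {}")
    case False
    then obtain a where "a \<in> A" by blast
    then show ?thesis by (intro exI[of _ "{a}"]) auto
  qed auto
next
  case (insert v V)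
  obtain B where B: "B \<subseteq> A" "finite B"
    "\<And>a. a \<in> A \<Longrightarrow> \<exists>b\<in>B. \<forall>v\<in>V. Poly_Mapping.lookup b v \<le> Poly_Mapping.lookup a v"
    using insert.IH[of A] by blast
  have "\<forall>k. \<exists>C\<subseteq>{a \<in> A. Poly_Mapping.lookup a v = k}. finite C \<and>
      (\<forall>a\<in>{a \<in> A. Poly_Mapping.lookup a v = k}. \<exists>b\<in>C. \<forall>v\<in>V. Poly_Mapping.lookup b v \<le> Poly_Mapping.lookup a v)"
    using insert.IH by blast
  from choice[OF this] obtain C where C': "\<And>k. C k \<subseteq> {a \<in> A. Poly_Mapping.lookup a v = k} \<and> finite (C k) \<and>
      (\<forall>a\<in>{a \<in> A. Poly_Mapping.lookup a v = k}. \<exists>b\<in>C k. \<forall>v\<in>V. Poly_Mapping.lookup b v \<le> Poly_Mapping.lookup a v)"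
    by blast
  have C: "C k \<subseteq> {a \<in> A. Poly_Mapping.lookup a v = k}" "finite (C k)"
    "a \<in> A \<Longrightarrow> Poly_Mapping.lookup a v = k \<Longrightarrow> \<exists>b\<in>C k. \<forall>v\<in>V. Poly_Mapping.lookup b v \<le> Poly_Mapping.lookup a v"
    for k a using C'[of k] by simp_all
  define N where "N = Max (insert 0 ((\<lambda>b. Poly_Mapping.lookup b v) ` B))"
  have N: "Poly_Mapping.lookup b v \<le> N" if "b \<in> B" for b
    unfolding N_def using B that by (intro Max_ge) auto
  show ?case
  proof (intro exI[of _ "B \<union> (\<Union>k<N. C k)"] conjI ballI)
    show "B \<union> (\<Union>k<N. C k) \<subseteq> A" "finite (B \<union> (\<Union>k<N. C k))" using B C by blast+
    fix a assume a: "a \<in> A"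
    show "\<exists>b\<in>B \<union> (\<Union>k<N. C k). \<forall>v\<in>insert v V. Poly_Mapping.lookup b v \<le> Poly_Mapping.lookup a v"
    proof (cases "Poly_Mapping.lookup a v < N")
      case True
      obtain b where "b \<in> C (Poly_Mapping.lookup a v)" "\<forall>v\<in>V. Poly_Mapping.lookup b v \<le> Poly_Mapping.lookup a v"
        using C(3) a by blast
      moreover from this have "Poly_Mapping.lookup b v = Poly_Mapping.lookup a v" using C(1) by blast
      ultimately show ?thesis using True by (intro bexI[of _ b]) auto
    next
      case False
      obtain b where "b \<in> B" "\<forall>v\<in>V. Poly_Mapping.lookup b v \<le> Poly_Mapping.lookup a v" using B(3) a by blast
      then show ?thesis using False N[of b] by (intro bexI[of _ b]) auto
    qed
  qed
qed

text \<open>Dickson's lemma selects finitely many elements such that every leading monomial of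
  \<open>J\<close> is divisible by one of theirs; subtracting a multiple of that element lowers the
  leading monomial. Generation is expressed through the ideals that contain \<open>G\<close>, which
  is the form in which it is used.\<close>

lemma hilbert_basis:
  fixes J :: "('v, 'k::field) mpoly set"
  assumes W: "finite W" and J: "polys.is_ideal W J"
  obtains G where "finite G" "G \<subseteq> J" "\<And>J'. polys.is_ideal W J' \<Longrightarrow> G \<subseteq> J' \<Longrightarrow> J \<subseteq> J'"
proof -
  obtain vs where vs: "set vs = W" using finite_list W by blast
  define L where "L = lead_mono vs ` (J - {0})"
  obtain B where B: "B \<subseteq> L" "finite B"
    "\<And>a. a \<in> L \<Longrightarrow> \<exists>b\<in>B. \<forall>v\<in>W. Poly_Mapping.lookup b v \<le> Poly_Mapping.lookup a v"
    using dickson[OF W, of L] by blast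
  have "\<forall>b\<in>B. \<exists>g\<in>J - {0}. lead_mono vs g = b" using B by (auto simp: L_def)
  then obtain g where g: "\<And>b. b \<in> B \<Longrightarrow> g b \<in> J - {0}" "\<And>b. b \<in> B \<Longrightarrow> lead_mono vs (g b) = b" by metis
  have JS: "f \<in> J \<Longrightarrow> f \<in> polys (set vs)" for f using polys.ideal_sub J vs by blast
  show ?thesis
  proof
    show "finite (g ` B)" "g ` B \<subseteq> J" using B g by auto
    fix J' assume J': "polys.is_ideal W J'" "g ` B \<subseteq> J'"
    have "f \<in> J \<Longrightarrow> f \<noteq> 0 \<Longrightarrow> lead_mono vs f = a \<Longrightarrow> f \<in> J'" for f a
    proof (induction a arbitrary: f rule: wfp_induct_rule[OF wfp_less_expo[of vs]])
      case (1 a)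
      note f = lead_mono[OF JS[OF "1.prems"(1)] "1.prems"(2), unfolded "1.prems"(3)]
      obtain b where b: "b \<in> B" "\<forall>v\<in>W. Poly_Mapping.lookup b v \<le> Poly_Mapping.lookup a v"
        using B(3)[of a] "1.prems" by (auto simp: L_def)
      note gb = lead_mono[OF JS, of "g b", unfolded g(2)[OF b(1)]]
      have gb: "b \<in> Poly_Mapping.keys (g b)" "\<And>m. m \<in> Poly_Mapping.keys (g b) \<Longrightarrow> m = b \<or> less_expo vs m b"
        using gb g(1)[OF b(1)] by auto
      have ka: "Poly_Mapping.keys a \<subseteq> W" using f(1) JS[OF "1.prems"(1)] vs by (auto simp: polys_def)
      have kb: "Poly_Mapping.keys b \<subseteq> W" using gb(1) JS[of "g b"] g(1)[OF b(1)] vs by (auto simp: polys_def)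
      have ba: "Poly_Mapping.lookup b v \<le> Poly_Mapping.lookup a v" for v
      proof (cases "v \<in> W")
        case False
        then have "Poly_Mapping.lookup b v = 0" using kb by (metis in_keys_iff subsetD)
        then show ?thesis by simp
      qed (use b in auto)
      then have ab: "a = (a - b) + b" by (intro poly_mapping_eqI) (simp add: lookup_add lookup_minus)
      define c where "c = Poly_Mapping.lookup f a / Poly_Mapping.lookup (g b) b"
      \<comment> \<open>The multiple of \<open>g b\<close> with the same leading term as
        \<open>f\<close>.\<close>
      define h where "h = Const c * monomial (a - b) * g b"
      have "Poly_Mapping.keys (a - b) \<subseteq> Poly_Mapping.keys a" by (auto simp: in_keys_iff lookup_minus)
      then have "Const c * monomial (a - b) \<in> polys W"
        using ka by (intro polys.mult_mem) (auto simp: polys_monomial_mem)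
      then have h: "h \<in> J" "h \<in> J'" unfolding h_def using polys.ideal_mult[OF J, of _ "g b"] polys.ideal_mult[OF J'(1), of _ "g b"] J'(2) g(1)[OF b(1)] b(1)
        by blast+
      have hk: "m = a \<or> less_expo vs m a" if m: "m \<in> Poly_Mapping.keys h" for m
      proof -
        have "m \<in> Poly_Mapping.keys (Poly_Mapping.single (a - b) c * g b)" using m by (simp add: h_def Const_monomial)
        then obtain m' where "m = (a - b) + m'" "m' \<in> Poly_Mapping.keys (g b)"
          using keys_mult[of "Poly_Mapping.single (a - b) c" "g b"] by (auto split: if_splits)
        then show ?thesis using gb(2)[of m'] ab less_expo_add[of vs m' b "a - b"]
          by (auto simp: add.commute)
      qed
      have "Poly_Mapping.lookup h a = Poly_Mapping.lookup f a"
      proof -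
        define r where "r = restrict_mono (\<lambda>m. m \<noteq> b) (g b)"
        have "g b = Poly_Mapping.single b (Poly_Mapping.lookup (g b) b) + r"
          by (auto simp: r_def lookup_add lookup_single lookup_restrict_mono when_def intro!: poly_mapping_eqI)
        then have "h = Poly_Mapping.single (a - b) c * (Poly_Mapping.single b (Poly_Mapping.lookup (g b) b) + r)"
          by (simp add: h_def Const_monomial)
        also have "\<dots> = Poly_Mapping.single a (c * Poly_Mapping.lookup (g b) b) + Poly_Mapping.single (a - b) c * r"
          using ab by (simp add: distrib_left mult_single)
        finally have "Poly_Mapping.lookup h a = c * Poly_Mapping.lookup (g b) b +
            Poly_Mapping.lookup (Poly_Mapping.single (a - b) c * r) a" by (simp add: lookup_add)
        moreover have "a \<notin> Poly_Mapping.keys (Poly_Mapping.single (a - b) c * r)"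
        proof
          assume "a \<in> Poly_Mapping.keys (Poly_Mapping.single (a - b) c * r)"
          then obtain m where "a = (a - b) + m" "m \<in> Poly_Mapping.keys r"
            using keys_mult[of "Poly_Mapping.single (a - b) c" r] by (auto split: if_splits)
          then have "m = b" using ab by (metis add_left_imp_eq)
          then show False using \<open>m \<in> Poly_Mapping.keys r\<close> by (simp add: r_def keys_restrict_mono)
        qed
        ultimately show ?thesis using gb(1) by (simp add: c_def in_keys_iff)
      qed
      then have na: "a \<notin> Poly_Mapping.keys (f - h)" by (simp add: in_keys_iff lookup_minus)
      have fh: "f - h \<in> J" using "1.prems" h J polys.ideal_diff by blast
      have "f - h \<in> J'"
      proof (cases "f - h = 0")
        case True
        then show ?thesis using J' polys.ideal_zero by metis
      next
        case False
        have "lead_mono vs (f - h) \<in> Poly_Mapping.keys (f - h)" using lead_mono(1)[OF JS[OF fh] False] .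
        moreover from this have "lead_mono vs (f - h) \<in> Poly_Mapping.keys f \<union> Poly_Mapping.keys h"
          using keys_diff[of f h] by blast
        ultimately have "less_expo vs (lead_mono vs (f - h)) a" using na f(2) hk by auto
        then show ?thesis using "1.IH" fh False by blast
      qed
      then have "(f - h) + h \<in> J'" using J' h polys.ideal_add by blast
      then show ?case by simp
    qed
    then show "J \<subseteq> J'" using J' polys.ideal_zero by blast
  qed
qed

text \<open>The union of a chain is finitely generated, so one member already contains the
  generators and equals the union; Zorn's lemma then gives a maximal member.\<close>

lemma polys_acc:
  fixes \<A> :: "('v, 'k::field) mpoly set set"
  assumes W: "finite W" and A: "\<A> \<noteq> {}" "\<And>J. J \<in> \<A> \<Longrightarrow> polys.is_ideal W J"
  shows "\<exists>J\<in>\<A>. \<forall>J'\<in>\<A>. J \<subseteq> J' \<longrightarrow> J' = J"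
proof (rule subset_Zorn_nonempty[OF A(1)])
  fix C assume C: "C \<noteq> {}" "subset.chain \<A> C"
  have chain: "subset.chain {J. polys.is_ideal W J} C" using C A by (auto simp: subset.chain_def)
  then have id: "polys.is_ideal W (\<Union>C)" using polys.ideal_Union_chain C by blast
  obtain G where G: "finite G" "G \<subseteq> \<Union>C" "\<And>J'. polys.is_ideal W J' \<Longrightarrow> G \<subseteq> J' \<Longrightarrow> \<Union>C \<subseteq> J'"
    using hilbert_basis[OF W id] by blast
  obtain J where "J \<in> C" "G \<subseteq> J"
    by (rule finite_subset_Union_chain[OF G(1,2) C])
  moreover from this have "\<Union>C \<subseteq> J" using G(3) chain by (auto simp: subset.chain_def)
  ultimately have "\<Union>C = J" by blast
  then show "\<Union>C \<in> \<A>" using \<open>J \<in> C\<close> C by (auto simp: subset.chain_def)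
qed

lemma indet_monomial: "v \<in> Poly_Mapping.keys m \<Longrightarrow> monomial m = indet v * monomial (m - Poly_Mapping.single v 1)"
proof -
  assume "v \<in> Poly_Mapping.keys m"
  then have "m = Poly_Mapping.single v 1 + (m - Poly_Mapping.single v 1)"
    by (intro poly_mapping_eqI) (auto simp: lookup_add lookup_minus lookup_single when_def in_keys_iff)
  then show ?thesis by (metis indet_def monomial_add)
qed

lemma indet_power: "indet v ^ k = monomial (Poly_Mapping.single v k)"
  by (induction k) (simp_all add: indet_def monomial_add[symmetric] single_add[symmetric])

lemma keys_minus_nat: "Poly_Mapping.keys (m - m' :: 'v \<Rightarrow>\<^sub>0 nat) \<subseteq> Poly_Mapping.keys m"
  by (auto simp: in_keys_iff lookup_minus)

lemma polys_ideal_of_monomials: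
  assumes J: "polys.is_ideal W J" and f: "\<And>m. m \<in> Poly_Mapping.keys f \<Longrightarrow> monomial m \<in> J"
  shows "f \<in> J"
  by (subst poly_sum_monos) (auto intro!: polys.ideal_sum[OF J] polys.ideal_mult[OF J] f)

text \<open>The product of the leading terms survives in \<open>f * g\<close>, so the two leading
  monomials add up to the exponent 0, and no monomial of \<open>f\<close> can be smaller than
  that.\<close>

lemma polys_unit_const:
  fixes f g :: "('v, 'k::field) mpoly"
  assumes W: "finite W" and fg: "f \<in> polys W" "g \<in> polys W" "f * g = 1"
  shows "Poly_Mapping.keys f \<subseteq> {0}"
proof -
  obtain vs where vs: "set vs = W" using finite_list W by blast
  have nz: "f \<noteq> 0" "g \<noteq> 0" using fg(3) by auto
  have "lead_mono vs f + lead_mono vs g = 0"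
    using lookup_lead_mono_mult[of f vs g] fg nz vs by (simp add: lookup_one when_def split: if_splits)
  then have "Poly_Mapping.keys (lead_mono vs f) = {}" by (metis Un_empty keys_add_nat keys_zero)
  then have "lead_mono vs f = 0" by simp
  then show ?thesis
    using lead_mono(2)[of f vs] fg nz vs by (auto simp: less_expo_def)
qed

subsection \<open>Primes generated by variables\<close>

text \<open>The ideal generated by the variables in \<open>V - F\<close>, described by supports. For
  an independent set \<open>F\<close> it contains the edge ideal and is the prime that belongs to
  the face \<open>F\<close>.\<close>

definition var_prime :: "'v set \<Rightarrow> 'v set \<Rightarrow> ('v, 'k::field) mpoly set" where
  "var_prime V F = {f \<in> polys V. \<forall>m\<in>Poly_Mapping.keys f. \<not> Poly_Mapping.keys m \<subseteq> F}"

lemma var_prime_ideal: "polys.is_ideal V (var_prime V F :: ('v, 'k::field) mpoly set)"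
  unfolding polys.is_ideal_def
proof (intro conjI ballI)
  fix a b :: "('v, 'k) mpoly" assume ab: "a \<in> var_prime V F" "b \<in> var_prime V F"
  then show "a + b \<in> var_prime V F"
    using Poly_Mapping.keys_add[of a b] by (fastforce simp: var_prime_def)
next
  fix s a :: "('v, 'k) mpoly" assume sa: "s \<in> polys V" "a \<in> var_prime V F"
  then show "s * a \<in> var_prime V F"
    using keys_mult[of s a] by (fastforce simp: var_prime_def keys_add_nat)
qed (auto simp: var_prime_def)

text \<open>Keeping only the monomials supported in \<open>F\<close> is reduction modulo this ideal,
  so the quotient is a polynomial ring in variables from \<open>F\<close> and has no zero
  divisors.\<close>

lemma var_prime_prime:
  assumes V: "finite V" shows "polys.is_prime V (var_prime V F :: ('v, 'k::field) mpoly set)"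
  unfolding polys.is_prime_def
proof (intro conjI ballI impI var_prime_ideal)
  show "1 \<notin> (var_prime V F :: ('v, 'k) mpoly set)" by (simp add: var_prime_def)
  fix a b :: "('v, 'k) mpoly" assume ab: "a \<in> polys V" "b \<in> polys V" "a * b \<in> var_prime V F"
  show "a \<in> var_prime V F \<or> b \<in> var_prime V F"
  proof (rule ccontr)
    assume neg: "\<not> ?thesis"
    define r where "r = (restrict_mono (\<lambda>m. Poly_Mapping.keys m \<subseteq> F) :: ('v, 'k) mpoly \<Rightarrow> _)"
    have rd: "f - r f \<in> var_prime V F" if "f \<in> polys V" for f
      using that polys_restrict[of f V]
      by (auto simp: var_prime_def r_def in_keys_iff lookup_minus lookup_restrict_mono when_def)
    have nz: "r a \<noteq> 0" "r b \<noteq> 0"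
      using neg ab by (auto simp: var_prime_def r_def simp flip: keys_eq_empty simp: keys_restrict_mono)
    have rp: "r f \<in> polys V" if "f \<in> polys V" for f using that polys_restrict by (auto simp: r_def)
    have "r a * r b = a * b - (r b * (a - r a) + a * (b - r b))" by (simp add: algebra_simps)
    also have "\<dots> \<in> var_prime V F"
      using ab(3) polys.ideal_mult[OF var_prime_ideal rp[OF ab(2)] rd[OF ab(1)]]
        polys.ideal_mult[OF var_prime_ideal ab(1) rd[OF ab(2)]]
      by (intro polys.ideal_diff[OF var_prime_ideal] polys.ideal_add[OF var_prime_ideal])
    finally have "Poly_Mapping.keys m \<subseteq> F \<Longrightarrow> m \<notin> Poly_Mapping.keys (r a * r b)" for m
      by (auto simp: var_prime_def)
    moreover have "Poly_Mapping.keys m \<subseteq> F" if "m \<in> Poly_Mapping.keys (r a * r b)" for m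
      using that keys_mult[of "r a" "r b"] by (fastforce simp: r_def keys_restrict_mono keys_add_nat)
    ultimately have "Poly_Mapping.keys (r a * r b) = {}" by blast
    then have "r a * r b = 0" by simp
    then show False using polys_no_zero_divisors[OF V rp[OF ab(1)] rp[OF ab(2)]] nz by blast
  qed
qed

lemma indet_in_var_prime: "v \<in> V \<Longrightarrow> indet v \<in> var_prime V F \<longleftrightarrow> v \<notin> F"
  by (auto simp: var_prime_def polys_indet) (auto simp: indet_def)

lemma monomial_in_ideal:
  assumes "polys.is_ideal V J" "Poly_Mapping.keys m \<subseteq> V" "v \<in> Poly_Mapping.keys m" "indet v \<in> J"
  shows "monomial m \<in> J"
proof -
  have "monomial (m - Poly_Mapping.single v 1) \<in> polys V"
    using assms(2) keys_minus_nat[of m] by (auto simp: polys_monomial_mem)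
  then show ?thesis using polys.ideal_mult_right[OF assms(1) _ assms(4)] indet_monomial[OF assms(3)] by metis
qed

lemma var_prime_least:
  assumes J: "polys.is_ideal V J" and "\<And>v. v \<in> V - F \<Longrightarrow> indet v \<in> J"
  shows "var_prime V F \<subseteq> J"
proof
  fix f :: "('a, 'b) mpoly" assume f: "f \<in> var_prime V F"
  show "f \<in> J"
  proof (rule polys_ideal_of_monomials[OF J])
    fix m assume m: "m \<in> Poly_Mapping.keys f"
    then obtain v where "v \<in> Poly_Mapping.keys m" "v \<notin> F" using f by (auto simp: var_prime_def)
    then show "monomial m \<in> J" using assms monomial_in_ideal[OF J, of m v] f m
      by (auto simp: var_prime_def polys_def)
  qed
qed

lemma var_prime_psubset:
  assumes "F' \<subset> F" "F \<subseteq> V" shows "(var_prime V F :: ('v, 'k::field) mpoly set) \<subset> var_prime V F'"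
proof -
  obtain v where v: "v \<in> F" "v \<notin> F'" using assms by blast
  have "(indet v :: ('v, 'k) mpoly) \<in> var_prime V F' - var_prime V F"
    using v assms indet_in_var_prime[of v V] by blast
  moreover have "(var_prime V F :: ('v, 'k) mpoly set) \<subseteq> var_prime V F'" using assms by (fastforce simp: var_prime_def)
  ultimately show ?thesis by blast
qed

subsection \<open>Chains of primes are bounded by the number of variables\<close>

interpretation pv: vector_space "\<lambda>(c::'k::field) (p :: ('v, 'k) mpoly). Const c * p"
  by unfold_locales (auto simp: Const_add Const_mult algebra_simps)

text \<open>Stated for an indexed family because power products with different exponents might
  coincide; a coincidence would be a linear relation, so \<open>r\<close> is injective.\<close>

lemma family_card_le:
  fixes r :: "'i \<Rightarrow> ('v, 'k::field) mpoly"
  assumes fin: "finite A" "finite T" and sp: "\<And>i. i \<in> A \<Longrightarrow> r i \<in> pv.span T"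
    and ind: "\<And>c i. (\<Sum>i\<in>A. Const (c i) * r i) = 0 \<Longrightarrow> i \<in> A \<Longrightarrow> c i = 0"
  shows "card A \<le> card T"
proof -
  have inj: "inj_on r A"
  proof (rule inj_onI, rule ccontr)
    fix i j assume ij: "i \<in> A" "j \<in> A" "r i = r j" "i \<noteq> j"
    let ?c = "\<lambda>k. if k = i then 1 else if k = j then - 1 else (0::'k)"
    have "(\<Sum>k\<in>A. Const (?c k) * r k) = (\<Sum>k\<in>{i, j}. Const (?c k) * r k)"
      using fin ij by (intro sum.mono_neutral_right) auto
    also have "\<dots> = 0" using ij by (simp add: Const_uminus)
    finally have "?c i = 0" using ind[of ?c i] ij(1) by simp
    then show False by simp
  qed
  have "pv.independent (r ` A)"
  proof (rule pv.independent_if_scalars_zero)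
    fix c x assume c: "(\<Sum>x\<in>r ` A. Const (c x) * x) = 0" and x: "x \<in> r ` A"
    have "(\<Sum>i\<in>A. Const (c (r i)) * r i) = 0" using c inj by (simp add: sum.reindex)
    then have "\<And>i. i \<in> A \<Longrightarrow> c (r i) = 0" using ind[of "\<lambda>i. c (r i)"] by blast
    then show "c x = 0" using x by auto
  qed (use fin in auto)
  then have "card (r ` A) \<le> card T"
    using pv.independent_span_bound[OF fin(2)] sp by blast
  then show ?thesis using inj by (simp add: card_image)
qed

fun power_prod :: "('v, 'k::field) mpoly list \<Rightarrow> nat list \<Rightarrow> ('v, 'k) mpoly" where
  "power_prod (f # fs) (a # as) = f ^ a * power_prod fs as"
| "power_prod _ _ = 1"

lemma power_prod_mem: "set fs \<subseteq> polys W \<Longrightarrow> power_prod fs as \<in> polys W"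
  by (induction fs as rule: power_prod.induct) auto

abbreviation expos :: "nat \<Rightarrow> nat \<Rightarrow> nat list set" where
  "expos N r \<equiv> {as. set as \<subseteq> {..N} \<and> length as = r}"

lemma finite_expos: "finite (expos N r)"
  by (rule finite_lists_length_eq) simp

lemma sum_expos_Suc:
  "(\<Sum>as\<in>expos N (Suc r). g as) = (\<Sum>k\<le>N. \<Sum>as\<in>expos N r. g (k # as))"
proof -
  have "expos N (Suc r) = (\<lambda>(k, as). k # as) ` ({..N} \<times> expos N r)"
    by (auto simp: length_Suc_conv image_iff)
  then have "(\<Sum>as\<in>expos N (Suc r). g as) = (\<Sum>p\<in>{..N} \<times> expos N r. g (fst p # snd p))"
    by (simp add: sum.reindex inj_on_def case_prod_unfold)
  then show ?thesis by (simp add: sum.cartesian_product case_prod_unfold)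
qed

text \<open>Elements \<open>f\<^sub>i \<in> Q\<^sub>i\<^sub>+\<^sub>1 - Q\<^sub>i\<close> are algebraically independent modulo \<open>Q\<^sub>0\<close>.\<close>

lemma chain_independent:
  fixes Q :: "nat \<Rightarrow> ('v, 'k::field) mpoly set"
  assumes "\<And>i. i \<le> length fs \<Longrightarrow> polys.is_prime V (Q i)" "\<And>i. i < length fs \<Longrightarrow> Q i \<subseteq> Q (Suc i)"
    and "\<And>i. i < length fs \<Longrightarrow> fs ! i \<in> Q (Suc i) - Q i"
    and "(\<Sum>as\<in>expos N (length fs). Const (c as) * power_prod fs as) \<in> Q 0"
    and "as \<in> expos N (length fs)"
  shows "c as = 0"
  using assms
proof (induction fs arbitrary: Q c as)
  case Nil
  show ?case
  proof (rule ccontr)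
    assume "c as \<noteq> 0"
    have as: "as = []" and Q: "polys.is_prime V (Q 0)" using Nil by auto
    have "expos N (length ([] :: ('v, 'k) mpoly list)) = {[]}" by auto
    then have "Const (c []) \<in> Q 0" using Nil.prems(4) by simp
    then have "Const (inverse (c [])) * Const (c []) \<in> Q 0"
      using polys.prime_ideal[OF Q] polys.ideal_mult polys_Const by blast
    then show False using Q \<open>c as \<noteq> 0\<close> as by (simp add: polys.is_prime_def flip: Const_mult)
  qed
next
  case (Cons f fs)
  have Q0: "polys.is_prime V (Q 0)" and Q1: "polys.is_prime V (Q (Suc 0))" "Q 0 \<subseteq> Q (Suc 0)"
    and f: "f \<in> Q (Suc 0)" "f \<notin> Q 0"
    using Cons.prems(1)[of 0] Cons.prems(1)[of 1] Cons.prems(2)[of 0] Cons.prems(3)[of 0] by auto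
  have fS: "f \<in> polys V" using f Q1 polys.ideal_sub polys.prime_ideal by blast
  have "set fs \<subseteq> polys V"
  proof
    fix g assume "g \<in> set fs"
    then obtain i where "i < length fs" "g = fs ! i" by (auto simp: in_set_conv_nth)
    then show "g \<in> polys V"
      using Cons.prems(3)[of "Suc i"] Cons.prems(1)[of "Suc (Suc i)"] polys.ideal_sub polys.prime_ideal by fastforce
  qed
  then have pp: "power_prod fs as \<in> polys V" for as by (rule power_prod_mem)
  let ?b = "\<lambda>d. \<Sum>as\<in>expos N (length fs). Const (d as) * power_prod fs as"
  have bS: "?b d \<in> polys V" for d by (intro polys.sum_mem polys.mult_mem polys_Const pp)
  have IH: "d as = 0" if "?b d \<in> Q (Suc 0)" "as \<in> expos N (length fs)" for d as
    using Cons.IH[of "\<lambda>i. Q (Suc i)" d as] that Cons.prems(1)[of "Suc _"] Cons.prems(2)[of "Suc _"]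
      Cons.prems(3)[of "Suc _"] by simp
  \<comment> \<open>Modulo \<open>Q (Suc 0)\<close> only the coefficient of \<open>f ^ 0\<close>
    remains, so it vanishes by the outer induction. The rest is divisible by \<open>f\<close>, which
    can be cancelled modulo the prime \<open>Q 0\<close>.\<close>
  have main: "d k as = 0" if "(\<Sum>k\<le>n. f ^ k * ?b (d k)) \<in> Q 0" "k \<le> n" "as \<in> expos N (length fs)" for n d k as
    using that
  proof (induction n arbitrary: d k)
    case 0
    then show ?case using IH[of "d 0" as] Q1 by auto
  next
    case (Suc n)
    let ?t = "\<Sum>k\<le>n. f ^ k * ?b (d (Suc k))"
    have t: "(\<Sum>k\<le>Suc n. f ^ k * ?b (d k)) = ?b (d 0) + f * ?t"
      by (simp only: sum.atMost_Suc_shift) (simp add: sum_distrib_left mult.assoc)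
    have tS: "?t \<in> polys V" by (intro polys.sum_mem polys.mult_mem polys.power_mem bS fS)
    have "f * ?t \<in> Q (Suc 0)" using f tS polys.prime_ideal[OF Q1(1)] polys.ideal_mult_right by blast
    then have "?b (d 0) \<in> Q (Suc 0)"
      using Suc.prems(1) Q1 polys.ideal_diff[OF polys.prime_ideal[OF Q1(1)], of "?b (d 0) + f * ?t" "f * ?t"]
      unfolding t by auto
    then have d0: "d 0 as = 0" if "as \<in> expos N (length fs)" for as using IH that by blast
    then have "?b (d 0) = 0" by (intro sum.neutral) simp
    then have "f * ?t \<in> Q 0" using Suc.prems(1) unfolding t by simp
    then have "?t \<in> Q 0" using Q0 f fS tS polys.prime_cases by blast
    then show ?case using Suc.IH[of "\<lambda>k. d (Suc k)"] Suc.prems d0 by (cases k) auto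
  qed
  obtain k as' where as: "as = k # as'" "k \<le> N" "as' \<in> expos N (length fs)"
    using Cons.prems(5) by (auto simp: length_Suc_conv)
  have "(\<Sum>k\<le>N. f ^ k * ?b (\<lambda>as. c (k # as))) \<in> Q 0"
    using Cons.prems(4) unfolding length_Cons sum_expos_Suc by (simp add: sum_distrib_left algebra_simps)
  then show ?case using main[of "\<lambda>k as. c (k # as)" N k as'] as by blast
qed

lemma finite_bounded_expos:
  assumes "finite W"
  shows "finite {m :: 'v \<Rightarrow>\<^sub>0 nat. Poly_Mapping.keys m \<subseteq> W \<and> (\<forall>v. Poly_Mapping.lookup m v \<le> K)}" (is "finite ?M")
    and "card {m :: 'v \<Rightarrow>\<^sub>0 nat. Poly_Mapping.keys m \<subseteq> W \<and> (\<forall>v. Poly_Mapping.lookup m v \<le> K)} \<le> (K + 1) ^ card W"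
proof -
  let ?f = "\<lambda>m :: 'v \<Rightarrow>\<^sub>0 nat. restrict (Poly_Mapping.lookup m) W"
  have inj: "inj_on ?f ?M"
  proof (rule inj_onI)
    fix m m' assume m: "m \<in> ?M" "m' \<in> ?M" "?f m = ?f m'"
    have "Poly_Mapping.lookup m v = Poly_Mapping.lookup m' v" for v
    proof (cases "v \<in> W")
      case True
      then show ?thesis using fun_cong[OF m(3), of v] by simp
    next
      case False
      then have "v \<notin> Poly_Mapping.keys m" "v \<notin> Poly_Mapping.keys m'" using m by auto
      then show ?thesis by (simp add: in_keys_iff)
    qed
    then show "m = m'" by (rule poly_mapping_eqI)
  qed
  have img: "?f ` ?M \<subseteq> PiE W (\<lambda>_. {..K})" by auto
  have fin: "finite (PiE W (\<lambda>_. {..K}))" using assms by (intro finite_PiE) auto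
  show "finite ?M" using inj_on_finite[OF inj img fin] .
  have "card ?M \<le> card (PiE W (\<lambda>_. {..K}))" using card_inj_on_le[OF inj img fin] .
  then show "card ?M \<le> (K + 1) ^ card W" using assms by (simp add: card_PiE)
qed

lemma in_span_monomials:
  assumes "\<And>m. m \<in> Poly_Mapping.keys f \<Longrightarrow> m \<in> A"
  shows "f \<in> pv.span (monomial ` A)"
  by (subst poly_sum_monos) (intro pv.span_sum pv.span_scale pv.span_base imageI assms)

lemma total_deg_power_prod:
  assumes "\<And>f m. f \<in> set fs \<Longrightarrow> m \<in> Poly_Mapping.keys f \<Longrightarrow> total_deg m \<le> D"
    and "m \<in> Poly_Mapping.keys (power_prod fs as)"
  shows "total_deg m \<le> D * sum_list as"
  using assms
proof (induction fs as arbitrary: m rule: power_prod.induct)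
  case (1 f fs a as)
  have pw: "total_deg m \<le> D * a" if "m \<in> Poly_Mapping.keys (f ^ a)" for m a
    using that
  proof (induction a arbitrary: m)
    case (Suc a)
    then obtain x y where "m = x + y" "x \<in> Poly_Mapping.keys f" "y \<in> Poly_Mapping.keys (f ^ a)"
      using keys_mult[of f "f ^ a"] by auto
    then show ?case using Suc.IH[of y] "1.prems"(1)[of f x] by (simp add: total_deg_add)
  qed simp
  obtain x y where "m = x + y" "x \<in> Poly_Mapping.keys (f ^ a)" "y \<in> Poly_Mapping.keys (power_prod fs as)"
    using "1.prems"(2) keys_mult[of "f ^ a" "power_prod fs as"] by auto
  moreover have "total_deg x \<le> D * a" "total_deg y \<le> D * sum_list as"
    using pw[of x a] "1.IH"[of y] "1.prems"(1) calculation by auto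
  ultimately show ?case by (simp add: total_deg_add distrib_left)
qed auto

text \<open>A counting form of the bound by the transcendence degree. Elements that separate
  consecutive primes can be taken in the variables of \<open>W\<close>, and their
  \<open>(N + 1) ^ r\<close> power products with exponents up to \<open>N\<close> are linearly
  independent. They lie in a space whose dimension grows only like \<open>N ^ card W\<close>, which
  for large \<open>N\<close> is too small if \<open>r > card W\<close>.\<close>

theorem chain_length_le:
  fixes Q :: "nat \<Rightarrow> ('v, 'k::field) mpoly set"
  assumes V: "finite V" "W \<subseteq> V" and Q: "\<And>i. i \<le> r \<Longrightarrow> polys.is_prime V (Q i)"
    "\<And>i. i < r \<Longrightarrow> Q i \<subset> Q (Suc i)" and W: "\<And>v. v \<in> V - W \<Longrightarrow> indet v \<in> Q 0"
  shows "r \<le> card W"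
proof -
  have finW: "finite W" using V finite_subset by blast
  have "\<exists>f. f \<in> Q (Suc i) - Q i \<and> f \<in> polys W" if i: "i < r" for i
  proof -
    obtain f where f: "f \<in> Q (Suc i)" "f \<notin> Q i" using Q(2)[OF i] by blast
    define g where "g = restrict_mono (\<lambda>m. Poly_Mapping.keys m \<subseteq> W) f"
    have inc: "Q 0 \<subseteq> Q j" if "j \<le> r" for j
      using that
    proof (induction j)
      case (Suc j)
      then show ?case using Q(2)[of j] by auto
    qed simp
    have fV: "f \<in> polys V" using f i Q(1)[of "Suc i"] polys.ideal_sub polys.prime_ideal by fastforce
    have fg: "f - g \<in> Q 0"
    proof (rule polys_ideal_of_monomials)
      show "polys.is_ideal V (Q 0)" using Q polys.prime_ideal by blast
      fix m assume "m \<in> Poly_Mapping.keys (f - g)"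
      then have m: "m \<in> Poly_Mapping.keys f" "\<not> Poly_Mapping.keys m \<subseteq> W"
        by (auto simp: g_def in_keys_iff lookup_minus lookup_restrict_mono)
      then obtain v where v: "v \<in> Poly_Mapping.keys m" "v \<notin> W" by blast
      have "Poly_Mapping.keys m \<subseteq> V" using m fV by (auto simp: polys_def)
      then show "monomial m \<in> Q 0"
        using monomial_in_ideal[of V "Q 0" m v] v W[of v] Q polys.prime_ideal by blast
    qed
    have "polys.is_ideal V (Q i)" "polys.is_ideal V (Q (Suc i))" using Q(1)[of i] Q(1)[of "Suc i"] i polys.prime_ideal by auto
    then have "g \<in> Q (Suc i)" "g \<notin> Q i"
      using f fg inc[of i] inc[of "Suc i"] i polys.ideal_diff_iff[of V _ f g] by auto
    moreover have "g \<in> polys W" by (auto simp: g_def polys_def keys_restrict_mono)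
    ultimately show ?thesis by blast
  qed
  then obtain h where h: "\<And>i. i < r \<Longrightarrow> h i \<in> Q (Suc i) - Q i \<and> h i \<in> polys W" by metis
  define fs where "fs = map h [0..<r]"
  have len: "length fs = r" by (simp add: fs_def)
  have fsW: "set fs \<subseteq> polys W" using h by (auto simp: fs_def)
  define D where "D = Max (insert 0 (total_deg ` (\<Union>f\<in>set fs. Poly_Mapping.keys f)))"
  have D: "total_deg m \<le> D" if "f \<in> set fs" "m \<in> Poly_Mapping.keys f" for f m
    unfolding D_def using that by (intro Max_ge) auto
  show ?thesis
  proof (rule ccontr)
    assume "\<not> r \<le> card W"
    then have r: "Suc (card W) \<le> r" by simp
    \<comment> \<open>Chosen such that the bound \<open>(D * r * N + 1) ^ card W\<close> for the
      number of monomials is at most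
      \<open>((D * r + 1) * (N + 1)) ^ card W = N * (N + 1) ^ card W\<close>, which is less than
      \<open>(N + 1) ^ Suc (card W)\<close>.\<close>
    define N where "N = (D * r + 1) ^ card W"
    let ?K = "D * (r * N)"
    let ?M = "{m :: 'v \<Rightarrow>\<^sub>0 nat. Poly_Mapping.keys m \<subseteq> W \<and> (\<forall>v. Poly_Mapping.lookup m v \<le> ?K)}"
    have "card (expos N r) \<le> card (monomial ` ?M :: ('v, 'k) mpoly set)"
    proof (rule family_card_le)
      show "finite (expos N r)" by (rule finite_expos)
      show "finite (monomial ` ?M)" using finite_bounded_expos[OF finW] by blast
      fix as assume as: "as \<in> expos N r"
      show "power_prod fs as \<in> pv.span (monomial ` ?M)"
      proof (rule in_span_monomials)
        fix m assume m: "m \<in> Poly_Mapping.keys (power_prod fs as)"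
        have "total_deg m \<le> D * sum_list as" using total_deg_power_prod[of fs D m as] D m by blast
        also have "sum_list as \<le> length as * N" using as
        proof (induction as arbitrary: r)
          case (Cons a as)
          have "sum_list as \<le> length as * N" using Cons.IH[of "length as"] Cons.prems by auto
          then show ?case using Cons.prems by auto
        qed simp
        finally have "total_deg m \<le> ?K" using as by simp
        then have "Poly_Mapping.lookup m v \<le> ?K" for v using lookup_le_total_deg[of m v] by linarith
        moreover have "Poly_Mapping.keys m \<subseteq> W"
          using power_prod_mem[OF fsW, of as] m by (auto simp: polys_def)
        ultimately show "m \<in> ?M" by blast
      qed
    next
      fix c :: "nat list \<Rightarrow> 'k" and as
      assume c: "(\<Sum>as\<in>expos N r. Const (c as) * power_prod fs as) = 0" and as: "as \<in> expos N r"
      have "0 \<in> Q 0" using Q polys.prime_ideal polys.ideal_zero by blast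
      then show "c as = 0"
        using chain_independent[where fs = fs and V = V and Q = Q and N = N and c = c and as = as] Q h c as len
        by (auto simp: fs_def)
    qed
    also have "\<dots> \<le> card ?M" by (rule card_image_le) (rule finite_bounded_expos[OF finW])
    also have "\<dots> \<le> (?K + 1) ^ card W" by (rule finite_bounded_expos[OF finW])
    also have "\<dots> \<le> ((D * r + 1) * (N + 1)) ^ card W" by (intro power_mono) (auto simp: algebra_simps)
    also have "\<dots> = N * (N + 1) ^ card W" by (simp only: power_mult_distrib N_def[symmetric])
    finally have "card (expos N r) \<le> N * (N + 1) ^ card W" .
    moreover have "card (expos N r) = (N + 1) ^ r" by (subst card_lists_length_eq) auto
    moreover have "(N + 1) ^ Suc (card W) \<le> (N + 1) ^ r" using r by (intro power_increasing) auto
    ultimately have "(N + 1) ^ Suc (card W) \<le> N * (N + 1) ^ card W" by linarith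
    moreover have "0 < (N + 1) ^ card W" by simp
    ultimately show False by simp
  qed
qed

section \<open>Zariski's lemma\<close>

lemma polys_prod_nonzero:
  fixes f :: "'i \<Rightarrow> ('v, 'k::field) mpoly"
  assumes "finite F" "finite W" "\<And>i. i \<in> F \<Longrightarrow> f i \<in> polys W" "\<And>i. i \<in> F \<Longrightarrow> f i \<noteq> 0"
  shows "prod f F \<noteq> 0"
  using assms
proof (induction F rule: finite_induct)
  case (insert x F)
  have "prod f F \<in> polys W" using insert.prems by (intro polys.prod_mem) auto
  then show ?case using insert polys_no_zero_divisors[of W "f x" "prod f F"] by simp
qed simp

text \<open>The polynomials whose class modulo \<open>M\<close> lies in the \<open>A\<close>-module
  generated by the classes of \<open>E\<close>.\<close>

definition span_mod :: "'a::comm_ring_1 set \<Rightarrow> 'a set \<Rightarrow> 'a set \<Rightarrow> 'a set" where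
  "span_mod A M E = {f. \<exists>d. (\<forall>e\<in>E. d e \<in> A) \<and> f - (\<Sum>e\<in>E. d e * e) \<in> M}"

locale maximal_poly_ideal =
  fixes V :: "'v set" and M :: "('v, 'k::field) mpoly set"
  assumes finV: "finite V" and M_prime: "polys.is_prime V M"
    and inverse: "\<And>f. f \<in> polys V - M \<Longrightarrow> \<exists>g\<in>polys V. f * g - 1 \<in> M"
begin

lemma M_ideal: "polys.is_ideal V M" using M_prime polys.prime_ideal by blast

lemma span_modI: "(\<And>e. e \<in> E \<Longrightarrow> d e \<in> A) \<Longrightarrow> f - (\<Sum>e\<in>E. d e * e) \<in> M \<Longrightarrow> f \<in> span_mod A M E"
  unfolding span_mod_def by blast

lemma span_mod_add: "f \<in> span_mod (polys W) M E \<Longrightarrow> g \<in> span_mod (polys W) M E \<Longrightarrow> f + g \<in> span_mod (polys W) M E"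
proof -
  assume "f \<in> span_mod (polys W) M E" "g \<in> span_mod (polys W) M E"
  then obtain d d' where d: "\<forall>e\<in>E. d e \<in> polys W" "f - (\<Sum>e\<in>E. d e * e) \<in> M"
    "\<forall>e\<in>E. d' e \<in> polys W" "g - (\<Sum>e\<in>E. d' e * e) \<in> M" by (auto simp: span_mod_def)
  show ?thesis
  proof (rule span_modI[of _ "\<lambda>e. d e + d' e"])
    have "f + g - (\<Sum>e\<in>E. (d e + d' e) * e) = (f - (\<Sum>e\<in>E. d e * e)) + (g - (\<Sum>e\<in>E. d' e * e))"
      by (simp add: distrib_right sum.distrib)
    then show "f + g - (\<Sum>e\<in>E. (d e + d' e) * e) \<in> M"
      using polys.ideal_add[OF M_ideal d(2,4)] by metis
  qed (use d in auto)
qed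

lemma span_mod_mult:
  assumes "W \<subseteq> V" "a \<in> polys W" "f \<in> span_mod (polys W) M E" shows "a * f \<in> span_mod (polys W) M E"
proof -
  obtain d where d: "\<forall>e\<in>E. d e \<in> polys W" "f - (\<Sum>e\<in>E. d e * e) \<in> M"
    using assms by (auto simp: span_mod_def)
  show ?thesis
  proof (rule span_modI[of _ "\<lambda>e. a * d e"])
    have "a * f - (\<Sum>e\<in>E. (a * d e) * e) = a * (f - (\<Sum>e\<in>E. d e * e))"
      by (simp add: right_diff_distrib sum_distrib_left mult.assoc)
    then show "a * f - (\<Sum>e\<in>E. (a * d e) * e) \<in> M"
      using polys.ideal_mult[OF M_ideal subsetD[OF polys_mono[OF assms(1)] assms(2)] d(2)] by simp
  qed (use d assms in auto)
qed

lemma span_mod_M: "f \<in> M \<Longrightarrow> f \<in> span_mod (polys W) M E"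
  by (rule span_modI[of _ "\<lambda>_. 0"]) auto

lemma span_mod_cong: "f - g \<in> M \<Longrightarrow> g \<in> span_mod (polys W) M E \<Longrightarrow> f \<in> span_mod (polys W) M E"
  using span_mod_add[OF span_mod_M[of "f - g" W E], of g] by simp

lemma span_mod_base: "finite E \<Longrightarrow> e \<in> E \<Longrightarrow> e \<in> span_mod (polys W) M E"
proof (rule span_modI[of _ "\<lambda>x. if x = e then 1 else 0"])
  assume "finite E" "e \<in> E"
  then have "(\<Sum>x\<in>E. (if x = e then 1 else 0) * x) = e"
    by (simp add: if_distrib[of "\<lambda>c. c * _"] cong: if_cong)
  then show "e - (\<Sum>x\<in>E. (if x = e then 1 else 0) * x) \<in> M" using polys.ideal_zero[OF M_ideal] by simp
qed auto

lemma span_mod_sum: "(\<And>i. i \<in> I \<Longrightarrow> f i \<in> span_mod (polys W) M E) \<Longrightarrow> sum f I \<in> span_mod (polys W) M E"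
proof (induction I rule: infinite_finite_induct)
  case (insert x F)
  then show ?case by (simp add: span_mod_add)
qed (simp_all add: span_mod_M polys.ideal_zero[OF M_ideal])

lemma span_mod_trans:
  assumes WV: "W \<subseteq> V" and h: "h \<in> polys W" and EG: "\<And>e. e \<in> E \<Longrightarrow> h * e \<in> span_mod (polys W) M G"
    and f: "f \<in> span_mod (polys W) M E"
  shows "h * f \<in> span_mod (polys W) M G"
proof -
  obtain d where d: "\<forall>e\<in>E. d e \<in> polys W" "f - (\<Sum>e\<in>E. d e * e) \<in> M"
    using f by (auto simp: span_mod_def)
  have "h * f - (\<Sum>e\<in>E. d e * (h * e)) = h * (f - (\<Sum>e\<in>E. d e * e))"
    by (simp add: right_diff_distrib sum_distrib_left algebra_simps)
  also have "\<dots> \<in> M" using polys.ideal_mult[OF M_ideal _ d(2)] h WV polys_mono by blast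
  finally show ?thesis
  proof (rule span_mod_cong, intro span_mod_sum)
    show "d e * (h * e) \<in> span_mod (polys W) M G" if "e \<in> E" for e
      by (rule span_mod_mult[OF WV bspec[OF d(1) that] EG[OF that]])
  qed
qed

lemma var_power_expansion:
  fixes f :: "('v, 'k) mpoly"
  assumes f: "f \<in> polys (insert v W)" "v \<notin> W"
  obtains co where "\<And>j. co j \<in> polys W" "finite {j. co j \<noteq> 0}" "f = (\<Sum>j\<in>{j. co j \<noteq> 0}. co j * indet v ^ j)"
proof -
  define co :: "nat \<Rightarrow> ('v, 'k) mpoly" where "co = (\<lambda>j. \<Sum>m\<in>{m \<in> Poly_Mapping.keys f. Poly_Mapping.lookup m v = j}.
      Const (Poly_Mapping.lookup f m) * monomial (m - Poly_Mapping.single v j))"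
  define J where "J = (\<lambda>m. Poly_Mapping.lookup m v) ` Poly_Mapping.keys f"
  have finJ: "finite J" by (simp add: J_def)
  have "co j = 0" if "j \<notin> J" for j
  proof -
    have "{m \<in> Poly_Mapping.keys f. Poly_Mapping.lookup m v = j} = {}" using that by (auto simp: J_def)
    then show ?thesis unfolding co_def by (simp only: sum.empty)
  qed
  then have sub: "{j. co j \<noteq> 0} \<subseteq> J" by blast
  show ?thesis
  proof
    show "co j \<in> polys W" for j
      unfolding co_def
    proof (intro polys.sum_mem polys.mult_mem polys_Const)
      fix m assume m: "m \<in> {m \<in> Poly_Mapping.keys f. Poly_Mapping.lookup m v = j}"
      then have "Poly_Mapping.keys m \<subseteq> insert v W" using f by (auto simp: polys_def)
      moreover have "v \<notin> Poly_Mapping.keys (m - Poly_Mapping.single v j)"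
        using m by (simp add: in_keys_iff lookup_minus)
      ultimately show "monomial (m - Poly_Mapping.single v j) \<in> polys W"
        using keys_minus_nat[of m "Poly_Mapping.single v j"] by (auto simp: polys_monomial_mem)
    qed
    show "finite {j. co j \<noteq> 0}" using sub finJ finite_subset by blast
    have "f = (\<Sum>m\<in>Poly_Mapping.keys f. Const (Poly_Mapping.lookup f m) * monomial m)" by (rule poly_sum_monos)
    also have "\<dots> = (\<Sum>j\<in>J. \<Sum>m\<in>{m \<in> Poly_Mapping.keys f. Poly_Mapping.lookup m v = j}.
        Const (Poly_Mapping.lookup f m) * monomial m)"
      by (rule sum.group[symmetric]) (auto simp: J_def)
    also have "\<dots> = (\<Sum>j\<in>J. co j * indet v ^ j)"
    proof (rule sum.cong[OF refl])
      fix j assume "j \<in> J"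
      have "monomial m = (monomial (m - Poly_Mapping.single v j) * indet v ^ j :: ('v, 'k) mpoly)"
        if "Poly_Mapping.lookup m v = j" for m
      proof -
        have "m = (m - Poly_Mapping.single v j) + Poly_Mapping.single v j"
          using that by (intro poly_mapping_eqI) (auto simp: lookup_add lookup_minus lookup_single when_def)
        then show ?thesis by (metis indet_power monomial_add)
      qed
      then show "(\<Sum>m\<in>{m \<in> Poly_Mapping.keys f. Poly_Mapping.lookup m v = j}. Const (Poly_Mapping.lookup f m) * monomial m)
          = co j * indet v ^ j"
        unfolding co_def sum_distrib_right by (intro sum.cong) (auto simp: mult.assoc)
    qed
    also have "\<dots> = (\<Sum>j\<in>{j. co j \<noteq> 0}. co j * indet v ^ j)"
      using sub finJ by (intro sum.mono_neutral_right) auto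
    finally show "f = (\<Sum>j\<in>{j. co j \<noteq> 0}. co j * indet v ^ j)" .
  qed
qed

text \<open>The witness is \<open>p = 1 + x * h\<close> with a variable \<open>x\<close> of
  \<open>W\<close>. Modulo \<open>p\<close> the power \<open>(x * h) ^ N\<close> is
  \<open>(- 1) ^ N\<close>, so if \<open>p\<close> divided \<open>h ^ N\<close> it would be a unit,
  but it is not constant. Hence \<open>K[W]\<close> does not become a field by inverting a single
  element.\<close>

lemma indep_unit_contradiction:
  fixes h :: "('v, 'k) mpoly"
  assumes W: "W \<subseteq> V" "u \<in> W" and h: "h \<in> polys W" "h \<noteq> 0"
    and dvd: "\<And>p. p \<in> polys W \<Longrightarrow> p \<noteq> 0 \<Longrightarrow> \<exists>N. \<exists>q\<in>polys W. h ^ N = p * q"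
  shows False
proof -
  have finW: "finite W" using W finV finite_subset by blast
  let ?x = "indet u :: ('v, 'k) mpoly"
  define p where "p = 1 + ?x * h"
  have x: "?x \<in> polys W" by (rule polys_indet[OF W(2)])
  have "Poly_Mapping.keys ?x \<noteq> {}" by (simp add: indet_def)
  then have "?x \<noteq> 0" by force
  then have xh: "?x * h \<noteq> 0" "?x * h \<in> polys W"
    using polys_no_zero_divisors[OF finW x h(1)] h x by auto
  have kx: "u \<in> Poly_Mapping.keys m" if "m \<in> Poly_Mapping.keys (?x * h)" for m
    using that keys_mult[of ?x h] by (auto simp: indet_def keys_add_nat)
  have "\<not> Poly_Mapping.keys p \<subseteq> {0}"
  proof
    assume "Poly_Mapping.keys p \<subseteq> {0}"
    moreover have "Poly_Mapping.keys (?x * h) \<subseteq> Poly_Mapping.keys p \<union> {0}"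
      using keys_diff[of p 1] by (auto simp: p_def)
    ultimately have "Poly_Mapping.keys (?x * h) \<subseteq> {0}" by blast
    then have "Poly_Mapping.keys (?x * h) = {}" using kx by fastforce
    then show False using xh by simp
  qed
  have pW: "p \<in> polys W" using xh by (simp add: p_def)
  have "p \<noteq> 0" using \<open>\<not> Poly_Mapping.keys p \<subseteq> {0}\<close> by auto
  then obtain N q where q: "q \<in> polys W" "h ^ N = p * q" using dvd pW by blast
  define r where "r = (\<Sum>i<N. (- 1) ^ (N - Suc i) * (?x * h) ^ i)"
  have rW: "r \<in> polys W" unfolding r_def
    by (intro polys.sum_mem polys.mult_mem[OF polys.power_mem polys.power_mem[OF xh(2)]]) simp
  have "(?x * h) ^ N - (- 1) ^ N = (?x * h - (- 1)) * r" unfolding r_def by (rule power_diff_sumr2)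
  then have r: "(?x * h) ^ N - (- 1) ^ N = p * r" by (simp add: p_def add.commute)
  have "(- 1) ^ N = (?x * h) ^ N - p * r" by (simp flip: r)
  also have "\<dots> = p * (?x ^ N * q - r)" by (simp add: power_mult_distrib q(2) algebra_simps)
  finally have "(- 1) ^ N * (- 1) ^ N = p * (?x ^ N * q - r) * (- 1) ^ N" by simp
  then have "1 = p * (?x ^ N * q - r) * (- 1) ^ N" by (simp flip: power_mult_distrib)
  then have "p * ((?x ^ N * q - r) * (- 1) ^ N) = 1" by (simp add: mult.assoc)
  moreover have "(?x ^ N * q - r) * (- 1) ^ N \<in> polys W"
    using x q rW by (intro polys.mult_mem polys.diff_mem polys.power_mem) auto
  ultimately show False using polys_unit_const[OF finW pW] \<open>\<not> Poly_Mapping.keys p \<subseteq> {0}\<close> by blast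
qed

text \<open>\<open>W\<close> is a maximal set of variables that is algebraically independent modulo \<open>M\<close>.\<close>

lemma finite_spanning_set:
  assumes W: "W \<subseteq> V" "M \<inter> polys W = {0}" "\<And>v. v \<in> V - W \<Longrightarrow> M \<inter> polys (insert v W) \<noteq> {0}"
  obtains B c where "finite B" "B \<subseteq> polys V" "1 \<in> B" "c \<in> polys W" "c \<noteq> 0"
    "\<And>f. f \<in> polys V \<Longrightarrow> \<exists>N. c ^ N * f \<in> span_mod (polys W) M B"
proof -
  have finW: "finite W" "finite (V - W)" using W finV finite_subset by blast+
  \<comment> \<open>An algebraic relation for \<open>v\<close> modulo \<open>M\<close> over the
    polynomials in \<open>W\<close>, of degree \<open>k\<close> and with leading coefficient
    \<open>c\<close>.\<close>
  define rel where "rel = (\<lambda>v (k :: nat, c, a). 1 \<le> k \<and> c \<in> polys W \<and> c \<noteq> 0 \<and> (\<forall>j<k. a j \<in> polys W) \<and>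
      c * indet v ^ k - (\<Sum>j<k. a j * indet v ^ j) \<in> M)"
  have "\<exists>y. rel v y" if v: "v \<in> V - W" for v
  proof -
    have "0 \<in> M \<inter> polys (insert v W)" using polys.ideal_zero[OF M_ideal] by auto
    then obtain f where f: "f \<in> M" "f \<in> polys (insert v W)" "f \<noteq> 0" using W(3)[OF v] by blast
    obtain co where co: "\<And>j. co j \<in> polys W" "finite {j. co j \<noteq> 0}" "f = (\<Sum>j\<in>{j. co j \<noteq> 0}. co j * indet v ^ j)"
      using var_power_expansion[OF f(2)] v by blast
    have "{j. co j \<noteq> 0} \<noteq> {}"
    proof
      assume "{j. co j \<noteq> 0} = {}"
      then have "f = 0" using co(3) by (simp only: sum.empty)
      then show False using f by simp
    qed
    define k where "k = Max {j. co j \<noteq> 0}"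
    have k: "co k \<noteq> 0" using Max_in[OF co(2) \<open>_ \<noteq> {}\<close>] by (simp add: k_def)
    have "{j. co j \<noteq> 0} \<subseteq> {..k}" using Max_ge[OF co(2)] by (auto simp: k_def)
    then have "f = (\<Sum>j\<le>k. co j * indet v ^ j)"
      by (subst co(3)) (intro sum.mono_neutral_left, auto)
    then have fk: "f = (\<Sum>j<k. co j * indet v ^ j) + co k * indet v ^ k"
      by (simp add: lessThan_Suc_atMost[symmetric])
    have "k \<noteq> 0"
    proof
      assume "k = 0"
      then have "f \<in> polys W" using fk co(1) by simp
      then show False using f W(2) by blast
    qed
    moreover have "co k * indet v ^ k - (\<Sum>j<k. - co j * indet v ^ j) \<in> M"
      using f(1) fk by (simp add: sum_negf add.commute)
    ultimately show ?thesis using k co(1)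
      by (intro exI[of _ "(k, co k, \<lambda>j. - co j)"]) (auto simp: rel_def)
  qed
  then have "\<forall>v\<in>V - W. \<exists>y. rel v y" by blast
  from bchoice[OF this] obtain y where y: "\<forall>v\<in>V - W. rel v (y v)" by blast
  define k c a where "k v = fst (y v)" and "c v = fst (snd (y v))" and "a v = snd (snd (y v))" for v
  have "rel v (k v, c v, a v)" if "v \<in> V - W" for v using y that by (simp add: k_def c_def a_def)
  then have kca: "\<And>v. v \<in> V - W \<Longrightarrow> 1 \<le> k v" "\<And>v. v \<in> V - W \<Longrightarrow> c v \<in> polys W"
    "\<And>v. v \<in> V - W \<Longrightarrow> c v \<noteq> 0" "\<And>v j. v \<in> V - W \<Longrightarrow> j < k v \<Longrightarrow> a v j \<in> polys W"
    "\<And>v. v \<in> V - W \<Longrightarrow> c v * indet v ^ k v - (\<Sum>j<k v. a v j * indet v ^ j) \<in> M"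
    by (simp_all add: rel_def)
  \<comment> \<open>The product of all leading coefficients. One factor \<open>C\<close> is paid for
    each multiplication by a variable, so a monomial of degree \<open>n\<close> needs
    \<open>C ^ n\<close>.\<close>
  define C where "C = (\<Prod>v\<in>V - W. c v)"
  define Box where "Box = {m :: 'v \<Rightarrow>\<^sub>0 nat. Poly_Mapping.keys m \<subseteq> V - W \<and> (\<forall>v\<in>V - W. Poly_Mapping.lookup m v < k v)}"
  define B :: "('v, 'k) mpoly set" where "B = monomial ` Box"
  have C: "C \<in> polys W" unfolding C_def using kca by (intro polys.prod_mem) auto
  have "C \<noteq> 0" unfolding C_def using finW kca by (intro polys_prod_nonzero) auto
  have finBox: "finite Box"
  proof (rule finite_subset)
    let ?K = "\<Sum>v\<in>V - W. k v"
    show "Box \<subseteq> {m. Poly_Mapping.keys m \<subseteq> V - W \<and> (\<forall>v. Poly_Mapping.lookup m v \<le> ?K)}"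
    proof (rule subsetI, intro CollectI conjI allI)
      fix m and v :: 'v assume m: "m \<in> Box"
      show "Poly_Mapping.keys m \<subseteq> V - W" using m by (simp add: Box_def)
      show "Poly_Mapping.lookup m v \<le> ?K"
      proof (cases "v \<in> V - W")
        case True
        then have "Poly_Mapping.lookup m v < k v" using m by (simp add: Box_def)
        moreover have "k v \<le> ?K" using True finW by (intro member_le_sum) auto
        ultimately show ?thesis by simp
      next
        case False
        then have "v \<notin> Poly_Mapping.keys m" using m by (auto simp: Box_def)
        then show ?thesis by (simp add: in_keys_iff)
      qed
    qed
  qed (use finite_bounded_expos finW in blast)
  then have finB: "finite B" by (simp add: B_def)
  have BV: "B \<subseteq> polys V" by (auto simp: B_def Box_def polys_monomial_mem)
  have "0 \<in> Box" using kca(1) by (auto simp: Box_def Suc_le_eq)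
  then have one: "1 \<in> B" unfolding B_def by (metis image_eqI monomial_zero)
  let ?S = "span_mod (polys W) M"
  have step: "C * indet v * b \<in> ?S B" if v: "v \<in> V" and b: "b \<in> B" for v b
  proof (cases "v \<in> W")
    case True
    then show ?thesis using span_mod_mult[OF W(1) polys.mult_mem[OF C polys_indet] span_mod_base[OF finB b]] by simp
  next
    case False
    then have v: "v \<in> V - W" using v by blast
    obtain m where m: "b = monomial m" "m \<in> Box" using b by (auto simp: B_def)
    have iv: "indet v ^ j * monomial m' = (monomial (Poly_Mapping.single v j + m') :: ('v, 'k) mpoly)" for j m'
      by (simp add: indet_power monomial_add)
    show ?thesis
    proof (cases "Suc (Poly_Mapping.lookup m v) < k v")
      case True
      have "Poly_Mapping.single v 1 + m \<in> Box"
        using m v True by (auto simp: Box_def keys_add_nat lookup_add lookup_single when_def)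
      then have "indet v * b \<in> B" using iv[of 1 m] m by (simp add: B_def)
      then show ?thesis using span_mod_mult[OF W(1) C span_mod_base[OF finB]] by (simp add: mult.assoc)
    next
      \<comment> \<open>The exponent of \<open>v\<close> reaches \<open>k v\<close>. The factor
        \<open>c v\<close> of \<open>C\<close> allows the relation for \<open>v\<close> to be
        applied, which leaves only smaller exponents of \<open>v\<close>.\<close>
      case False
      have "Poly_Mapping.lookup m v < k v" using m(2) v by (simp add: Box_def)
      with False have kv: "Poly_Mapping.lookup m v = k v - 1" "1 \<le> k v" by simp_all
      define m' where "m' = m - Poly_Mapping.single v (k v - 1)"
      have mm': "m = Poly_Mapping.single v (k v - 1) + m'"
        unfolding m'_def using kv by (intro poly_mapping_eqI) (auto simp: lookup_add lookup_minus lookup_single when_def)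
      have e1: "indet v * b = indet v ^ k v * monomial m'"
      proof -
        have "Poly_Mapping.single v 1 + m = Poly_Mapping.single v 1 + Poly_Mapping.single v (k v - 1) + m'"
          by (subst mm') (simp add: add.assoc)
        also have "\<dots> = Poly_Mapping.single v (k v) + m'" using kv(2) by (simp flip: single_add)
        finally show ?thesis using iv[of 1 m] iv[of "k v" m'] m(1) by simp
      qed
      have e2: "C = (\<Prod>w\<in>V - W - {v}. c w) * c v"
        using finW v by (simp add: C_def prod.remove mult.commute)
      have "C * indet v * b = C * (indet v * b)" by (simp only: mult.assoc)
      also have "\<dots> = (\<Prod>w\<in>V - W - {v}. c w) * c v * (indet v ^ k v * monomial m')" by (simp only: e1 e2)
      finally have eq: "C * indet v * b = (\<Prod>w\<in>V - W - {v}. c w) * monomial m' * (c v * indet v ^ k v)"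
        by (simp only: mult_ac)
      let ?P = "\<Prod>w\<in>V - W - {v}. c w"
      have P: "?P \<in> polys W" using kca by (intro polys.prod_mem) auto
      have m'V: "monomial m' \<in> polys V"
        using m keys_minus_nat[of m] by (auto simp: m'_def polys_monomial_mem Box_def)
      have "?P * monomial m' * (c v * indet v ^ k v) - (\<Sum>j<k v. ?P * (a v j * monomial (Poly_Mapping.single v j + m')))
          = ?P * monomial m' * (c v * indet v ^ k v - (\<Sum>j<k v. a v j * indet v ^ j))"
        unfolding iv[symmetric] right_diff_distrib sum_distrib_left by (simp add: mult_ac)
      also have "\<dots> \<in> M" using kca(5)[OF v] P m'V polys_mono[OF W(1)]
        by (intro polys.ideal_mult[OF M_ideal] polys.mult_mem) auto
      finally show ?thesis unfolding eq
      proof (rule span_mod_cong)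
        show "(\<Sum>j<k v. ?P * (a v j * monomial (Poly_Mapping.single v j + m'))) \<in> ?S B"
        proof (intro span_mod_sum span_mod_mult[OF W(1) P] span_mod_mult[OF W(1)] span_mod_base[OF finB])
          fix j assume j: "j \<in> {..<k v}"
          then show "a v j \<in> polys W" using kca(4)[OF v] by auto
          have "Poly_Mapping.single v j + m' \<in> Box"
            using m v j kv by (auto simp: Box_def m'_def keys_add_nat lookup_add lookup_minus lookup_single when_def
                dest: subsetD[OF keys_minus_nat])
          then show "monomial (Poly_Mapping.single v j + m') \<in> B" by (simp add: B_def)
        qed
      qed
    qed
  qed
  have mult: "C * indet v * f \<in> ?S B" if v: "v \<in> V" and f: "f \<in> ?S B" for v f
  proof -
    obtain d where d: "\<forall>e\<in>B. d e \<in> polys W" "f - (\<Sum>e\<in>B. d e * e) \<in> M" using f by (auto simp: span_mod_def)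
    have "C * indet v * f - (\<Sum>e\<in>B. d e * (C * indet v * e)) = C * indet v * (f - (\<Sum>e\<in>B. d e * e))"
      by (simp add: right_diff_distrib sum_distrib_left mult_ac)
    also have "\<dots> \<in> M"
      using subsetD[OF polys_mono[OF W(1)] C] polys_indet[OF v]
      by (intro polys.ideal_mult[OF M_ideal _ d(2)] polys.mult_mem)
    finally show ?thesis
    proof (rule span_mod_cong, intro span_mod_sum)
      show "d e * (C * indet v * e) \<in> ?S B" if "e \<in> B" for e
        by (rule span_mod_mult[OF W(1) bspec[OF d(1) that] step[OF v that]])
    qed
  qed
  have mon: "C ^ n * monomial m \<in> ?S B" if "total_deg m = n" "Poly_Mapping.keys m \<subseteq> V" for n m
    using that
  proof (induction n arbitrary: m)
    case 0
    then have "m = 0" by (auto simp: total_deg_def in_keys_iff intro!: poly_mapping_eqI)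
    then show ?case using span_mod_base[OF finB one] by simp
  next
    case (Suc n)
    then have "Poly_Mapping.keys m \<noteq> {}" by (auto simp: total_deg_def)
    then obtain v where v: "v \<in> Poly_Mapping.keys m" by blast
    let ?m = "m - Poly_Mapping.single v 1"
    have "m = Poly_Mapping.single v 1 + ?m"
      using v by (intro poly_mapping_eqI) (auto simp: lookup_add lookup_minus lookup_single when_def in_keys_iff)
    then have "total_deg m = total_deg (Poly_Mapping.single v (1::nat)) + total_deg ?m" by (metis total_deg_add)
    then have "total_deg ?m = n" using Suc.prems by simp
    then have "C ^ n * monomial ?m \<in> ?S B" using Suc.IH[of ?m] Suc.prems keys_minus_nat[of m] by blast
    then have "C * indet v * (C ^ n * monomial ?m) \<in> ?S B" using mult[of v] v Suc.prems by blast
    also have "C * indet v * (C ^ n * monomial ?m) = C ^ Suc n * (indet v * monomial ?m)"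
      by (simp add: mult_ac)
    also have "indet v * monomial ?m = monomial m" by (rule indet_monomial[OF v, symmetric])
    finally show ?case .
  qed
  show ?thesis
  proof
    show "finite B" "B \<subseteq> polys V" "1 \<in> B" "C \<in> polys W" "C \<noteq> 0" by fact+
    fix f :: "('v, 'k) mpoly" assume f: "f \<in> polys V"
    define N where "N = (\<Sum>m\<in>Poly_Mapping.keys f. total_deg m)"
    have "C ^ N * f = (\<Sum>m\<in>Poly_Mapping.keys f. Const (Poly_Mapping.lookup f m) * (C ^ N * monomial m))"
      by (subst (1) poly_sum_monos) (simp add: sum_distrib_left mult_ac)
    also have "\<dots> \<in> ?S B"
    proof (intro span_mod_sum span_mod_mult[OF W(1) polys_Const])
      fix m assume m: "m \<in> Poly_Mapping.keys f"
      have "total_deg m \<le> N" unfolding N_def using m by (intro member_le_sum) auto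
      then have "C ^ N * monomial m = C ^ (N - total_deg m) * (C ^ total_deg m * monomial m)"
        by (simp add: mult.assoc[symmetric] power_add[symmetric])
      also have "\<dots> \<in> ?S B"
      proof (rule span_mod_mult[OF W(1) polys.power_mem[OF C]])
        have "Poly_Mapping.keys m \<subseteq> V" using f m by (auto simp: polys_def)
        then show "C ^ total_deg m * monomial m \<in> ?S B" using mon by blast
      qed
      finally show "C ^ N * monomial m \<in> ?S B" .
    qed
    finally show "\<exists>N. C ^ N * f \<in> ?S B" by blast
  qed
qed

text \<open>Passes from generators to a basis at the cost of a denominator: each \<open>b\<close>
  outside a maximal independent subset satisfies a relation in which its own coefficient is nonzero,
  and \<open>g\<close> multiplies these coefficients. The element 1 is kept in \<open>E\<close> so
  that \<open>no_independent_variables\<close> can compare coefficients of 1.\<close>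

lemma maximal_independent_subset:
  assumes W: "W \<subseteq> V" "M \<inter> polys W = {0}" and B: "finite B" "B \<subseteq> polys V" "1 \<in> B"
  obtains E g where "E \<subseteq> B" "1 \<in> E" "g \<in> polys W" "g \<noteq> 0" "\<And>b. b \<in> B \<Longrightarrow> g * b \<in> span_mod (polys W) M E"
    "\<forall>d. (\<Sum>e\<in>E. d e * e) \<in> M \<longrightarrow> (\<forall>e\<in>E. d e \<in> polys W) \<longrightarrow> (\<forall>e\<in>E. d e = 0)"
proof -
  have finW: "finite W" using W finV finite_subset by blast
  define ind where "ind = (\<lambda>E. \<forall>d. (\<Sum>e\<in>E. d e * e) \<in> M \<longrightarrow> (\<forall>e\<in>E. d e \<in> polys W) \<longrightarrow> (\<forall>e\<in>E. d e = 0))"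
  have "ind {1}" unfolding ind_def
  proof (intro allI impI ballI)
    fix d :: "('v, 'k) mpoly \<Rightarrow> ('v, 'k) mpoly" and e :: "('v, 'k) mpoly"
    assume "(\<Sum>e\<in>{1}. d e * e) \<in> M" "\<forall>e\<in>{1}. d e \<in> polys W" "e \<in> {1}"
    then have "d e \<in> M \<inter> polys W" by simp
    then show "d e = 0" using W(2) by blast
  qed
  then have "{1} \<in> {E. E \<subseteq> B \<and> 1 \<in> E \<and> ind E}" using B by simp
  moreover have "finite {E. E \<subseteq> B \<and> 1 \<in> E \<and> ind E}" using B by (auto intro: finite_subset[of _ "Pow B"])
  ultimately have "\<exists>E\<in>{E. E \<subseteq> B \<and> 1 \<in> E \<and> ind E}. \<forall>E'\<in>{E. E \<subseteq> B \<and> 1 \<in> E \<and> ind E}. E \<subseteq> E' \<longrightarrow> E = E'"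
    by (intro finite_has_maximal) auto
  then obtain E where E0: "E \<in> {E. E \<subseteq> B \<and> 1 \<in> E \<and> ind E}"
    "\<forall>E'\<in>{E. E \<subseteq> B \<and> 1 \<in> E \<and> ind E}. E \<subseteq> E' \<longrightarrow> E = E'"
    by (rule bexE)
  have E: "E \<subseteq> B" "1 \<in> E" "ind E" using E0(1) by simp_all
  have max: "E' = E" if "E' \<subseteq> B" "1 \<in> E'" "ind E'" "E \<subseteq> E'" for E'
    using bspec[OF E0(2), of E'] that by simp
  have finE: "finite E" using E B finite_subset by blast
  have "\<exists>g. g \<in> polys W \<and> g \<noteq> 0 \<and> g * b \<in> span_mod (polys W) M E" if b: "b \<in> B" for b
  proof (cases "b \<in> E")
    case True
    then show ?thesis using span_mod_base[OF finE] by (intro exI[of _ 1]) auto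
  next
    case False
    then have "\<not> ind (insert b E)" using max[of "insert b E"] E b by blast
    then obtain d where d: "(\<Sum>e\<in>insert b E. d e * e) \<in> M" "\<forall>e\<in>insert b E. d e \<in> polys W" "\<exists>e\<in>insert b E. d e \<noteq> 0"
      unfolding ind_def by blast
    have s: "d b * b + (\<Sum>e\<in>E. d e * e) \<in> M" using d(1) False finE by simp
    have "d b \<noteq> 0"
    proof
      assume "d b = 0"
      then have "(\<Sum>e\<in>E. d e * e) \<in> M" using s by simp
      then show False using E(3) d \<open>d b = 0\<close> unfolding ind_def by blast
    qed
    moreover have "d b * b \<in> span_mod (polys W) M E"
      by (rule span_modI[of _ "\<lambda>e. - d e"]) (use d s in \<open>auto simp: sum_negf\<close>)
    ultimately show ?thesis using d by blast
  qed
  then obtain g where g: "\<And>b. b \<in> B \<Longrightarrow> g b \<in> polys W" "\<And>b. b \<in> B \<Longrightarrow> g b \<noteq> 0"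
    "\<And>b. b \<in> B \<Longrightarrow> g b * b \<in> span_mod (polys W) M E" by metis
  show ?thesis
  proof
    show "E \<subseteq> B" "1 \<in> E" by fact+
    show "prod g B \<in> polys W" using g by (intro polys.prod_mem) auto
    show "prod g B \<noteq> 0" using finW B g by (intro polys_prod_nonzero) auto
    show "prod g B * b \<in> span_mod (polys W) M E" if b: "b \<in> B" for b
    proof -
      have "prod g B * b = prod g (B - {b}) * (g b * b)" by (simp add: prod.remove[OF B(1) b] mult_ac)
      moreover have "prod g (B - {b}) \<in> polys W" using g by (intro polys.prod_mem) auto
      ultimately show ?thesis using span_mod_mult[OF W(1) _ g(3)[OF b]] by simp
    qed
    show "\<forall>d. (\<Sum>e\<in>E. d e * e) \<in> M \<longrightarrow> (\<forall>e\<in>E. d e \<in> polys W) \<longrightarrow> (\<forall>e\<in>E. d e = 0)"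
      using E(3) unfolding ind_def .
  qed
qed

text \<open>A nonzero \<open>p\<close> in \<open>polys W\<close> has an inverse \<open>q\<close>
  modulo \<open>M\<close>. Write \<open>g * (c ^ N * q)\<close> in terms of \<open>E\<close> and
  multiply by \<open>p\<close>: the coefficient of 1 shows that \<open>p\<close> divides
  \<open>g * c ^ N\<close>. So every \<open>p\<close> divides a power of \<open>g * c\<close>, which
  \<open>indep_unit_contradiction\<close> excludes.\<close>

lemma no_independent_variables:
  assumes W: "W \<subseteq> V" "M \<inter> polys W = {0}" "\<And>v. v \<in> V - W \<Longrightarrow> M \<inter> polys (insert v W) \<noteq> {0}"
  shows "W = {}"
proof (rule ccontr)
  assume "W \<noteq> {}"
  then obtain u where u: "u \<in> W" by blast
  have finW: "finite W" using W finV finite_subset by blast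
  obtain B c where B: "finite B" "B \<subseteq> polys V" "1 \<in> B" "c \<in> polys W" "c \<noteq> 0"
    "\<And>f. f \<in> polys V \<Longrightarrow> \<exists>N. c ^ N * f \<in> span_mod (polys W) M B"
    by (rule finite_spanning_set[OF W], assumption, rule that)
  obtain E g where E: "E \<subseteq> B" "1 \<in> E" "g \<in> polys W" "g \<noteq> 0"
    "\<And>b. b \<in> B \<Longrightarrow> g * b \<in> span_mod (polys W) M E"
    "\<forall>d. (\<Sum>e\<in>E. d e * e) \<in> M \<longrightarrow> (\<forall>e\<in>E. d e \<in> polys W) \<longrightarrow> (\<forall>e\<in>E. d e = 0)"
    by (rule maximal_independent_subset[OF W(1,2) B(1-3)], rule that)
  have finE: "finite E" using E B finite_subset by blast
  have gc: "g * c \<in> polys W" "g * c \<noteq> 0"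
    using E(3,4) B(4,5) polys_no_zero_divisors[OF finW, of g c] by auto
  show False
  proof (rule indep_unit_contradiction[OF W(1) u gc])
    fix p :: "('v, 'k) mpoly" assume p: "p \<in> polys W" "p \<noteq> 0"
    then have pV: "p \<in> polys V - M" using W(2) subsetD[OF polys_mono[OF W(1)] p(1)] by blast
    obtain q where q: "q \<in> polys V" "p * q - 1 \<in> M" using inverse[OF pV] by blast
    obtain N where N: "c ^ N * q \<in> span_mod (polys W) M B" using B(6)[OF q(1)] by blast
    have "g * (c ^ N * q) \<in> span_mod (polys W) M E" by (rule span_mod_trans[OF W(1) E(3,5) N])
    then obtain d where d: "\<forall>e\<in>E. d e \<in> polys W" "g * (c ^ N * q) - (\<Sum>e\<in>E. d e * e) \<in> M"
      by (auto simp: span_mod_def)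
    \<comment> \<open>Coefficients over \<open>E\<close> that represent
      \<open>g * c ^ N - p * (g * (c ^ N * q))\<close> modulo \<open>M\<close>; this element is in
      \<open>M\<close> because \<open>p * q - 1\<close> is.\<close>
    define d' where "d' = (\<lambda>e. (if e = 1 then g * c ^ N else 0) - p * d e)"
    have "(\<Sum>e\<in>E. (if e = 1 then g * c ^ N else 0) * e) = g * c ^ N"
      using finE E(2) by (simp add: if_distrib[of "\<lambda>c. c * _"] cong: if_cong)
    then have "(\<Sum>e\<in>E. d' e * e) = g * c ^ N - p * (\<Sum>e\<in>E. d e * e)"
      by (simp add: d'_def left_diff_distrib sum_subtractf sum_distrib_left mult.assoc)
    also have "\<dots> = p * (g * (c ^ N * q) - (\<Sum>e\<in>E. d e * e)) - g * c ^ N * (p * q - 1)"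
      by (simp add: algebra_simps)
    also have "\<dots> \<in> M"
    proof (rule polys.ideal_diff[OF M_ideal])
      show "p * (g * (c ^ N * q) - (\<Sum>e\<in>E. d e * e)) \<in> M"
        using polys.ideal_mult[OF M_ideal _ d(2), of p] pV by simp
      have "g * c ^ N \<in> polys V" using subsetD[OF polys_mono[OF W(1)], of "g * c ^ N"] E(3) B(4) by simp
      then show "g * c ^ N * (p * q - 1) \<in> M" using polys.ideal_mult[OF M_ideal _ q(2)] by simp
    qed
    finally have d'M: "(\<Sum>e\<in>E. d' e * e) \<in> M" .
    have "d' e \<in> polys W" if "e \<in> E" for e
      using that d(1) E(3) p B(4) unfolding d'_def by (intro polys.diff_mem polys.mult_mem) auto
    then have "d' 1 = 0" using E(6)[rule_format, OF d'M _ E(2)] by blast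
    then have "g * c ^ N = p * d 1" by (simp add: d'_def)
    \<comment> \<open>\<open>g * c ^ N\<close> need not be a power of \<open>g * c\<close>, but it
      divides this one.\<close>
    moreover have "(g * c) ^ Suc N = g ^ N * c * (g * c ^ N)" by (simp add: power_mult_distrib algebra_simps)
    ultimately have "(g * c) ^ Suc N = p * (g ^ N * c * d 1)" by (simp add: algebra_simps)
    moreover have "g ^ N * c * d 1 \<in> polys W" using E B d by auto
    ultimately show "\<exists>N. \<exists>q\<in>polys W. (g * c) ^ N = p * q" by blast
  qed
qed

text \<open>Since no variables are independent modulo \<open>M\<close>, the denominators are
  constants and the quotient has finite dimension over \<open>K\<close>. So the powers of
  \<open>t\<close> are dependent; the relation is divided by its top nonzero coefficient, and
  \<open>1 \<notin> M\<close> makes the degree positive.\<close>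

theorem algebraic_mod_maximal:
  assumes t: "t \<in> polys V"
  obtains d c where "1 \<le> d" "t ^ d + (\<Sum>k<d. Const (c k) * t ^ k) \<in> M"
proof -
  have const0: "Const x \<notin> M" if "x \<noteq> 0" for x :: 'k
  proof
    assume "Const x \<in> M"
    then have "Const (inverse x) * Const x \<in> M" using polys.ideal_mult[OF M_ideal] polys_Const by blast
    then show False using M_prime that by (simp add: polys.is_prime_def flip: Const_mult)
  qed
  have polys_empty: "\<exists>x. f = Const x" if "f \<in> polys {}" for f :: "('v, 'k) mpoly"
  proof -
    have "Poly_Mapping.keys f \<subseteq> {0}" using that by (auto simp: polys_def)
    then have "f = Const (Poly_Mapping.lookup f 0)"
      by (intro poly_mapping_eqI) (auto simp: Const_def lookup_single when_def in_keys_iff)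
    then show ?thesis ..
  qed
  have base: "M \<inter> polys {} = {0}"
  proof
    show "M \<inter> polys {} \<subseteq> {0}"
    proof
      fix f assume f: "f \<in> M \<inter> polys {}"
      then obtain x where "f = Const x" using polys_empty by blast
      then show "f \<in> {0}" using const0[of x] f by (cases "x = 0") auto
    qed
  qed (use polys.ideal_zero[OF M_ideal] in simp)
  define \<W> where "\<W> = {W. W \<subseteq> V \<and> M \<inter> polys W = {0}}"
  have "finite \<W>" "{} \<in> \<W>" using finV base by (auto simp: \<W>_def intro: finite_subset[of _ "Pow V"])
  then obtain W where W: "W \<in> \<W>" "\<And>W'. W' \<in> \<W> \<Longrightarrow> W \<subseteq> W' \<Longrightarrow> W' = W"
    using finite_has_maximal[of \<W>] by blast
  have "W = {}"
  proof (rule no_independent_variables)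
    show "W \<subseteq> V" "M \<inter> polys W = {0}" using W by (auto simp: \<W>_def)
    fix v assume "v \<in> V - W"
    then show "M \<inter> polys (insert v W) \<noteq> {0}" using W(2)[of "insert v W"] W(1) by (auto simp: \<W>_def)
  qed
  then have ext: "M \<inter> polys (insert v {}) \<noteq> {0}" if "v \<in> V - {}" for v
    using W(2)[of "{v}"] that by (auto simp: \<W>_def)
  obtain B c where B: "finite B" "c \<in> polys {}" "c \<noteq> 0"
    "\<And>f. f \<in> polys V \<Longrightarrow> \<exists>N. c ^ N * f \<in> span_mod (polys {}) M B"
    by (rule finite_spanning_set[OF empty_subsetI base ext], assumption, rule that)
  obtain x where x: "c = Const x" "x \<noteq> 0" using polys_empty B(2,3) by fastforce
  have sp: "f \<in> span_mod (polys {}) M B" if f: "f \<in> polys V" for f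
  proof -
    obtain N where N: "c ^ N * f \<in> span_mod (polys {}) M B" using B(4)[OF f] by blast
    have "Const (inverse x) ^ N * (c ^ N * f) \<in> span_mod (polys {}) M B"
      by (rule span_mod_mult[OF _ _ N]) auto
    moreover have "Const (inverse x) ^ N * (c ^ N * f) = (Const (inverse x) * c) ^ N * f"
      by (simp add: power_mult_distrib mult.assoc)
    moreover have "Const (inverse x) * c = 1" using x by (simp flip: Const_mult)
    ultimately show ?thesis by simp
  qed
  have "\<exists>r. r \<in> pv.span B \<and> t ^ i - r \<in> M" for i
  proof -
    obtain d where d: "\<forall>e\<in>B. d e \<in> polys {}" "t ^ i - (\<Sum>e\<in>B. d e * e) \<in> M"
      using sp[of "t ^ i"] t by (auto simp: span_mod_def)
    have "(\<Sum>e\<in>B. d e * e) \<in> pv.span B"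
    proof (rule pv.span_sum)
      fix e assume e: "e \<in> B"
      then obtain y where "d e = Const y" using d polys_empty by blast
      then show "d e * e \<in> pv.span B" using pv.span_scale[OF pv.span_base[OF e]] by simp
    qed
    then show ?thesis using d by blast
  qed
  then obtain r where r: "\<And>i. r i \<in> pv.span B" "\<And>i. t ^ i - r i \<in> M" by metis
  have "\<not> (\<forall>c i. (\<Sum>i\<in>{..card B}. Const (c i) * r i) = 0 \<longrightarrow> i \<in> {..card B} \<longrightarrow> c i = 0)"
  proof
    assume "\<forall>c i. (\<Sum>i\<in>{..card B}. Const (c i) * r i) = 0 \<longrightarrow> i \<in> {..card B} \<longrightarrow> c i = 0"
    then have "card {..card B} \<le> card B" using B(1) r(1) by (intro family_card_le[of _ _ r]) auto
    then show False by simp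
  qed
  then obtain u i where u: "(\<Sum>i\<le>card B. Const (u i) * r i) = 0" "i \<le> card B" "u i \<noteq> 0" by auto
  define d where "d = Max {i. i \<le> card B \<and> u i \<noteq> 0}"
  have d: "d \<le> card B" "u d \<noteq> 0" "\<And>i. i \<le> card B \<Longrightarrow> d < i \<Longrightarrow> u i = 0"
  proof -
    have fin: "finite {i. i \<le> card B \<and> u i \<noteq> 0}" by simp
    have "d \<in> {i. i \<le> card B \<and> u i \<noteq> 0}" unfolding d_def using u by (intro Max_in) auto
    then show "d \<le> card B" "u d \<noteq> 0" by auto
    show "u i = 0" if "i \<le> card B" "d < i" for i
    proof (rule ccontr)
      assume "u i \<noteq> 0"
      then have "i \<le> d" unfolding d_def using that by (intro Max_ge[OF fin]) simp
      then show False using that by simp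
    qed
  qed
  have "(\<Sum>i\<le>card B. Const (u i) * t ^ i) = (\<Sum>i\<le>card B. Const (u i) * (t ^ i - r i)) + (\<Sum>i\<le>card B. Const (u i) * r i)"
    by (simp add: sum.distrib[symmetric] algebra_simps)
  also have "\<dots> \<in> M" unfolding u(1)
    using r(2) polys.ideal_mult[OF M_ideal polys_Const] by (auto intro!: polys.ideal_sum[OF M_ideal])
  also have "(\<Sum>i\<le>card B. Const (u i) * t ^ i) = (\<Sum>i\<le>d. Const (u i) * t ^ i)"
    using d by (intro sum.mono_neutral_right) auto
  finally have "(\<Sum>i\<le>d. Const (u i) * t ^ i) \<in> M" .
  then have "Const (inverse (u d)) * (\<Sum>i\<le>d. Const (u i) * t ^ i) \<in> M"
    using polys.ideal_mult[OF M_ideal polys_Const] by blast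
  moreover have "Const (inverse (u d)) * (\<Sum>i\<le>d. Const (u i) * t ^ i)
      = t ^ d + (\<Sum>k<d. Const (inverse (u d) * u k) * t ^ k)"
    using d(2) by (simp add: lessThan_Suc_atMost[symmetric] distrib_left sum_distrib_left Const_mult mult.assoc[symmetric]
        flip: Const_mult)
  ultimately have rel: "t ^ d + (\<Sum>k<d. Const (inverse (u d) * u k) * t ^ k) \<in> M" by simp
  moreover have "1 \<le> d"
  proof (rule ccontr)
    assume "\<not> 1 \<le> d"
    then have "d = 0" by simp
    then have "1 \<in> M" using rel by simp
    then show False using M_prime by (simp add: polys.is_prime_def)
  qed
  ultimately show ?thesis using that[of d "\<lambda>k. inverse (u d) * u k"] by simp
qed

end

section \<open>Combinatorics\<close>

text \<open>The induction of Halmos and Vaughan. If some proper nonempty \<open>B\<close> has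
  exactly \<open>card B\<close> neighbours, then \<open>B\<close> and its complement are matched
  separately. Otherwise every proper nonempty subset has a neighbour to spare, and an arbitrary pair
  can be matched and removed.\<close>

lemma hall_marriage:
  assumes "finite A" "\<And>a. a \<in> A \<Longrightarrow> finite (N a)" "\<And>B. B \<subseteq> A \<Longrightarrow> card B \<le> card (\<Union>b\<in>B. N b)"
  shows "\<exists>f. inj_on f A \<and> (\<forall>a\<in>A. f a \<in> N a)"
  using assms
proof (induction "card A" arbitrary: A N rule: less_induct)
  case less
  note fin = less.prems(1,2) and hall = less.prems(3)
  have finU: "finite (\<Union>b\<in>B. N b)" if "B \<subseteq> A" for B
    using that fin finite_subset[of B A] by auto
  show ?case
  proof (cases "A = {}")
    case False
    then obtain a where a: "a \<in> A" by blast
    show ?thesis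
    proof (cases "\<exists>B. B \<noteq> {} \<and> B \<subset> A \<and> card (\<Union>b\<in>B. N b) = card B")
      case True
      then obtain B where B: "B \<noteq> {}" "B \<subset> A" "card (\<Union>b\<in>B. N b) = card B" by blast
      let ?U = "\<Union>b\<in>B. N b"
      have BA: "B \<subseteq> A" "card B < card A" "finite B" using B fin psubset_card_mono[of A B] finite_subset[of B A] by auto
      have "\<exists>f. inj_on f B \<and> (\<forall>a\<in>B. f a \<in> N a)"
        using BA fin by (intro less.hyps) (auto intro: hall)
      then obtain f where f: "inj_on f B" "\<forall>a\<in>B. f a \<in> N a" by blast
      have "\<exists>g. inj_on g (A - B) \<and> (\<forall>a\<in>A - B. g a \<in> N a - ?U)"
      proof (rule less.hyps)
        show "card (A - B) < card A"
          using B BA fin by (intro psubset_card_mono) auto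
        fix C assume C: "C \<subseteq> A - B"
        have finC: "finite C" using C fin finite_subset[of C A] by auto
        have "card C + card B = card (C \<union> B)" using C BA finC by (subst card_Un_disjoint) auto
        also have "\<dots> \<le> card (\<Union>b\<in>C \<union> B. N b)" using C BA by (intro hall) auto
        also have "(\<Union>b\<in>C \<union> B. N b) = (\<Union>b\<in>C. N b - ?U) \<union> ?U" by auto
        also have "card \<dots> = card (\<Union>b\<in>C. N b - ?U) + card ?U"
          using finU[of "C \<union> B"] C BA by (intro card_Un_disjoint) (auto intro: finite_subset)
        finally show "card C \<le> card (\<Union>b\<in>C. N b - ?U)" using B(3) by simp
      qed (use fin in auto)
      then obtain g where g: "inj_on g (A - B)" "\<forall>a\<in>A - B. g a \<in> N a - ?U" by blast
      let ?h = "\<lambda>a. if a \<in> B then f a else g a"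
      have "inj_on ?h A"
      proof (rule inj_onI)
        fix x y assume xy: "x \<in> A" "y \<in> A" "?h x = ?h y"
        have fU: "f b \<in> ?U" if "b \<in> B" for b using f that by blast
        have gU: "g c \<notin> ?U" if "c \<in> A - B" for c using g that by blast
        show "x = y"
          using xy fU[of x] fU[of y] gU[of x] gU[of y] inj_onD[OF f(1), of x y] inj_onD[OF g(1), of x y]
          by (cases "x \<in> B"; cases "y \<in> B") auto
      qed
      moreover have "\<forall>a\<in>A. ?h a \<in> N a" using f g by auto
      ultimately show ?thesis by blast
    next
      case False
      have "1 \<le> card (N a)" using hall[of "{a}"] a by auto
      then have "N a \<noteq> {}" by force
      then obtain x where x: "x \<in> N a" by blast
      have "\<exists>g. inj_on g (A - {a}) \<and> (\<forall>b\<in>A - {a}. g b \<in> N b - {x})"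
      proof (rule less.hyps)
        show "card (A - {a}) < card A" using a fin by (intro psubset_card_mono) auto
        fix C assume C: "C \<subseteq> A - {a}"
        show "card C \<le> card (\<Union>b\<in>C. N b - {x})"
        proof (cases "C = {}")
          case False
          have "card C \<noteq> card (\<Union>b\<in>C. N b)"
            using \<open>\<not> (\<exists>B. B \<noteq> {} \<and> B \<subset> A \<and> card (\<Union>b\<in>B. N b) = card B)\<close> False C a by (metis Diff_insert_absorb
              insert_Diff psubsetI subset_Diff_insert subset_insertI2 insertI1 subsetD)
          then have "card C < card (\<Union>b\<in>C. N b)" using hall[of C] C by force
          also have "(\<Union>b\<in>C. N b) \<subseteq> insert x (\<Union>b\<in>C. N b - {x})" by auto
          then have "card (\<Union>b\<in>C. N b) \<le> card (insert x (\<Union>b\<in>C. N b - {x}))"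
            using finU[of C] C by (intro card_mono) (auto intro: finite_subset[OF _ finU[of C]])
          also have "\<dots> \<le> Suc (card (\<Union>b\<in>C. N b - {x}))" by (rule card_insert_le_m1) simp_all
          finally show ?thesis by simp
        qed simp
      qed (use fin in auto)
      then obtain g where g: "inj_on g (A - {a})" "\<forall>b\<in>A - {a}. g b \<in> N b - {x}" by blast
      have "inj_on (g(a := x)) A"
      proof (rule inj_onI)
        fix u w assume uw: "u \<in> A" "w \<in> A" "(g(a := x)) u = (g(a := x)) w"
        have gx: "g c \<noteq> x" if "c \<in> A" "c \<noteq> a" for c using g that by blast
        show "u = w"
          using uw gx[of u] gx[of w] inj_onD[OF g(1), of u w] by (cases "u = a"; cases "w = a") auto
      qed
      moreover have "\<forall>b\<in>A. (g(a := x)) b \<in> N b" using g x by auto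
      ultimately show ?thesis by blast
    qed
  qed simp
qed

section \<open>Independent sets, facets and vertex covers\<close>

locale graph =
  fixes V :: "'v set" and E :: "'v set set"
  assumes simple: "simple_graph V E"
begin

abbreviation "\<Delta> \<equiv> independence_complex V E"

lemma finV: "finite V"
  using simple by (simp add: simple_graph_def)

lemma edge_doubleton: assumes "e \<in> E" obtains u v where "e = {u, v}" "u \<noteq> v" "u \<in> V" "v \<in> V"
proof -
  have "card e = 2" "e \<subseteq> V" using assms simple by (auto simp: simple_graph_def)
  then show ?thesis using that by (auto simp: card_2_iff)
qed

lemma adj_neq: "{u, v} \<in> E \<Longrightarrow> u \<noteq> v"
  using simple by (force simp: simple_graph_def)

lemma adj_V: "{u, v} \<in> E \<Longrightarrow> u \<in> V \<and> v \<in> V"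
  using simple by (auto simp: simple_graph_def)

lemma indepI: "F \<subseteq> V \<Longrightarrow> (\<And>u v. u \<in> F \<Longrightarrow> v \<in> F \<Longrightarrow> {u, v} \<notin> E) \<Longrightarrow> F \<in> \<Delta>"
  by (auto simp: independence_complex_def)

lemma indepD: "F \<in> \<Delta> \<Longrightarrow> u \<in> F \<Longrightarrow> v \<in> F \<Longrightarrow> {u, v} \<notin> E"
  by (auto simp: independence_complex_def)

lemma indep_V: "F \<in> \<Delta> \<Longrightarrow> F \<subseteq> V"
  by (auto simp: independence_complex_def)

lemma indep_subset: "F \<in> \<Delta> \<Longrightarrow> F' \<subseteq> F \<Longrightarrow> F' \<in> \<Delta>"
  by (auto simp: independence_complex_def)

lemma indep_finite: "F \<in> \<Delta> \<Longrightarrow> finite F"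
  using indep_V finV finite_subset by blast

lemma finite_complex: "finite \<Delta>"
  using finV by (auto simp: independence_complex_def intro: finite_subset[of _ "Pow V"])

lemma facet_indep: "facet \<Delta> F \<Longrightarrow> F \<in> \<Delta>"
  by (simp add: facet_def)

lemma facet_extends: assumes "A \<in> \<Delta>" obtains F where "facet \<Delta> F" "A \<subseteq> F"
proof -
  have "\<exists>F\<in>\<Delta>. A \<subseteq> F \<and> (\<forall>H\<in>\<Delta>. F \<subseteq> H \<longrightarrow> F = H)"
    by (rule finite_has_maximal2[OF finite_complex assms])
  then show ?thesis using that unfolding facet_def by blast
qed

lemma vertex_cover_iff: "vertex_cover V E C \<longleftrightarrow> C \<subseteq> V \<and> V - C \<in> \<Delta>"
proof
  assume C: "vertex_cover V E C"
  have "{u, v} \<notin> E" if "u \<in> V - C" "v \<in> V - C" for u v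
  proof
    assume "{u, v} \<in> E"
    then have "{u, v} \<inter> C \<noteq> {}" using C by (auto simp: vertex_cover_def)
    then show False using that by auto
  qed
  then show "C \<subseteq> V \<and> V - C \<in> \<Delta>" using C by (auto simp: vertex_cover_def intro: indepI)
next
  assume C: "C \<subseteq> V \<and> V - C \<in> \<Delta>"
  have "e \<inter> C \<noteq> {}" if e: "e \<in> E" for e
  proof
    assume eC: "e \<inter> C = {}"
    obtain u v where "e = {u, v}" "u \<in> V" "v \<in> V" using edge_doubleton[OF e] by metis
    then show False using e eC indepD[of "V - C" u v] C by auto
  qed
  then show "vertex_cover V E C" using C by (simp add: vertex_cover_def)
qed

lemma facet_imp_minimal_vertex_cover: assumes F: "facet \<Delta> F" shows "minimal_vertex_cover V E (V - F)"
proof -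
  have FV: "F \<subseteq> V" using F facet_indep indep_V by blast
  then have VF: "V - (V - F) = F" by blast
  have "\<not> vertex_cover V E D" if D: "D \<subset> V - F" for D
  proof
    assume "vertex_cover V E D"
    then have "V - D \<in> \<Delta>" by (simp add: vertex_cover_iff)
    moreover have "F \<subset> V - D" using D FV by blast
    ultimately show False using F unfolding facet_def by blast
  qed
  then show ?thesis using F facet_indep VF by (simp add: minimal_vertex_cover_def vertex_cover_iff)
qed

lemma unmixed_facets:
  assumes "unmixed_graph V E" "facet \<Delta> F" "facet \<Delta> H" shows "card F = card H"
proof -
  have FH: "F \<subseteq> V" "H \<subseteq> V" using assms facet_indep indep_V by blast+
  have "card (V - F) = card (V - H)"
    using assms(1) facet_imp_minimal_vertex_cover[OF assms(2)] facet_imp_minimal_vertex_cover[OF assms(3)]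
    unfolding unmixed_graph_def by blast
  moreover have "card (V - F) = card V - card F" "card (V - H) = card V - card H"
    using FH finV finite_subset by (blast intro: card_Diff_subset)+
  moreover have "card F \<le> card V" "card H \<le> card V" using FH finV by (simp_all add: card_mono)
  ultimately show ?thesis by linarith
qed

end

section \<open>Hall's condition in a graph whose facets have the same size\<close>

locale well_covered_graph = graph +
  assumes no_isolated: "no_isolated_vertex V E"
    and facets_card: "\<And>F H. facet \<Delta> F \<Longrightarrow> facet \<Delta> H \<Longrightarrow> card F = card H"
begin

definition nbs :: "'a set \<Rightarrow> 'a set" where
  "nbs A = {v \<in> V. \<exists>a\<in>A. {a, v} \<in> E}"

lemma finite_nbs: "finite (nbs A)"
  using finV by (simp add: nbs_def)

lemma indep_card_le: "A \<in> \<Delta> \<Longrightarrow> facet \<Delta> F \<Longrightarrow> card A \<le> card F"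
proof -
  assume A: "A \<in> \<Delta>" and F: "facet \<Delta> F"
  obtain H where H: "facet \<Delta> H" "A \<subseteq> H" using facet_extends[OF A] .
  then have "card A \<le> card H" using indep_finite[OF facet_indep] by (intro card_mono) auto
  then show ?thesis using facets_card[OF F H(1)] by simp
qed

text \<open>This is Hall's condition. Take a facet \<open>J\<close> through a neighbour of some
  \<open>a\<close> in \<open>A\<close>; then \<open>a\<close> is not in \<open>J\<close>, and
  induction applies to \<open>A \<inter> J\<close>, whose neighbours lie outside \<open>J\<close>.
  Exchanging the neighbours of \<open>A - J\<close> in \<open>J\<close> for \<open>A - J\<close>
  itself gives an independent set, which is no larger than \<open>J\<close>; so \<open>A - J\<close>
  has at least \<open>card (A - J)\<close> neighbours in \<open>J\<close>. The two sets of
  neighbours are disjoint.\<close>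

lemma indep_card_le_nbs: "A \<in> \<Delta> \<Longrightarrow> card A \<le> card (nbs A)"
proof (induction "card A" arbitrary: A rule: less_induct)
  case less
  show ?case
  proof (cases "A = {}")
    case False
    then obtain a where a: "a \<in> A" by blast
    then have "a \<in> V" using less.prems indep_V by blast
    then obtain e where "e \<in> E" "a \<in> e" using no_isolated by (auto simp: no_isolated_vertex_def)
    moreover from this obtain u w where "e = {u, w}" by (elim edge_doubleton)
    ultimately have "\<exists>v. {a, v} \<in> E" by (auto simp: insert_commute)
    then obtain v where v: "{a, v} \<in> E" ..
    have "{v} \<in> \<Delta>" using v adj_V adj_neq by (intro indepI) fastforce+
    then obtain J where J: "facet \<Delta> J" "v \<in> J" by (rule facet_extends) auto
    note Ji = facet_indep[OF J(1)]
    have finA: "finite A" "finite J" using less.prems Ji indep_finite by auto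
    have "a \<notin> J" using J(2) v indepD[OF Ji] by blast
    then have sm: "card (A \<inter> J) < card A" using a finA by (intro psubset_card_mono) auto
    let ?P = "J \<inter> nbs (A - J)" and ?Q = "nbs (A \<inter> J)"
    have "(J - nbs (A - J)) \<union> (A - J) \<in> \<Delta>"
    proof (rule indepI)
      show "(J - nbs (A - J)) \<union> (A - J) \<subseteq> V" using less.prems Ji indep_V by blast
      fix u w assume uw: "u \<in> (J - nbs (A - J)) \<union> (A - J)" "w \<in> (J - nbs (A - J)) \<union> (A - J)"
      show "{u, w} \<notin> E"
      proof
        assume e: "{u, w} \<in> E"
        then have uV: "u \<in> V" "w \<in> V" and e': "{w, u} \<in> E" using adj_V by (auto simp: insert_commute)
        have "\<not> (u \<in> J \<and> w \<in> J)" "\<not> (u \<in> A \<and> w \<in> A)"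
          using e indepD[OF Ji] indepD[OF less.prems] by blast+
        then show False using uw e e' uV by (auto simp: nbs_def)
      qed
    qed
    from indep_card_le[OF this J(1)]
    have "card ((J - nbs (A - J)) \<union> (A - J)) \<le> card J" .
    moreover have "card ((J - nbs (A - J)) \<union> (A - J)) = card (J - nbs (A - J)) + card (A - J)"
      using finA by (intro card_Un_disjoint) auto
    moreover have "card J = card (J - nbs (A - J)) + card ?P"
      using finA by (metis add.commute card_Int_Diff)
    ultimately have 1: "card (A - J) \<le> card ?P" by linarith
    have 2: "card (A \<inter> J) \<le> card ?Q"
      using less.hyps[OF sm] less.prems indep_subset[of A "A \<inter> J"] by blast
    have "?P \<inter> ?Q = {}" using indepD[OF Ji] by (auto simp: nbs_def)
    then have "card ?P + card ?Q = card (?P \<union> ?Q)"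
      using finA finite_nbs by (subst card_Un_disjoint) auto
    also have "\<dots> \<le> card (nbs A)" using finite_nbs by (intro card_mono) (auto simp: nbs_def)
    finally have "card ?P + card ?Q \<le> card (nbs A)" .
    moreover have "card A = card (A - J) + card (A \<inter> J)" using finA by (metis add.commute card_Int_Diff)
    ultimately show ?thesis using 1 2 by linarith
  qed simp
qed

text \<open>Hall's theorem embeds \<open>Y\<close> into its complement, so
  \<open>2 * card Y \<le> card V\<close>; together with \<open>half\<close> the embedding is
  onto.\<close>

lemma matching_exists:
  assumes Y: "facet \<Delta> Y" and half: "card V \<le> 2 * card Y"
  obtains p where "bij_betw p Y (V - Y)" "\<And>y. y \<in> Y \<Longrightarrow> {y, p y} \<in> E" "card V = 2 * card Y"
proof -
  note Yi = facet_indep[OF Y]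
  have finY: "finite Y" "Y \<subseteq> V" using Yi indep_finite indep_V by auto
  have "\<exists>f. inj_on f Y \<and> (\<forall>a\<in>Y. f a \<in> nbs {a})"
  proof (rule hall_marriage[OF finY(1) finite_nbs])
    fix B assume "B \<subseteq> Y"
    then have "card B \<le> card (nbs B)" using indep_card_le_nbs indep_subset[OF Yi] by blast
    also have "nbs B = (\<Union>b\<in>B. nbs {b})" by (auto simp: nbs_def)
    finally show "card B \<le> card (\<Union>b\<in>B. nbs {b})" .
  qed
  then obtain p where p: "inj_on p Y" "\<And>y. y \<in> Y \<Longrightarrow> p y \<in> nbs {y}" by blast
  have pe: "{y, p y} \<in> E" "p y \<in> V" if "y \<in> Y" for y using p(2)[OF that] by (auto simp: nbs_def)
  have sub: "p ` Y \<subseteq> V - Y" using pe indepD[OF Yi] by blast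
  have cVY: "card (V - Y) = card V - card Y" using finY finV by (intro card_Diff_subset) auto
  have "card Y \<le> card (V - Y)" using card_inj_on_le[OF p(1) sub] finV by simp
  moreover have "card Y \<le> card V" using finY finV by (intro card_mono) auto
  ultimately have eq: "card V = 2 * card Y" using half cVY by linarith
  then have "card (p ` Y) = card (V - Y)" using card_image[OF p(1)] cVY by simp
  then have "p ` Y = V - Y" using sub finV by (intro card_subset_eq) auto
  then show ?thesis using that p(1) pe eq by (auto simp: bij_betw_def)
qed

end

section \<open>The preorder on a facet: matchings, shellings and connectedness\<close>

locale matched_graph = graph +
  fixes n :: nat and Y :: "'a set" and p :: "'a \<Rightarrow> 'a"
  assumes facet_card: "\<And>F. facet \<Delta> F \<Longrightarrow> card F = n"
    and Y: "facet \<Delta> Y" and p: "bij_betw p Y (V - Y)" and p_edge: "\<And>y. y \<in> Y \<Longrightarrow> {y, p y} \<in> E"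
begin

lemma Y_indep: "Y \<in> \<Delta>" by (rule facet_indep[OF Y])

lemma Y_V: "Y \<subseteq> V" by (rule indep_V[OF Y_indep])

lemma finY: "finite Y" by (rule indep_finite[OF Y_indep])

lemma p_V: "y \<in> Y \<Longrightarrow> p y \<in> V" "y \<in> Y \<Longrightarrow> p y \<notin> Y"
  using p by (auto simp: bij_betw_def)

lemma p_inj: "x \<in> Y \<Longrightarrow> y \<in> Y \<Longrightarrow> p x = p y \<longleftrightarrow> x = y"
  using p by (auto simp: bij_betw_def inj_on_def)

lemma p_surj: assumes "v \<in> V - Y" obtains y where "y \<in> Y" "v = p y"
  using assms p by (auto simp: bij_betw_def)

lemma V_cases: assumes "v \<in> V" obtains "v \<in> Y" | y where "y \<in> Y" "v = p y"
  using assms p_surj by blast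

lemma not_both: "F \<in> \<Delta> \<Longrightarrow> y \<in> Y \<Longrightarrow> \<not> (y \<in> F \<and> p y \<in> F)"
  using p_edge indepD by blast

text \<open>\<open>?c\<close> sends a vertex to the matching edge that contains it, named by its end
  in \<open>Y\<close>. It is injective on \<open>F\<close> because the two ends of an edge are not
  both in \<open>F\<close>.\<close>

lemma indep_transversal:
  assumes F: "F \<in> \<Delta>"
  shows "card F = card {y \<in> Y. y \<in> F \<or> p y \<in> F}"
proof -
  let ?c = "\<lambda>v. if v \<in> Y then v else inv_into Y p v"
  have c: "?c v \<in> Y" "?c v \<in> F \<or> p (?c v) \<in> F" if "v \<in> F" for v
  proof -
    have "v \<in> V" using that F indep_V by blast
    then show "?c v \<in> Y" "?c v \<in> F \<or> p (?c v) \<in> F"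
      using that p inv_into_into[of v p Y] f_inv_into_f[of v p Y] by (auto simp: bij_betw_def)
  qed
  have "bij_betw ?c F {y \<in> Y. y \<in> F \<or> p y \<in> F}"
    unfolding bij_betw_def
  proof
    show "inj_on ?c F"
    proof (rule inj_onI)
      fix u v assume uv: "u \<in> F" "v \<in> F" "?c u = ?c v"
      have V: "u \<in> V" "v \<in> V" using uv F indep_V by auto
      have pi: "w \<notin> Y \<Longrightarrow> w \<in> V \<Longrightarrow> p (?c w) = w" for w using p f_inv_into_f[of w p Y] by (auto simp: bij_betw_def)
      show "u = v"
        using uv c[of u] c[of v] pi[of u] pi[of v] V not_both[OF F, of "?c u"]
        by (cases "u \<in> Y"; cases "v \<in> Y") auto
    qed
    show "?c ` F = {y \<in> Y. y \<in> F \<or> p y \<in> F}"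
    proof
      show "?c ` F \<subseteq> {y \<in> Y. y \<in> F \<or> p y \<in> F}"
      proof (rule image_subsetI)
        fix v assume "v \<in> F"
        then show "?c v \<in> {y \<in> Y. y \<in> F \<or> p y \<in> F}" using c[of v] by blast
      qed
      show "{y \<in> Y. y \<in> F \<or> p y \<in> F} \<subseteq> ?c ` F"
      proof
        fix y assume "y \<in> {y \<in> Y. y \<in> F \<or> p y \<in> F}"
        then consider "y \<in> Y" "y \<in> F" | "y \<in> Y" "p y \<in> F" by blast
        then show "y \<in> ?c ` F"
        proof cases
          case 1
          then show ?thesis by (intro image_eqI[of _ _ y]) auto
        next
          case 2
          then have "?c (p y) = y" using p_V p by (auto simp: bij_betw_def)
          then show ?thesis using 2 by (intro image_eqI[of _ _ "p y"]) auto
        qed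
      qed
    qed
  qed
  then show ?thesis by (rule bij_betw_same_card)
qed

lemma card_Y: "card Y = n" by (rule facet_card[OF Y])

text \<open>A facet has \<open>n\<close> vertices, distributed over \<open>n\<close> matching edges
  with at most one in each.\<close>

lemma facet_exactly_one:
  assumes F: "facet \<Delta> F" and y: "y \<in> Y" shows "p y \<in> F \<longleftrightarrow> y \<notin> F"
proof -
  have "card {y \<in> Y. y \<in> F \<or> p y \<in> F} = card Y"
    using indep_transversal[OF facet_indep[OF F]] facet_card[OF F] card_Y by simp
  then have "{y \<in> Y. y \<in> F \<or> p y \<in> F} = Y" using finY by (intro card_subset_eq) auto
  then show ?thesis using y not_both[OF facet_indep[OF F] y] by blast
qed

lemma facet_iff_card: "facet \<Delta> F \<longleftrightarrow> F \<in> \<Delta> \<and> card F = n"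
proof
  assume F: "F \<in> \<Delta> \<and> card F = n"
  then obtain H where H: "facet \<Delta> H" "F \<subseteq> H" using facet_extends by blast
  then have "F = H" using F facet_card indep_finite[OF facet_indep] by (intro card_subset_eq) auto
  then show "facet \<Delta> F" using H by simp
qed (simp add: facet_indep facet_card)

lemma facet_eqI:
  assumes F: "facet \<Delta> F" "facet \<Delta> H" and "F - Y = H - Y" shows "F = H"
proof -
  have "v \<in> F \<longleftrightarrow> v \<in> H" if "v \<in> V" for v
    using that
  proof (cases rule: V_cases)
    case 1
    have "p v \<in> F \<longleftrightarrow> p v \<in> H" using assms(3) p_V[OF 1] by blast
    then show ?thesis using facet_exactly_one[OF F(1) 1] facet_exactly_one[OF F(2) 1] by blast
  next
    case (2 y)
    then show ?thesis using assms(3) p_V[of y] by blast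
  qed
  then show ?thesis using F facet_indep indep_V by blast
qed

text \<open>A facet through nonadjacent \<open>z\<close> and \<open>w\<close> would contain neither
  \<open>y\<close> nor \<open>p y\<close>. For \<open>z = w\<close> this says that no vertex is
  adjacent to both ends of a matching edge; otherwise it is the source of the transitivity of
  \<open>below\<close>.\<close>

lemma adj_through_edge:
  assumes y: "y \<in> Y" and "{z, p y} \<in> E" "{w, y} \<in> E" shows "{z, w} \<in> E"
proof (rule ccontr)
  assume ne: "{z, w} \<notin> E"
  have "{z, w} \<in> \<Delta>"
    using ne adj_V[OF assms(2)] adj_V[OF assms(3)] adj_neq[of z z] adj_neq[of w w]
    by (intro indepI) (auto simp: insert_commute)
  then obtain F where F: "facet \<Delta> F" "{z, w} \<subseteq> F" by (rule facet_extends)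
  have "p y \<notin> F" "y \<notin> F" using F assms indepD[OF facet_indep[OF F(1)]] by blast+
  then show False using facet_exactly_one[OF F(1) y] by blast
qed

definition below :: "'a \<Rightarrow> 'a \<Rightarrow> bool" where
  "below x y \<longleftrightarrow> x \<in> Y \<and> y \<in> Y \<and> {p x, y} \<in> E"

definition antisymmetric :: bool where
  "antisymmetric \<longleftrightarrow> (\<forall>x y. below x y \<longrightarrow> below y x \<longrightarrow> x = y)"

lemma below_refl: "y \<in> Y \<Longrightarrow> below y y"
  using p_edge by (auto simp: below_def insert_commute)

lemma below_trans: "below x y \<Longrightarrow> below y z \<Longrightarrow> below x z"
  using adj_through_edge[of y z "p x"] by (auto simp: below_def insert_commute)

text \<open>The size of the down-set is a rank for the partial order; it serves for the induction
  over matchings and for choosing a minimal element in the shelling.\<close>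

lemma below_downset_less:
  assumes anti: "antisymmetric" and b: "below x y" "x \<noteq> y"
  shows "card {z. below z x} < card {z. below z y}"
proof (rule psubset_card_mono)
  show "finite {z. below z y}" using finY by (auto simp: below_def intro: finite_subset[of _ Y])
  have "{z. below z x} \<subseteq> {z. below z y}" using b below_trans by blast
  moreover have "below y y" using b below_refl by (simp add: below_def)
  moreover have "\<not> below y x" using anti b by (auto simp: antisymmetric_def)
  ultimately show "{z. below z x} \<subset> {z. below z y}" by blast
qed

lemma matching_of_bij:
  assumes q: "bij_betw q Y (V - Y)" "\<And>y. y \<in> Y \<Longrightarrow> {y, q y} \<in> E"
  shows "perfect_matching V E ((\<lambda>y. {y, q y}) ` Y)"
  unfolding perfect_matching_def
proof (intro conjI)
  show "(\<lambda>y. {y, q y}) ` Y \<subseteq> E" using q by auto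
  have qY: "q y \<in> V - Y" if "y \<in> Y" for y using q(1) that by (auto simp: bij_betw_def)
  have qi: "q x = q y \<Longrightarrow> x = y" if "x \<in> Y" "y \<in> Y" for x y
    using q(1) that by (auto simp: bij_betw_def inj_on_def)
  show "disjoint ((\<lambda>y. {y, q y}) ` Y)"
    unfolding pairwise_def disjnt_def
  proof (intro ballI impI)
    fix e e' assume "e \<in> (\<lambda>y. {y, q y}) ` Y" "e' \<in> (\<lambda>y. {y, q y}) ` Y" "e \<noteq> e'"
    then obtain x y where "x \<in> Y" "y \<in> Y" "e = {x, q x}" "e' = {y, q y}" "x \<noteq> y" by blast
    then show "e \<inter> e' = {}" using qY[of x] qY[of y] qi[of x y] by auto
  qed
  show "\<Union> ((\<lambda>y. {y, q y}) ` Y) = V"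
    using q(1) Y_V by (auto simp: bij_betw_def)
qed

text \<open>A matching \<open>M\<close> pairs each \<open>y\<close> with some
  \<open>p (s y)\<close>, and \<open>s y\<close> is below \<open>y\<close>. An injective map of a
  finite partial order into itself that never goes up is the identity.\<close>

lemma antisymmetric_imp_unique_matching:
  assumes anti: "antisymmetric" shows "\<exists>!M. perfect_matching V E M"
proof (rule ex1I)
  show "perfect_matching V E ((\<lambda>y. {y, p y}) ` Y)" using matching_of_bij p p_edge by blast
  fix M assume M: "perfect_matching V E M"
  have ME: "M \<subseteq> E" and MV: "\<Union>M = V" using M by (auto simp: perfect_matching_def)
  have dis: "e = e'" if "e \<in> M" "e' \<in> M" "v \<in> e" "v \<in> e'" for e e' v
    using M that unfolding perfect_matching_def pairwise_def disjnt_def by blast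
  have ex: "\<exists>x. x \<in> Y \<and> {y, p x} \<in> M" if y: "y \<in> Y" for y
  proof -
    obtain e where e: "e \<in> M" "y \<in> e" using MV y Y_V by blast
    from e ME have "e \<in> E" by blast
    then obtain u v where uv: "e = {u, v}" "u \<in> V" "v \<in> V" by (elim edge_doubleton)
    then have "\<exists>w. e = {y, w} \<and> w \<in> V" using e(2) by (auto simp: insert_commute)
    then obtain w where w: "e = {y, w}" "w \<in> V" by blast
    then have "w \<notin> Y" using e ME indepD[OF Y_indep y] by blast
    then obtain x where "x \<in> Y" "w = p x" using w p_surj by blast
    then show ?thesis using e w by blast
  qed
  then obtain s where s: "\<And>y. y \<in> Y \<Longrightarrow> s y \<in> Y" "\<And>y. y \<in> Y \<Longrightarrow> {y, p (s y)} \<in> M" by metis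
  have s_below: "below (s y) y" if "y \<in> Y" for y
    using s[OF that] ME that by (auto simp: below_def insert_commute)
  have s_inj: "x = y" if "x \<in> Y" "y \<in> Y" "s x = s y" for x y
  proof -
    have "{x, p (s x)} = {y, p (s x)}"
      using dis[OF s(2)[OF that(1)] s(2)[OF that(2)], of "p (s x)"] that by simp
    then show ?thesis by (auto simp: doubleton_eq_iff)
  qed
  have s_id: "s y = y" if "y \<in> Y" for y
    using that
  proof (induction "card {z. below z y}" arbitrary: y rule: less_induct)
    case less
    show ?case
    proof (rule ccontr)
      assume ne: "s y \<noteq> y"
      then have "s (s y) = s y"
        using less below_downset_less[OF anti s_below[OF less.prems]] s(1) by blast
      then show False using s_inj[of "s y" y] s(1) less.prems ne by blast
    qed
  qed
  have sub: "{y, p y} \<in> M" if "y \<in> Y" for y using s(2)[OF that] s_id[OF that] by simp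
  show "M = (\<lambda>y. {y, p y}) ` Y"
  proof
    show "(\<lambda>y. {y, p y}) ` Y \<subseteq> M" using sub by auto
    show "M \<subseteq> (\<lambda>y. {y, p y}) ` Y"
    proof
      fix e assume e: "e \<in> M"
      then have "e \<in> E" using ME by blast
      then obtain v where v: "v \<in> e" "v \<in> V" by (elim edge_doubleton) blast
      from v(2) obtain y where "y \<in> Y" "v \<in> {y, p y}" by (cases rule: V_cases) auto
      then show "e \<in> (\<lambda>y. {y, p y}) ` Y" using dis[OF e sub v(1)] by blast
    qed
  qed
qed

text \<open>If \<open>x\<close> and \<open>y\<close> are below each other, they can exchange their
  partners \<open>p x\<close> and \<open>p y\<close>, which gives a second perfect matching.\<close>

lemma unique_matching_imp_antisymmetric:
  assumes uniq: "\<exists>!M. perfect_matching V E M" shows "antisymmetric"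
  unfolding antisymmetric_def
proof (intro allI impI, rule ccontr)
  fix x y assume xy: "below x y" "below y x" "x \<noteq> y"
  have Yxy: "x \<in> Y" "y \<in> Y" using xy by (auto simp: below_def)
  let ?t = "transpose x y"
  have "bij_betw ?t Y Y" using Yxy by (simp add: bij_betw_transpose_iff)
  then have "bij_betw (p \<circ> ?t) Y (V - Y)" using p bij_betw_trans by blast
  moreover have "{z, (p \<circ> ?t) z} \<in> E" if "z \<in> Y" for z
    using xy that p_edge[OF that] by (auto simp: below_def transpose_def insert_commute)
  ultimately have "perfect_matching V E ((\<lambda>z. {z, (p \<circ> ?t) z}) ` Y)" by (rule matching_of_bij)
  moreover have "perfect_matching V E ((\<lambda>z. {z, p z}) ` Y)" using matching_of_bij p p_edge by blast
  ultimately have "(\<lambda>z. {z, (p \<circ> ?t) z}) ` Y = (\<lambda>z. {z, p z}) ` Y" using uniq by blast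
  moreover have "{x, (p \<circ> ?t) x} \<in> (\<lambda>z. {z, (p \<circ> ?t) z}) ` Y" using Yxy(1) by (rule imageI)
  ultimately have "{x, p y} \<in> (\<lambda>z. {z, p z}) ` Y" by simp
  then obtain z where z: "z \<in> Y" "{x, p y} = {z, p z}" by blast
  then have "x = z" using Yxy p_V(2)[OF z(1)] by (auto simp: doubleton_eq_iff)
  then have "p y = p x" using z by (auto simp: doubleton_eq_iff)
  then show False using p_inj Yxy xy by blast
qed

text \<open>Facets are ordered by the number of their vertices outside \<open>Y\<close>. Given
  \<open>F\<close> and an earlier \<open>H\<close>, take a minimal \<open>a\<close> with
  \<open>p a\<close> in \<open>F - H\<close> and exchange \<open>p a\<close> for \<open>a\<close>.
  The result is independent: a neighbour of \<open>a\<close> in \<open>F\<close> other than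
  \<open>p a\<close> would be \<open>p b\<close> with \<open>b\<close> strictly below
  \<open>a\<close>; by minimality \<open>p b\<close> would lie in \<open>H\<close>, together with
  its neighbour \<open>a\<close>.\<close>

lemma antisymmetric_imp_shellable:
  assumes anti: "antisymmetric" shows "shellable_complex \<Delta>"
  unfolding shellable_complex_def
proof (intro conjI)
  show "pure_complex \<Delta>" by (simp add: pure_complex_def face_dim_def facet_card)
  have "finite {F. facet \<Delta> F}" using finite_complex by (auto simp: facet_def intro: finite_subset[of _ \<Delta>])
  then obtain Gs where Gs: "set Gs = {F. facet \<Delta> F}" "distinct Gs" using finite_distinct_list by blast
  define k where "k = (\<lambda>F. card (F - Y))"
  define Fs where "Fs = sort_key k Gs"
  have Fs: "set Fs = {F. facet \<Delta> F}" "distinct Fs" "sorted (map k Fs)" using Gs by (auto simp: Fs_def)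
  have "\<exists>v\<in>Fs ! i - Fs ! j. \<exists>l<i. Fs ! i - Fs ! l = {v}" if ij: "i < length Fs" "j < i" for i j
  proof -
    define F H where "F = Fs ! i" and "H = Fs ! j"
    have F: "facet \<Delta> F" and H: "facet \<Delta> H" using Fs(1) ij nth_mem[of i Fs] nth_mem[of j Fs] by (auto simp: F_def H_def)
    have ne: "F \<noteq> H" using Fs(2) ij by (auto simp: F_def H_def nth_eq_iff_index_eq)
    have kle: "k H \<le> k F" using sorted_nth_mono[OF Fs(3), of j i] ij by (simp add: F_def H_def)
    note Fi = facet_indep[OF F] and Hi = facet_indep[OF H]
    have finF: "finite F" "finite H" using indep_finite Fi Hi by auto
    define D where "D = {y \<in> Y. p y \<in> F \<and> p y \<notin> H}"
    \<comment> \<open>Otherwise \<open>F - Y\<close> would lie in \<open>H - Y\<close>, which is not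
      larger because \<open>H\<close> comes earlier; equal parts outside \<open>Y\<close> would give
      \<open>F = H\<close>.\<close>
    have "D \<noteq> {}"
    proof
      assume "D = {}"
      have "F - Y \<subseteq> H - Y"
      proof
        fix v assume v: "v \<in> F - Y"
        then have "v \<in> V - Y" using indep_V[OF Fi] by blast
        then obtain y where "y \<in> Y" "v = p y" by (rule p_surj)
        then show "v \<in> H - Y" using v \<open>D = {}\<close> by (auto simp: D_def)
      qed
      then have "F - Y = H - Y" using kle finF by (intro card_seteq) (auto simp: k_def)
      then show False using facet_eqI F H ne by blast
    qed
    then obtain a0 where "a0 \<in> D" by blast
    then have "\<exists>a. a \<in> D \<and> (\<forall>b. b \<in> D \<longrightarrow> card {z. below z a} \<le> card {z. below z b})"
      by (rule ex_has_least_nat)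
    then obtain a where a: "a \<in> D" and min: "\<And>b. b \<in> D \<Longrightarrow> card {z. below z a} \<le> card {z. below z b}"
      by blast
    have aY: "a \<in> Y" "p a \<in> F" "p a \<notin> H" "a \<notin> F" "a \<in> H"
      using a facet_exactly_one[OF F, of a] facet_exactly_one[OF H, of a] by (auto simp: D_def)
    have nadj: "{z, a} \<notin> E" if z: "z \<in> F - {p a}" for z
    proof
      assume e: "{z, a} \<in> E"
      have "z \<in> V" using z indep_V[OF Fi] by blast
      then show False
      proof (cases rule: V_cases)
        case 1
        then show ?thesis using e aY indepD[OF Y_indep] by blast
      next
        case (2 b)
        then have b: "below b a" "b \<noteq> a" using e aY z by (auto simp: below_def)
        then have "card {z. below z b} < card {z. below z a}" by (rule below_downset_less[OF anti])
        then have "b \<notin> D" using min[of b] by auto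
        then have "z \<in> H" using 2 z by (auto simp: D_def)
        then show ?thesis using e aY indepD[OF Hi] by blast
      qed
    qed
    define F' where "F' = insert a (F - {p a})"
    have "F' \<in> \<Delta>"
    proof (rule indepI)
      show "F' \<subseteq> V" using indep_V[OF Fi] aY Y_V by (auto simp: F'_def)
      show "{u, v} \<notin> E" if "u \<in> F'" "v \<in> F'" for u v
        using that nadj[of u] nadj[of v] indepD[OF Fi, of u v] adj_neq[of u v] by (auto simp: F'_def insert_commute)
    qed
    moreover have "card F' = card F"
    proof -
      have "card F' = Suc (card (F - {p a}))"
        unfolding F'_def using aY(4) finF(1) by (intro card_insert_disjoint) auto
      also have "\<dots> = card F" by (rule card_Suc_Diff1[OF finF(1) aY(2)])
      finally show ?thesis .
    qed
    ultimately have F': "facet \<Delta> F'" using facet_iff_card F by simp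
    have "F' - Y = F - Y - {p a}" using aY(1) by (auto simp: F'_def)
    moreover have "p a \<in> F - Y" using aY(2) p_V(2)[OF aY(1)] by blast
    moreover have "finite (F - Y)" using finF(1) by simp
    ultimately have kF': "k F' < k F" unfolding k_def by (metis card_Diff1_less)
    obtain l where l: "l < length Fs" "Fs ! l = F'" using F' Fs(1) in_set_conv_nth[of F' Fs] by auto
    have "l < i"
    proof (rule ccontr)
      assume "\<not> l < i"
      then have "k F \<le> k F'" using sorted_nth_mono[OF Fs(3), of i l] l ij by (simp add: F_def)
      then show False using kF' by simp
    qed
    moreover have "F - F' = {p a}" using aY p_V by (auto simp: F'_def)
    ultimately show ?thesis using l aY by (auto simp: F_def H_def)
  qed
  then show "\<exists>Fs. distinct Fs \<and> set Fs = {F. facet \<Delta> F} \<and>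
      (\<forall>i<length Fs. \<forall>j<i. \<exists>v\<in>Fs ! i - Fs ! j. \<exists>k<i. Fs ! i - Fs ! k = {v})"
    using Fs by (intro exI[of _ Fs]) blast
qed

lemma complex_dim: "complex_dim \<Delta> = int n - 1"
  unfolding complex_dim_def
proof (rule Max_eqI)
  show "finite (face_dim ` \<Delta>)" using finite_complex by simp
  show "int n - 1 \<in> face_dim ` \<Delta>" using Y_indep card_Y by (force simp: face_dim_def)
  fix d assume "d \<in> face_dim ` \<Delta>"
  then obtain F where F: "F \<in> \<Delta>" "d = face_dim F" by blast
  obtain H where "facet \<Delta> H" "F \<subseteq> H" using facet_extends[OF F(1)] .
  then have "card F \<le> n" using card_mono[of H F] facet_card indep_finite[OF facet_indep] by metis
  then show "d \<le> int n - 1" using F by (simp add: face_dim_def)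
qed

definition step :: "'a set \<Rightarrow> 'a set \<Rightarrow> bool" where
  "step F H \<longleftrightarrow> facet \<Delta> F \<and> facet \<Delta> H \<and> Suc (card (F \<inter> H)) = n"

lemma step_sym: "step F H \<Longrightarrow> step H F"
  by (simp add: step_def Int_commute)

lemma step_path:
  assumes "step\<^sup>*\<^sup>* F H" "facet \<Delta> F"
  shows "\<exists>m Fs. (\<forall>i\<le>m. facet \<Delta> (Fs i)) \<and> Fs 0 = F \<and> Fs m = H \<and>
    (\<forall>i<(m::nat). face_dim (Fs i \<inter> Fs (Suc i)) = complex_dim \<Delta> - 1)"
  using assms
proof (induction rule: rtranclp_induct)
  case base
  then show ?case by (intro exI[of _ 0] exI[of _ "\<lambda>_. F"]) auto
next
  case (step G H)
  then obtain m Fs where Fs: "\<forall>i\<le>m. facet \<Delta> (Fs i)" "Fs 0 = F" "Fs m = G"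
    "\<forall>i<m. face_dim (Fs i \<inter> Fs (Suc i)) = complex_dim \<Delta> - 1" by blast
  have d: "face_dim (G \<inter> H) = complex_dim \<Delta> - 1" "facet \<Delta> H"
    using step.hyps(2) by (auto simp: step_def face_dim_def complex_dim)
  show ?case
  proof (intro exI[of _ "Suc m"] exI[of _ "Fs(Suc m := H)"] conjI allI impI)
    fix i assume "i < Suc m"
    then show "face_dim ((Fs(Suc m := H)) i \<inter> (Fs(Suc m := H)) (Suc i)) = complex_dim \<Delta> - 1"
      using Fs d by (cases "i = m") auto
  qed (use Fs d in \<open>auto simp: le_Suc_eq\<close>)
qed

text \<open>Every facet but the first shares all but one vertex with an earlier one, so all of them
  are joined to the first.\<close>

lemma shellable_imp_strongly_connected:
  assumes sh: "shellable_complex \<Delta>" shows "strongly_connected_complex \<Delta>"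
  unfolding strongly_connected_complex_def
proof (intro conjI allI impI)
  show "pure_complex \<Delta>" using sh by (simp add: shellable_complex_def)
  fix F H assume FH: "facet \<Delta> F" "facet \<Delta> H"
  obtain Fs where Fs: "set Fs = {F. facet \<Delta> F}"
    "\<forall>i<length Fs. \<forall>j<i. \<exists>v\<in>Fs ! i - Fs ! j. \<exists>k<i. Fs ! i - Fs ! k = {v}"
    using sh by (auto simp: shellable_complex_def)
  have fc: "facet \<Delta> (Fs ! i)" if "i < length Fs" for i using Fs(1) that nth_mem by blast
  have reach: "step\<^sup>*\<^sup>* (Fs ! i) (Fs ! 0)" if "i < length Fs" for i
    using that
  proof (induction i rule: less_induct)
    case (less i)
    show ?case
    proof (cases "i = 0")
      case False
      then obtain v k where k: "k < i" "Fs ! i - Fs ! k = {v}" using Fs(2) less.prems by blast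
      have fin: "finite (Fs ! i)" using fc[OF less.prems] facet_indep indep_finite by blast
      have "card (Fs ! i) = card (Fs ! i \<inter> Fs ! k) + card (Fs ! i - Fs ! k)"
        using fin by (rule card_Int_Diff)
      then have "step (Fs ! i) (Fs ! k)"
        unfolding step_def using k less.prems fc[of i] fc[of k] facet_card[OF fc[of i]] by simp
      moreover have "step\<^sup>*\<^sup>* (Fs ! k) (Fs ! 0)" using less k by auto
      ultimately show ?thesis by (rule converse_rtranclp_into_rtranclp)
    qed simp
  qed
  obtain i j where ij: "i < length Fs" "F = Fs ! i" "j < length Fs" "H = Fs ! j"
    using FH Fs(1) by (metis in_set_conv_nth mem_Collect_eq)
  have "step\<^sup>*\<^sup>* (Fs ! 0) (Fs ! j)" using reach[OF ij(3)]
  proof (induction rule: rtranclp_induct)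
    case (step y z)
    then show ?case using step_sym by (meson converse_rtranclp_into_rtranclp)
  qed simp
  then have "step\<^sup>*\<^sup>* F H" using reach[OF ij(1)] ij by auto
  then show "\<exists>m Fs. (\<forall>i\<le>m. facet \<Delta> (Fs i)) \<and> Fs 0 = F \<and> Fs m = H \<and>
      (\<forall>i<m. face_dim (Fs i \<inter> Fs (Suc i)) = complex_dim \<Delta> - 1)"
    using step_path FH by blast
qed

text \<open>The facets fall into two classes, through \<open>x\<close> and \<open>y\<close> or
  through \<open>p x\<close> and \<open>p y\<close>, because \<open>p x\<close> is adjacent to
  \<open>y\<close> and \<open>p y\<close> to \<open>x\<close>.\<close>

lemma facet_dichotomy:
  assumes xy: "below x y" "below y x" and F: "facet \<Delta> F"
  shows "x \<in> F \<longleftrightarrow> y \<in> F"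
proof -
  have e: "{p x, y} \<in> E" "{p y, x} \<in> E" "x \<in> Y" "y \<in> Y" using xy by (auto simp: below_def)
  then show ?thesis
    using facet_exactly_one[OF F e(3)] facet_exactly_one[OF F e(4)] indepD[OF facet_indep[OF F]] by blast
qed

text \<open>A path from \<open>Y\<close> to a facet through \<open>p x\<close> must leave the class
  of facets through \<open>x\<close> and \<open>y\<close> at some step and loses both vertices there
  at once, but a step exchanges a single vertex.\<close>

lemma strongly_connected_imp_antisymmetric:
  assumes sc: "strongly_connected_complex \<Delta>" shows "antisymmetric"
  unfolding antisymmetric_def
proof (intro allI impI, rule ccontr)
  fix x y assume xy: "below x y" "below y x" "x \<noteq> y"
  have Yxy: "x \<in> Y" "y \<in> Y" using xy by (auto simp: below_def)
  have "{p x} \<in> \<Delta>" using p_V Yxy adj_neq[of "p x" "p x"] by (intro indepI) auto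
  then obtain H where H: "facet \<Delta> H" "p x \<in> H" by (rule facet_extends) auto
  obtain m Fs where Fs: "\<forall>i\<le>m. facet \<Delta> (Fs i)" "Fs 0 = Y" "Fs m = H"
    "\<forall>i<(m::nat). face_dim (Fs i \<inter> Fs (Suc i)) = complex_dim \<Delta> - 1"
    using sc Y H(1) unfolding strongly_connected_complex_def by blast
  have "x \<in> Fs i" if "i \<le> m" for i
    using that
  proof (induction i)
    case (Suc i)
    then have f: "facet \<Delta> (Fs i)" "facet \<Delta> (Fs (Suc i))" "x \<in> Fs i" using Fs by auto
    show ?case
    proof (rule ccontr)
      assume "x \<notin> Fs (Suc i)"
      then have "y \<notin> Fs (Suc i)" "y \<in> Fs i" using facet_dichotomy[OF xy(1,2)] f by blast+
      then have "Fs i \<inter> Fs (Suc i) \<subseteq> Fs i - {x, y}" using \<open>x \<notin> Fs (Suc i)\<close> by blast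
      moreover have fin: "finite (Fs i)" using f facet_indep indep_finite by blast
      ultimately have "card (Fs i \<inter> Fs (Suc i)) \<le> card (Fs i - {x, y})" by (intro card_mono) auto
      also have "\<dots> = n - 2" using fin f \<open>y \<in> Fs i\<close> xy facet_card by (subst card_Diff_subset) auto
      finally have "card (Fs i \<inter> Fs (Suc i)) \<le> n - 2" .
      \<comment> \<open>Excludes truncation in \<open>n - 2\<close>.\<close>
      moreover have "card {x, y} \<le> n" using card_mono[OF finY, of "{x, y}"] Yxy card_Y by simp
      then have "2 \<le> n" using xy by simp
      ultimately have "face_dim (Fs i \<inter> Fs (Suc i)) < complex_dim \<Delta> - 1"
        by (simp add: face_dim_def complex_dim)
      moreover have "face_dim (Fs i \<inter> Fs (Suc i)) = complex_dim \<Delta> - 1" using Fs Suc.prems by simp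
      ultimately show False by simp
    qed
  qed (use Fs Yxy in simp)
  then have "x \<in> H" using Fs by blast
  then show False using H facet_exactly_one[OF H(1) Yxy(1)] by blast
qed

end

section \<open>Translation to the ring records\<close>

definition maximal_ideal :: "'v set \<Rightarrow> ('v, 'k::field) mpoly set \<Rightarrow> bool" where
  "maximal_ideal V M \<longleftrightarrow> polys.is_ideal V M \<and> M \<noteq> polys V \<and>
     (\<forall>J. polys.is_ideal V J \<longrightarrow> M \<subseteq> J \<longrightarrow> J = M \<or> J = polys V)"

text \<open>Properness of the generated ideal is not part of this definition;
  \<open>regular_sequence_iff\<close> obtains it from a maximal ideal that contains \<open>I\<close>
  and \<open>zs\<close>.\<close>

definition regular_mod :: "'v set \<Rightarrow> ('v, 'k::field) mpoly set \<Rightarrow> ('v, 'k) mpoly list \<Rightarrow> bool" where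
  "regular_mod V I zs \<longleftrightarrow> set zs \<subseteq> polys V \<and> (\<forall>i<length zs.
     polys.nonzerodivisor_on V (foldl (polys.add_principal V) I (take i zs)) (zs ! i))"

lemma mpoly_ring_simps:
  "carrier (mpoly_ring TYPE('k::field) V) = polys V"
  "monoid.mult (mpoly_ring TYPE('k::field) V) = (*)"
  "ring.add (mpoly_ring TYPE('k::field) V) = (+)"
  "monoid.one (mpoly_ring TYPE('k::field) V) = 1"
  "ring.zero (mpoly_ring TYPE('k::field) V) = 0"
  by (auto simp: mpoly_ring_def ring_of_type_algebra_def polys_def fun_eq_iff)

lemma cring_mpoly_ring:
  fixes V :: "'v set" shows "cring (mpoly_ring TYPE('k::field) V)"
proof (rule cringI)
  show "abelian_group (mpoly_ring TYPE('k) V)"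
  proof (rule abelian_groupI; simp only: mpoly_ring_simps)
    show "\<exists>y\<in>polys V. y + x = 0" if "x \<in> polys V" for x :: "('v, 'k) mpoly"
      using that by (intro bexI[of _ "- x"]) auto
  qed (simp_all add: algebra_simps)
  show "comm_monoid (mpoly_ring TYPE('k) V)"
    by (rule comm_monoidI; simp only: mpoly_ring_simps) (simp_all add: algebra_simps)
qed (simp_all only: mpoly_ring_simps distrib_right)

lemma ring_mpoly_ring: "ring (mpoly_ring TYPE('k::field) V)"
  using cring_mpoly_ring cring.axioms(1) by blast

lemma a_inv_mpoly_ring:
  fixes x :: "('v, 'k::field) mpoly"
  assumes "x \<in> polys V" shows "a_inv (mpoly_ring TYPE('k) V) x = - x"
proof -
  interpret cring "mpoly_ring TYPE('k) V" by (rule cring_mpoly_ring)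
  show ?thesis using assms by (intro minus_equality) (simp_all add: mpoly_ring_simps)
qed

lemma ideal_mpoly_ring_iff:
  fixes J :: "('v, 'k::field) mpoly set"
  shows "ideal J (mpoly_ring TYPE('k) V) \<longleftrightarrow> polys.is_ideal V J"
proof
  assume J: "ideal J (mpoly_ring TYPE('k) V)"
  interpret ideal J "mpoly_ring TYPE('k) V" by (rule J)
  show "polys.is_ideal V J" unfolding polys.is_ideal_def
    using a_subset additive_subgroup.zero_closed[OF ideal.axioms(1)[OF J]]
      additive_subgroup.a_closed[OF ideal.axioms(1)[OF J]] I_l_closed by (simp add: mpoly_ring_simps)
next
  assume J: "polys.is_ideal V J"
  show "ideal J (mpoly_ring TYPE('k) V)"
  proof (rule idealI[OF ring_mpoly_ring])
    show "subgroup J (add_monoid (mpoly_ring TYPE('k) V))"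
    proof (rule subgroup.intro)
      show "J \<subseteq> carrier (add_monoid (mpoly_ring TYPE('k) V))"
        using J polys.ideal_sub by (auto simp: mpoly_ring_simps)
      show "x \<otimes>\<^bsub>add_monoid (mpoly_ring TYPE('k) V)\<^esub> y \<in> J" if "x \<in> J" "y \<in> J" for x y
        using polys.ideal_add[OF J that] by (simp add: mpoly_ring_simps)
      show "\<one>\<^bsub>add_monoid (mpoly_ring TYPE('k) V)\<^esub> \<in> J"
        using polys.ideal_zero[OF J] by (simp add: mpoly_ring_simps)
      show "inv\<^bsub>add_monoid (mpoly_ring TYPE('k) V)\<^esub> x \<in> J" if "x \<in> J" for x
        using polys.ideal_uminus[OF J that] a_inv_mpoly_ring[OF polys.ideal_sub[OF J that]]
        by (simp add: a_inv_def)
    qed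
  qed (simp_all add: mpoly_ring_simps polys.ideal_mult[OF J] polys.ideal_mult_right[OF J])
qed

lemma primeideal_mpoly_ring_iff:
  fixes J :: "('v, 'k::field) mpoly set"
  shows "primeideal J (mpoly_ring TYPE('k) V) \<longleftrightarrow> polys.is_prime V J"
proof
  assume J: "primeideal J (mpoly_ring TYPE('k) V)"
  interpret primeideal J "mpoly_ring TYPE('k) V" by (rule J)
  have "polys.is_ideal V J" using is_ideal ideal_mpoly_ring_iff by blast
  moreover have "1 \<notin> J" using one_imp_carrier I_notcarr by (auto simp: mpoly_ring_simps)
  ultimately show "polys.is_prime V J" unfolding polys.is_prime_def using I_prime by (simp add: mpoly_ring_simps)
next
  assume J: "polys.is_prime V J"
  show "primeideal J (mpoly_ring TYPE('k) V)"
  proof (rule primeidealI[OF _ cring_mpoly_ring])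
    show "ideal J (mpoly_ring TYPE('k) V)" using J polys.prime_ideal ideal_mpoly_ring_iff by blast
    show "carrier (mpoly_ring TYPE('k) V) \<noteq> J"
      using J polys.one_mem[of V] unfolding mpoly_ring_simps polys.is_prime_def by metis
  qed (use J in \<open>simp_all add: mpoly_ring_simps polys.is_prime_def\<close>)
qed

section \<open>Height, depth and the Cohen-Macaulay property of a quotient in terms of the
  polynomial ring\<close>

locale poly_quotient =
  fixes V :: "'v set" and I :: "('v, 'k::field) mpoly set"
  assumes finV: "finite V" and I_ideal: "polys.is_ideal V I"
begin

abbreviation R where "R \<equiv> mpoly_ring TYPE('k) V"

abbreviation RI where "RI \<equiv> R Quot I"

definition rc :: "('v, 'k) mpoly \<Rightarrow> ('v, 'k) mpoly set" where
  "rc a = I +>\<^bsub>R\<^esub> a"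

sublocale ring_R: cring R by (rule cring_mpoly_ring)

sublocale ideal_I: ideal I R using I_ideal ideal_mpoly_ring_iff by blast

sublocale ring_RI: cring RI by (rule ideal_I.quotient_is_cring[OF cring_mpoly_ring])

lemma rc_hom: "rc \<in> ring_hom R RI"
  using ideal_I.rcos_ring_hom unfolding rc_def[abs_def] by simp

lemma rc_image: "rc ` J = (+>\<^bsub>R\<^esub>) I ` J"
  by (auto simp: rc_def)

lemma carrier_RI: "carrier RI = rc ` polys V"
  unfolding FactRing_def A_RCOSETS_def' by (auto simp: rc_def mpoly_ring_simps)

lemma rc_mult: "a \<in> polys V \<Longrightarrow> b \<in> polys V \<Longrightarrow> rc a \<otimes>\<^bsub>RI\<^esub> rc b = rc (a * b)"
  using ring_hom_mult[OF rc_hom, of a b] by (simp add: mpoly_ring_simps)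

lemma rc_eq_iff: assumes "a \<in> polys V" "b \<in> polys V" shows "rc a = rc b \<longleftrightarrow> a - b \<in> I"
proof -
  have "a \<ominus>\<^bsub>R\<^esub> b = a - b"
    using assms by (simp add: a_minus_def a_inv_mpoly_ring mpoly_ring_simps)
  then show ?thesis
    using ring_R.quotient_eq_iff_same_a_r_cos[OF ideal_I.is_ideal, of a b] assms
    by (simp add: rc_def mpoly_ring_simps)
qed

lemma rc_mem_iff:
  assumes J: "polys.is_ideal V J" "I \<subseteq> J" and a: "a \<in> polys V"
  shows "rc a \<in> rc ` J \<longleftrightarrow> a \<in> J"
proof
  assume "rc a \<in> rc ` J"
  then obtain b where b: "b \<in> J" "rc a = rc b" by blast
  then have "a - b \<in> J" using rc_eq_iff[OF a polys.ideal_sub[OF J(1)]] J(2) by blast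
  then show "a \<in> J" using polys.ideal_diff_iff[OF J(1)] b by blast
qed blast

lemma rc_image_inj:
  assumes "polys.is_ideal V J" "I \<subseteq> J" "polys.is_ideal V J'" "I \<subseteq> J'"
  shows "rc ` J \<subseteq> rc ` J' \<longleftrightarrow> J \<subseteq> J'"
  using rc_mem_iff[OF assms(3,4)] polys.ideal_sub[OF assms(1)] by (auto simp: image_subset_iff)

lemma ideal_RI: "polys.is_ideal V J \<Longrightarrow> ideal (rc ` J) RI"
  unfolding rc_image by (rule ring_R.ring_ideal_imp_quot_ideal[OF ideal_I.is_ideal])
    (simp add: ideal_mpoly_ring_iff)

lemma ideal_RI_cases:
  assumes "ideal \<J> RI" obtains J where "polys.is_ideal V J" "I \<subseteq> J" "\<J> = rc ` J"
proof -
  have "\<J> \<in> (\<lambda>J. (+>\<^bsub>R\<^esub>) I ` J) ` {J. ideal J R \<and> I \<subseteq> J}"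
    using ring_R.quot_ideal_correspondence[OF ideal_I.is_ideal] assms by (auto simp: bij_betw_def)
  then show ?thesis using that unfolding rc_image[symmetric] ideal_mpoly_ring_iff by blast
qed

lemma primeideal_RI_iff:
  assumes J: "polys.is_ideal V J" "I \<subseteq> J" shows "primeideal (rc ` J) RI \<longleftrightarrow> polys.is_prime V J"
proof
  assume P: "primeideal (rc ` J) RI"
  interpret P: primeideal "rc ` J" RI by (rule P)
  show "polys.is_prime V J" unfolding polys.is_prime_def
  proof (intro conjI ballI impI J(1))
    show "1 \<notin> J"
    proof
      assume "1 \<in> J"
      then have "J = polys V" using polys.ideal_mult_right[OF J(1), of _ 1] polys.ideal_sub[OF J(1)] by auto
      then show False using P.I_notcarr by (simp add: carrier_RI)
    qed
    fix a b assume ab: "a \<in> polys V" "b \<in> polys V" "a * b \<in> J"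
    then have "rc a \<otimes>\<^bsub>RI\<^esub> rc b \<in> rc ` J" using rc_mult by auto
    then have "rc a \<in> rc ` J \<or> rc b \<in> rc ` J" using ab by (intro P.I_prime) (auto simp: carrier_RI)
    then show "a \<in> J \<or> b \<in> J" using rc_mem_iff[OF J] ab by blast
  qed
next
  assume P: "polys.is_prime V J"
  show "primeideal (rc ` J) RI"
  proof (rule primeidealI[OF ideal_RI[OF J(1)] ring_RI.is_cring])
    show "carrier RI \<noteq> rc ` J"
    proof
      assume "carrier RI = rc ` J"
      then have "rc 1 \<in> rc ` J" unfolding carrier_RI by (metis imageI polys.one_mem)
      then show False using rc_mem_iff[OF J] P by (simp add: polys.is_prime_def)
    qed
    fix \<alpha> \<beta> assume "\<alpha> \<in> carrier RI" "\<beta> \<in> carrier RI" and m: "\<alpha> \<otimes>\<^bsub>RI\<^esub> \<beta> \<in> rc ` J"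
    then obtain a b where ab: "a \<in> polys V" "b \<in> polys V" "\<alpha> = rc a" "\<beta> = rc b" by (auto simp: carrier_RI)
    then have "a * b \<in> J" using m rc_mult[OF ab(1,2)] rc_mem_iff[OF J, of "a * b"] by simp
    then show "\<alpha> \<in> rc ` J \<or> \<beta> \<in> rc ` J" using P ab by (auto simp: polys.is_prime_def)
  qed
qed

lemma maximalideal_RI_iff:
  assumes J: "polys.is_ideal V J" "I \<subseteq> J" shows "maximalideal (rc ` J) RI \<longleftrightarrow> maximal_ideal V J"
proof -
  have eq: "rc ` J = rc ` J' \<longleftrightarrow> J = J'" if "polys.is_ideal V J'" "I \<subseteq> J'" for J'
    using rc_image_inj[OF J that] rc_image_inj[OF that J] by blast
  have S: "polys.is_ideal V (polys V :: ('v, 'k) mpoly set)" "I \<subseteq> polys V"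
    using polys.ideal_sub[OF I_ideal] by (auto simp: polys.is_ideal_def)
  show ?thesis
  proof
    assume M: "maximalideal (rc ` J) RI"
    interpret M: maximalideal "rc ` J" RI by (rule M)
    show "maximal_ideal V J" unfolding maximal_ideal_def
    proof (intro conjI allI impI J(1))
      show "J \<noteq> polys V" using M.I_notcarr by (auto simp: carrier_RI)
      fix J' assume J': "polys.is_ideal V J'" "J \<subseteq> J'"
      then have "rc ` J' = rc ` J \<or> rc ` J' = carrier RI"
        using ideal_RI polys.ideal_sub[OF J'(1)] by (intro M.I_maximal) (auto simp: carrier_RI)
      moreover have "I \<subseteq> J'" using J J' by blast
      ultimately show "J' = J \<or> J' = polys V"
        using eq[OF J'(1) \<open>I \<subseteq> J'\<close>] rc_image_inj[OF S J'(1) \<open>I \<subseteq> J'\<close>] polys.ideal_sub[OF J'(1)]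
        unfolding carrier_RI by (metis order_refl subsetI subset_antisym)
    qed
  next
    assume M: "maximal_ideal V J"
    show "maximalideal (rc ` J) RI"
    proof (rule maximalidealI[OF ideal_RI[OF J(1)]])
      show "carrier RI \<noteq> rc ` J" using M eq[OF S] by (auto simp: carrier_RI maximal_ideal_def)
      fix \<J> assume "ideal \<J> RI" and sub: "rc ` J \<subseteq> \<J>"
      then obtain J' where J': "polys.is_ideal V J'" "I \<subseteq> J'" "\<J> = rc ` J'" by (elim ideal_RI_cases)
      then have "J \<subseteq> J'" using sub rc_image_inj[OF J J'(1,2)] by blast
      then have "J' = J \<or> J' = polys V" using M J' unfolding maximal_ideal_def by blast
      then show "\<J> = rc ` J \<or> \<J> = carrier RI" using J' carrier_RI by blast
    qed
  qed
qed

text \<open>The generators are added to \<open>I\<close> one at a time so that the ideals of the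
  prefixes of a regular sequence appear directly; the four claims characterize the result as a
  generated ideal.\<close>

lemma foldl_add_principal:
  assumes "set zs \<subseteq> polys V"
  shows "polys.is_ideal V (foldl (polys.add_principal V) I zs)" "I \<subseteq> foldl (polys.add_principal V) I zs"
    "set zs \<subseteq> foldl (polys.add_principal V) I zs"
    "\<And>J. polys.is_ideal V J \<Longrightarrow> I \<subseteq> J \<Longrightarrow> set zs \<subseteq> J \<Longrightarrow> foldl (polys.add_principal V) I zs \<subseteq> J"
  using assms
proof (induction zs rule: rev_induct)
  case Nil
  {
    case 1 then show ?case using I_ideal by simp
  next
    case 2 then show ?case by simp
  next
    case 3 then show ?case by simp
  next
    case 4 then show ?case by simp
  }
next
  case (snoc z zs)
  {
    case 1 then show ?case using snoc.IH(1) by (simp add: polys.add_principal_ideal)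
  next
    case 2
    then have "I \<subseteq> foldl (polys.add_principal V) I zs" using snoc.IH(2) by simp
    also have "\<dots> \<subseteq> polys.add_principal V (foldl (polys.add_principal V) I zs) z"
      by (rule polys.add_principal_sub)
    finally show ?case by simp
  next
    case 3
    then have F: "polys.is_ideal V (foldl (polys.add_principal V) I zs)" "set zs \<subseteq> foldl (polys.add_principal V) I zs"
      using snoc.IH(1,3) by auto
    note F(2)
    also have "foldl (polys.add_principal V) I zs \<subseteq> polys.add_principal V (foldl (polys.add_principal V) I zs) z"
      by (rule polys.add_principal_sub)
    finally show ?case using polys.add_principal_self[OF F(1), of z] by simp
  next
    case (4 J)
    then show ?case using snoc.IH(4)[of J] by (simp add: polys.add_principal_least)
  }
qed

lemma Idl_rc:
  assumes zs: "set zs \<subseteq> polys V"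
  shows "Idl\<^bsub>RI\<^esub> (rc ` set zs) = rc ` foldl (polys.add_principal V) I zs"
proof
  let ?F = "foldl (polys.add_principal V) I zs"
  note F = foldl_add_principal[OF zs]
  show "Idl\<^bsub>RI\<^esub> (rc ` set zs) \<subseteq> rc ` ?F"
    using F by (intro ring_RI.genideal_minimal ideal_RI) auto
  have sub: "rc ` set zs \<subseteq> carrier RI" using zs carrier_RI by auto
  obtain J where J: "polys.is_ideal V J" "I \<subseteq> J" "Idl\<^bsub>RI\<^esub> (rc ` set zs) = rc ` J"
    using ideal_RI_cases[OF ring_RI.genideal_ideal[OF sub]] .
  have "set zs \<subseteq> J"
  proof
    fix z assume z: "z \<in> set zs"
    then have "rc z \<in> rc ` J" using ring_RI.genideal_self[OF sub] unfolding J(3) by blast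
    then show "z \<in> J" using rc_mem_iff[OF J(1,2)] z zs by blast
  qed
  then have "?F \<subseteq> J" using F(4) J by blast
  then show "rc ` ?F \<subseteq> Idl\<^bsub>RI\<^esub> (rc ` set zs)" using J by auto
qed

lemma regular_sequence_iff:
  assumes zs: "set zs \<subseteq> M" and M: "maximal_ideal V M" "I \<subseteq> M"
  shows "regular_sequence RI (map rc zs) \<longleftrightarrow> regular_mod V I zs"
proof -
  have Mi: "polys.is_ideal V M" using M by (simp add: maximal_ideal_def)
  have zsS: "set zs \<subseteq> polys V" using zs polys.ideal_sub[OF Mi] by blast
  have take: "set (take i zs) \<subseteq> polys V" for i using zsS set_take_subset by fast
  let ?F = "\<lambda>i. foldl (polys.add_principal V) I (take i zs)"
  have Idl: "Idl\<^bsub>RI\<^esub> (set (take i (map rc zs))) = rc ` ?F i" for i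
    using Idl_rc[OF take] by (simp add: take_map)
  have nzd: "(\<forall>a\<in>carrier RI. map rc zs ! i \<otimes>\<^bsub>RI\<^esub> a \<in> Idl\<^bsub>RI\<^esub> (set (take i (map rc zs))) \<longrightarrow>
        a \<in> Idl\<^bsub>RI\<^esub> (set (take i (map rc zs)))) \<longleftrightarrow> polys.nonzerodivisor_on V (?F i) (zs ! i)"
    if i: "i < length zs" for i
  proof -
    have zi: "zs ! i \<in> polys V" using zsS i nth_mem by blast
    show ?thesis
      unfolding Idl carrier_RI polys.nonzerodivisor_on_def
      using rc_mem_iff[OF foldl_add_principal(1,2)[OF take]] zi i rc_mult by auto
  qed
  have "Idl\<^bsub>RI\<^esub> (set (map rc zs)) \<noteq> carrier RI"
  proof
    assume "Idl\<^bsub>RI\<^esub> (set (map rc zs)) = carrier RI"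
    then have "rc ` foldl (polys.add_principal V) I zs = rc ` polys V" using Idl_rc[OF zsS] carrier_RI by simp
    then have "rc 1 \<in> rc ` foldl (polys.add_principal V) I zs" by (metis imageI polys.one_mem)
    then have "1 \<in> foldl (polys.add_principal V) I zs"
      using rc_mem_iff[OF foldl_add_principal(1,2)[OF zsS]] by simp
    then have "1 \<in> M" using foldl_add_principal(4)[OF zsS Mi M(2) zs] by blast
    then have "polys V \<subseteq> M" using polys.ideal_mult_right[OF Mi, of _ 1] by auto
    then show False using M polys.ideal_sub[OF Mi] by (auto simp: maximal_ideal_def)
  qed
  moreover have "set (map rc zs) \<subseteq> carrier RI" using zsS carrier_RI by auto
  ultimately show ?thesis using zsS nzd unfolding regular_sequence_def regular_mod_def by auto
qed

lemma maximal_prime: assumes M: "maximal_ideal V M" "I \<subseteq> M" shows "polys.is_prime V M"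
proof -
  have "polys.is_ideal V M" using M by (simp add: maximal_ideal_def)
  moreover have "maximalideal (rc ` M) RI" using maximalideal_RI_iff calculation M by blast
  then have "primeideal (rc ` M) RI" by (rule ring_RI.maximalideal_prime)
  ultimately show ?thesis using primeideal_RI_iff M by blast
qed

lemma localized:
  assumes "polys.is_prime V M" shows "localized_subring (polys V) M"
  by unfold_locales (use assms polys_acc[OF finV] in blast)+

lemma prime_chain_end:
  assumes ch: "polys.prime_chain V J M d" and M: "polys.is_prime V M" "J \<subseteq> M"
  shows "\<exists>Q :: nat \<Rightarrow> ('v, 'k) mpoly set. (\<forall>i\<le>d. polys.is_prime V (Q i)) \<and> (\<forall>i<d. Q i \<subset> Q (Suc i)) \<and> J \<subseteq> Q 0 \<and> Q d = M"
proof -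
  obtain Q :: "nat \<Rightarrow> ('v, 'k) mpoly set" where Q: "\<forall>i\<le>d. polys.is_prime V (Q i)" "\<forall>i<d. Q i \<subset> Q (Suc i)" "J \<subseteq> Q 0" "Q d \<subseteq> M"
    using ch by (auto simp: polys.prime_chain_def)
  show ?thesis
  proof (intro exI[of _ "Q(d := M)"] conjI allI impI)
    fix i assume "i < d"
    then have "Q i \<subset> Q (Suc i)" using Q by blast
    then show "(Q(d := M)) i \<subset> (Q(d := M)) (Suc i)" using Q \<open>i < d\<close> by (cases "Suc i = d") auto
  qed (use Q M in auto)
qed

lemma prime_height_RI:
  assumes M: "polys.is_prime V M" "I \<subseteq> M"
  shows "prime_height RI (rc ` M) = Sup {enat d |d. polys.prime_chain V I M d}"
proof -
  have Mi: "polys.is_ideal V M" using M polys.prime_ideal by blast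
  have "(\<exists>Q :: nat \<Rightarrow> ('v, 'k) mpoly set set. (\<forall>i\<le>d. primeideal (Q i) RI) \<and> (\<forall>i<d. Q i \<subset> Q (Suc i)) \<and> Q d = rc ` M)
      \<longleftrightarrow> polys.prime_chain V I M d" for d
  proof
    assume "\<exists>Q :: nat \<Rightarrow> ('v, 'k) mpoly set set. (\<forall>i\<le>d. primeideal (Q i) RI) \<and> (\<forall>i<d. Q i \<subset> Q (Suc i)) \<and> Q d = rc ` M"
    then obtain Q :: "nat \<Rightarrow> ('v, 'k) mpoly set set" where Q: "\<And>i. i \<le> d \<Longrightarrow> primeideal (Q i) RI" "\<And>i. i < d \<Longrightarrow> Q i \<subset> Q (Suc i)" "Q d = rc ` M" by blast
    have "\<exists>J. polys.is_ideal V J \<and> I \<subseteq> J \<and> Q i = rc ` J" if "i \<le> d" for i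
      using ideal_RI_cases[OF primeideal.axioms(1)[OF Q(1)[OF that]]] by metis
    then obtain P where P: "\<And>i. i \<le> d \<Longrightarrow> polys.is_ideal V (P i) \<and> I \<subseteq> P i \<and> Q i = rc ` P i" by metis
    have "polys.is_prime V (P i)" if "i \<le> d" for i
      using primeideal_RI_iff[of "P i"] P[OF that] Q(1)[OF that] by simp
    moreover have "P i \<subset> P (Suc i)" if "i < d" for i
      using Q(2)[OF that] P[of i] P[of "Suc i"] that rc_image_inj[of "P i" "P (Suc i)"] by auto
    moreover have "P d \<subseteq> M" using Q(3) P[of d] rc_image_inj[OF _ _ Mi M(2), of "P d"] by auto
    ultimately show "polys.prime_chain V I M d" unfolding polys.prime_chain_def using P[of 0] by blast
  next
    assume "polys.prime_chain V I M d"
    from prime_chain_end[OF this M] obtain Q :: "nat \<Rightarrow> ('v, 'k) mpoly set"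
      where Q: "\<And>i. i \<le> d \<Longrightarrow> polys.is_prime V (Q i)" "\<And>i. i < d \<Longrightarrow> Q i \<subset> Q (Suc i)" "I \<subseteq> Q 0" "Q d = M" by blast
    have inc: "I \<subseteq> Q i" if "i \<le> d" for i
      using that
    proof (induction i)
      case (Suc i)
      then show ?case using Q(2)[of i] by auto
    qed (use Q in simp)
    have Qi: "polys.is_ideal V (Q i)" if "i \<le> d" for i using Q(1)[OF that] polys.prime_ideal by blast
    show "\<exists>Q :: nat \<Rightarrow> ('v, 'k) mpoly set set. (\<forall>i\<le>d. primeideal (Q i) RI) \<and> (\<forall>i<d. Q i \<subset> Q (Suc i)) \<and> Q d = rc ` M"
    proof (intro exI[of _ "\<lambda>i. rc ` Q i"] conjI allI impI)
      show "primeideal (rc ` Q i) RI" if "i \<le> d" for i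
        using primeideal_RI_iff[OF Qi[OF that] inc[OF that]] Q(1)[OF that] by simp
      show "rc ` Q i \<subset> rc ` Q (Suc i)" if "i < d" for i
        using Q(2)[OF that] rc_image_inj[of "Q i" "Q (Suc i)"] rc_image_inj[of "Q (Suc i)" "Q i"] Qi inc that by auto
    qed (use Q in simp)
  qed
  then show ?thesis unfolding prime_height_def by simp
qed

text \<open>The image of \<open>M\<close> is maximal, so it is the only prime over itself and the
  infimum is its own height.\<close>

lemma ideal_height_RI:
  assumes M: "maximal_ideal V M" "I \<subseteq> M"
  shows "ideal_height RI (rc ` M) = Sup {enat d |d. polys.prime_chain V I M d}"
proof -
  have Mi: "polys.is_ideal V M" using M by (simp add: maximal_ideal_def)
  have P: "polys.is_prime V M" by (rule maximal_prime[OF M])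
  have "P = rc ` M" if "primeideal P RI" "rc ` M \<subseteq> P" for P
  proof -
    interpret P: primeideal P RI by (rule that)
    interpret M: maximalideal "rc ` M" RI using maximalideal_RI_iff[OF Mi M(2)] M by blast
    show ?thesis using M.I_maximal[OF P.is_ideal that(2) P.a_subset] P.I_notcarr by blast
  qed
  moreover have "primeideal (rc ` M) RI" using primeideal_RI_iff[OF Mi M(2)] P by blast
  ultimately have "{prime_height RI P |P. primeideal P RI \<and> rc ` M \<subseteq> P} = {prime_height RI (rc ` M)}" by blast
  then show ?thesis unfolding ideal_height_def using prime_height_RI[OF P M(2)] by simp
qed

lemma ideal_depth_RI:
  assumes M: "maximal_ideal V M" "I \<subseteq> M"
  shows "ideal_depth RI (rc ` M) = Sup {enat (length zs) |zs. regular_mod V I zs \<and> set zs \<subseteq> M}"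
proof -
  have "{enat (length xs) |xs. regular_sequence RI xs \<and> set xs \<subseteq> rc ` M}
      = {enat (length zs) |zs. regular_mod V I zs \<and> set zs \<subseteq> M}" (is "?A = ?B")
  proof
    show "?B \<subseteq> ?A"
    proof
      fix x assume "x \<in> ?B"
      then obtain zs where "x = enat (length zs)" "regular_mod V I zs" "set zs \<subseteq> M" by blast
      then show "x \<in> ?A" using regular_sequence_iff[OF _ M, of zs]
        by (intro CollectI exI[of _ "map rc zs"]) auto
    qed
    show "?A \<subseteq> ?B"
    proof
      fix x assume "x \<in> ?A"
      then obtain xs where xs: "x = enat (length xs)" "regular_sequence RI xs" "set xs \<subseteq> rc ` M" by blast
      then have "xs \<in> lists (rc ` M)" by (auto simp: lists_eq_set)
      then have "xs \<in> map rc ` lists M" by (simp add: lists_image)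
      then obtain zs where "xs = map rc zs" "set zs \<subseteq> M" by (auto simp: lists_eq_set)
      then show "x \<in> ?B" using xs regular_sequence_iff[OF _ M, of zs] by auto
    qed
  qed
  then show ?thesis unfolding ideal_depth_def by simp
qed

lemma cohen_macaulay_iff:
  "cohen_macaulay_ring RI \<longleftrightarrow> (\<forall>M. maximal_ideal V M \<longrightarrow> I \<subseteq> M \<longrightarrow>
     Sup {enat (length zs) |zs. regular_mod V I zs \<and> set zs \<subseteq> M} = Sup {enat d |d. polys.prime_chain V I M d})"
proof -
  have noeth: "noetherian_ring RI"
  proof (rule ring_RI.noetherian_ringI)
    fix \<J> assume "ideal \<J> RI"
    then obtain J where J: "polys.is_ideal V J" "I \<subseteq> J" "\<J> = rc ` J" by (rule ideal_RI_cases)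
    obtain G where G: "finite G" "G \<subseteq> J" "\<And>J'. polys.is_ideal V J' \<Longrightarrow> G \<subseteq> J' \<Longrightarrow> J \<subseteq> J'"
      using hilbert_basis[OF finV J(1)] by blast
    obtain zs where zs: "set zs = G" using finite_list[OF G(1)] by blast
    have zsS: "set zs \<subseteq> polys V" using zs G(2) polys.ideal_sub[OF J(1)] by blast
    have "foldl (polys.add_principal V) I zs = J"
    proof
      show "foldl (polys.add_principal V) I zs \<subseteq> J"
        by (rule foldl_add_principal(4)[OF zsS J(1,2)]) (simp add: zs G(2))
      show "J \<subseteq> foldl (polys.add_principal V) I zs"
        by (rule G(3)[OF foldl_add_principal(1)[OF zsS]]) (use foldl_add_principal(3)[OF zsS] zs in simp)
    qed
    then have eq: "\<J> = Idl\<^bsub>RI\<^esub> (rc ` set zs)" using Idl_rc[OF zsS] J by simp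
    show "\<exists>A\<subseteq>carrier RI. finite A \<and> \<J> = Idl\<^bsub>RI\<^esub> A"
    proof (intro exI conjI)
      show "rc ` set zs \<subseteq> carrier RI" unfolding carrier_RI by (rule image_mono[OF zsS])
    qed (use eq in auto)
  qed
  show ?thesis
  proof
    assume CM: "cohen_macaulay_ring RI"
    show "\<forall>M. maximal_ideal V M \<longrightarrow> I \<subseteq> M \<longrightarrow>
      Sup {enat (length zs) |zs. regular_mod V I zs \<and> set zs \<subseteq> M} = Sup {enat d |d. polys.prime_chain V I M d}"
    proof (intro allI impI)
      fix M assume M: "maximal_ideal V M" "I \<subseteq> M"
      then have "maximalideal (rc ` M) RI" using maximalideal_RI_iff[of M] by (simp add: maximal_ideal_def)
      then have "ideal_depth RI (rc ` M) = ideal_height RI (rc ` M)"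
        using CM by (simp add: cohen_macaulay_ring_def)
      then show "Sup {enat (length zs) |zs. regular_mod V I zs \<and> set zs \<subseteq> M} = Sup {enat d |d. polys.prime_chain V I M d}"
        using ideal_depth_RI[OF M] ideal_height_RI[OF M] by simp
    qed
  next
    assume eq: "\<forall>M. maximal_ideal V M \<longrightarrow> I \<subseteq> M \<longrightarrow>
      Sup {enat (length zs) |zs. regular_mod V I zs \<and> set zs \<subseteq> M} = Sup {enat d |d. polys.prime_chain V I M d}"
    show "cohen_macaulay_ring RI" unfolding cohen_macaulay_ring_def
    proof (intro conjI allI impI ring_RI.is_cring noeth)
      fix \<M> assume m: "maximalideal \<M> RI"
      obtain M where M: "polys.is_ideal V M" "I \<subseteq> M" "\<M> = rc ` M"
        by (rule ideal_RI_cases[OF maximalideal.axioms(1)[OF m]])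
      have mm: "maximal_ideal V M" by (rule iffD1[OF maximalideal_RI_iff[OF M(1,2)] m[unfolded M(3)]])
      show "ideal_depth RI \<M> = ideal_height RI \<M>"
        unfolding M(3) ideal_depth_RI[OF mm M(2)] ideal_height_RI[OF mm M(2)]
        by (rule eq[rule_format, OF mm M(2)])
    qed
  qed
qed

text \<open>An upper bound for the heights and the existence of regular sequences of that length suffice,
  since every regular sequence in a prime gives a chain of primes of the same length.\<close>

lemma cohen_macaulayI:
  assumes len: "\<And>M d. maximal_ideal V M \<Longrightarrow> I \<subseteq> M \<Longrightarrow> polys.prime_chain V I M d \<Longrightarrow> d \<le> n"
    and reg: "\<And>M. maximal_ideal V M \<Longrightarrow> I \<subseteq> M \<Longrightarrow> \<exists>zs. regular_mod V I zs \<and> set zs \<subseteq> M \<and> length zs = n"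
  shows "cohen_macaulay_ring RI"
  unfolding cohen_macaulay_iff
proof (intro allI impI)
  fix M assume M: "maximal_ideal V M" "I \<subseteq> M"
  have P: "polys.is_prime V M" by (rule maximal_prime[OF M])
  interpret L: localized_subring "polys V" M by (rule localized[OF P])
  have chain: "polys.prime_chain V I M (length zs)" if zs: "regular_mod V I zs" "set zs \<subseteq> M" for zs
  proof -
    have "L.loc_regular (L.loc I) zs"
      using zs by (intro L.loc_regular_of_regular[OF I_ideal]) (auto simp: regular_mod_def)
    moreover have "1 \<notin> L.loc I"
    proof
      assume "1 \<in> L.loc I"
      then obtain s where "s \<in> polys V - M" "s * 1 \<in> I" by (elim L.locE)
      then show False using M by auto
    qed
    \<comment> \<open>The bound for annihilators is applied to the element 1, whose annihilator
      modulo \<open>L.loc I\<close> contains \<open>I\<close>.\<close>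
    ultimately have "polys.prime_chain V {r \<in> polys V. r * 1 \<in> L.loc I} M (length zs)"
      using zs L.loc_saturated[OF I_ideal] by (intro L.chain_of_annihilator) auto
    moreover have "I \<subseteq> {r \<in> polys V. r * 1 \<in> L.loc I}"
      using L.loc_sub[OF I_ideal] polys.ideal_sub[OF I_ideal] by auto
    ultimately show ?thesis by (rule polys.prime_chain_mono)
  qed
  obtain zs where zs: "regular_mod V I zs" "set zs \<subseteq> M" "length zs = n" using reg[OF M] by blast
  have "Sup {enat (length zs) |zs. regular_mod V I zs \<and> set zs \<subseteq> M} = enat n"
  proof (rule antisym)
    show "Sup {enat (length zs) |zs. regular_mod V I zs \<and> set zs \<subseteq> M} \<le> enat n"
      using len[OF M chain] by (intro Sup_least) auto
    show "enat n \<le> Sup {enat (length zs) |zs. regular_mod V I zs \<and> set zs \<subseteq> M}"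
      using zs by (intro Sup_upper) auto
  qed
  moreover have "Sup {enat d |d. polys.prime_chain V I M d} = enat n"
  proof (rule antisym)
    show "Sup {enat d |d. polys.prime_chain V I M d} \<le> enat n"
      using len[OF M] by (intro Sup_least) auto
    show "enat n \<le> Sup {enat d |d. polys.prime_chain V I M d}"
      using chain[OF zs(1,2)] zs(3) by (intro Sup_upper) auto
  qed
  ultimately show "Sup {enat (length zs) |zs. regular_mod V I zs \<and> set zs \<subseteq> M} = Sup {enat d |d. polys.prime_chain V I M d}"
    by simp
qed

text \<open>Depth and height are suprema in \<open>enat\<close>. If all regular sequences in
  \<open>M\<close> were shorter than \<open>d\<close>, their supremum would be at most
  \<open>d - 1\<close>; this leaves only \<open>d = 0\<close>, where the empty sequence
  serves.\<close>

lemma cohen_macaulay_regular_sequence: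
  assumes CM: "cohen_macaulay_ring RI" and M: "maximal_ideal V M" "I \<subseteq> M"
    and ch: "polys.prime_chain V I M d"
  obtains zs where "regular_mod V I zs" "set zs \<subseteq> M" "d \<le> length zs"
proof (rule ccontr)
  assume no: "\<not> thesis"
  let ?D = "Sup {enat (length zs) |zs. regular_mod V I zs \<and> set zs \<subseteq> M}"
    and ?H = "Sup {enat d |d. polys.prime_chain V I M d}"
  have 1: "?D \<le> enat (d - 1)"
  proof (rule Sup_least)
    fix x assume "x \<in> {enat (length zs) |zs. regular_mod V I zs \<and> set zs \<subseteq> M}"
    then obtain zs where zs: "x = enat (length zs)" "regular_mod V I zs" "set zs \<subseteq> M" by blast
    then have "\<not> d \<le> length zs" using that no by blast
    then show "x \<le> enat (d - 1)" using zs by simp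
  qed
  have 2: "enat d \<le> ?H" using ch by (intro Sup_upper) auto
  have 3: "?D = ?H" by (rule CM[unfolded cohen_macaulay_iff, rule_format, OF M])
  have "enat d \<le> enat (d - 1)" by (rule order_trans[OF 2 1[unfolded 3]])
  then have "d = 0" by simp
  have thesis by (rule that[of "[]"]) (simp_all add: regular_mod_def \<open>d = 0\<close>)
  then show False using no by contradiction
qed

end

section \<open>The edge ideal\<close>

lemma mpoly_var_indet: "mpoly_var TYPE('k::field) v = indet v"
  by (simp add: mpoly_var_def indet_def monomial_def)

lemma indet_mult: "indet u * indet v = monomial (Poly_Mapping.single u 1 + Poly_Mapping.single v 1)"
  by (simp add: indet_def monomial_add)

text \<open>This is the ideal of polynomials with zero constant term. An ideal that contains it and
  one more polynomial also contains the constant term of that polynomial, which is a unit.\<close>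

lemma var_prime_empty_maximal:
  "maximal_ideal V (var_prime V {} :: ('v, 'k::field) mpoly set)"
  unfolding maximal_ideal_def
proof (intro conjI allI impI var_prime_ideal)
  have "(1 :: ('v, 'k) mpoly) \<notin> var_prime V {}" by (simp add: var_prime_def)
  then show "(var_prime V {} :: ('v, 'k) mpoly set) \<noteq> polys V" using polys.one_mem by metis
  fix J :: "('v, 'k) mpoly set" assume J: "polys.is_ideal V J" "var_prime V {} \<subseteq> J"
  show "J = var_prime V {} \<or> J = polys V"
  proof (cases "J \<subseteq> var_prime V {}")
    case False
    then obtain f where f: "f \<in> J" "f \<notin> var_prime V {}" by blast
    have fV: "f \<in> polys V" using polys.ideal_sub[OF J(1) f(1)] .
    let ?c = "Poly_Mapping.lookup f 0"
    obtain m where "m \<in> Poly_Mapping.keys f" "Poly_Mapping.keys m \<subseteq> {}" using f fV by (auto simp: var_prime_def)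
    then have c: "?c \<noteq> 0" by (simp add: in_keys_iff)
    have "m \<noteq> 0" if "m \<in> Poly_Mapping.keys (f - Const ?c)" for m
      using that by (auto simp: in_keys_iff lookup_minus Const_def)
    then have "\<not> Poly_Mapping.keys m \<subseteq> {}" if "m \<in> Poly_Mapping.keys (f - Const ?c)" for m
      using that by auto
    then have "f - Const ?c \<in> var_prime V {}" using fV by (simp add: var_prime_def)
    then have "f - (f - Const ?c) \<in> J" using f J polys.ideal_diff[OF J(1)] by blast
    then have "Const ?c \<in> J" by simp
    then have "Const (inverse ?c) * Const ?c \<in> J" using polys.ideal_mult[OF J(1)] polys_Const by blast
    then have "1 \<in> J" using c by (simp flip: Const_mult)
    then have "f \<in> J" if "f \<in> polys V" for f using polys.ideal_mult_right[OF J(1) that] by fastforce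
    then show ?thesis using polys.ideal_sub[OF J(1)] by blast
  qed (use J in blast)
qed

text \<open>Moving the variables of \<open>F - W\<close> one by one into the ideal gives primes from
  \<open>var_prime V F\<close> up to \<open>var_prime V W\<close>, and at the end \<open>P\<close>
  takes the place of the last. Applied with \<open>F = Y\<close> for a chain over the edge ideal and
  with \<open>F = V\<close> for the height of \<open>P\<close>.\<close>

lemma var_prime_chain:
  fixes P :: "('v, 'k::field) mpoly set"
  assumes V: "finite V" and WF: "W \<subseteq> F" "F \<subseteq> V" and P: "polys.is_prime V P" "var_prime V W \<subseteq> P"
  shows "\<exists>Q :: nat \<Rightarrow> ('v, 'k) mpoly set. (\<forall>i\<le>card (F - W). polys.is_prime V (Q i)) \<and>
    (\<forall>i<card (F - W). Q i \<subset> Q (Suc i)) \<and> var_prime V F \<subseteq> Q 0 \<and> Q (card (F - W)) = P"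
proof -
  have "finite (F - W)" using V WF finite_subset by blast
  then obtain vs where vs: "set vs = F - W" "distinct vs" using finite_distinct_list by blast
  have len: "length vs = card (F - W)" using vs distinct_card by metis
  let ?G = "\<lambda>i. F - set (take i vs)"
  let ?Q = "\<lambda>i. if i = length vs then P else (var_prime V (?G i) :: ('v, 'k) mpoly set)"
  have G: "?G (Suc i) \<subset> ?G i" if "i < length vs" for i
  proof -
    have "vs ! i \<notin> set (take i vs)" using vs(2) that by (auto simp: in_set_conv_nth nth_eq_iff_index_eq)
    moreover have "vs ! i \<in> F" using vs(1) nth_mem[OF that] by blast
    ultimately show ?thesis using that by (auto simp: take_Suc_conv_app_nth)
  qed
  have last: "?G (length vs) = W" using vs WF by auto
  have sub: "(var_prime V (?G i) :: ('v, 'k) mpoly set) \<subset> var_prime V (?G (Suc i))" if "i < length vs" for i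
    using G[OF that] WF by (intro var_prime_psubset) auto
  show ?thesis unfolding len[symmetric]
  proof (intro exI[of _ ?Q] conjI allI impI)
    show "polys.is_prime V (?Q i)" for i using P by (simp add: var_prime_prime[OF V])
    show "?Q i \<subset> ?Q (Suc i)" if "i < length vs" for i
    proof (cases "Suc i = length vs")
      case True
      then show ?thesis using sub[OF that] P(2) last that by auto
    next
      case False
      then show ?thesis using sub[OF that] that by simp
    qed
    show "var_prime V F \<subseteq> ?Q 0" using P(2) last by (cases vs) auto
  qed simp
qed

context graph
begin

text \<open>The Stanley-Reisner ideal of \<open>\<Delta>\<close>, described by supports;
  \<open>edge_ideal_eq\<close> identifies it with the edge ideal.\<close>

definition nonface_ideal :: "('v, 'k::field) mpoly set" where
  "nonface_ideal = {f \<in> polys V. \<forall>m\<in>Poly_Mapping.keys f. Poly_Mapping.keys m \<notin> \<Delta>}"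

lemma nonface_ideal_ideal: "polys.is_ideal V (nonface_ideal :: ('v, 'k::field) mpoly set)"
  unfolding polys.is_ideal_def
proof (intro conjI ballI)
  fix a b :: "('v, 'k) mpoly" assume ab: "a \<in> nonface_ideal" "b \<in> nonface_ideal"
  then show "a + b \<in> nonface_ideal"
    using Poly_Mapping.keys_add[of a b] by (fastforce simp: nonface_ideal_def)
next
  fix s a :: "('v, 'k) mpoly" assume sa: "s \<in> polys V" "a \<in> nonface_ideal"
  have "Poly_Mapping.keys m \<notin> \<Delta>" if m: "m \<in> Poly_Mapping.keys (s * a)" for m
  proof -
    obtain x y where "m = x + y" "y \<in> Poly_Mapping.keys a" using m keys_mult[of s a] by blast
    then show ?thesis using sa(2) indep_subset[of "Poly_Mapping.keys m" "Poly_Mapping.keys y"]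
      by (auto simp: nonface_ideal_def keys_add_nat)
  qed
  then show "s * a \<in> nonface_ideal"
    using sa by (auto simp: nonface_ideal_def)
qed (auto simp: nonface_ideal_def)

lemma monomial_nonface: "Poly_Mapping.keys m \<subseteq> V \<Longrightarrow> Poly_Mapping.keys m \<notin> \<Delta> \<Longrightarrow> monomial m \<in> nonface_ideal"
  by (simp add: nonface_ideal_def polys_monomial_mem)

lemma edge_in_nonface_ideal: "{u, v} \<in> E \<Longrightarrow> indet u * indet v \<in> nonface_ideal"
  unfolding indet_mult using adj_V[of u v] indepD[of "{u, v}" u v]
  by (intro monomial_nonface) (auto simp: keys_add_nat insert_commute)

text \<open>A monomial whose support is not independent is divisible by the product of the two ends
  of an edge.\<close>

lemma edge_ideal_eq: "edge_ideal TYPE('k::field) V E = (nonface_ideal :: ('v, 'k) mpoly set)"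
proof -
  interpret R: cring "mpoly_ring TYPE('k) V" by (rule cring_mpoly_ring)
  let ?G = "{indet u * indet v |u v. {u, v} \<in> E} :: ('v, 'k) mpoly set"
  have eq: "edge_ideal TYPE('k) V E = Idl\<^bsub>mpoly_ring TYPE('k) V\<^esub> ?G"
    by (simp add: edge_ideal_def mpoly_var_indet mpoly_ring_simps)
  have sub: "?G \<subseteq> nonface_ideal" using edge_in_nonface_ideal by blast
  then have GS: "?G \<subseteq> carrier (mpoly_ring TYPE('k) V)"
    unfolding mpoly_ring_simps using polys.ideal_sub[OF nonface_ideal_ideal] by blast
  have J: "polys.is_ideal V (Idl\<^bsub>mpoly_ring TYPE('k) V\<^esub> ?G)"
    using R.genideal_ideal[OF GS] by (simp add: ideal_mpoly_ring_iff)
  show ?thesis unfolding eq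
  proof
    show "Idl\<^bsub>mpoly_ring TYPE('k) V\<^esub> ?G \<subseteq> nonface_ideal"
      using sub nonface_ideal_ideal by (intro R.genideal_minimal) (simp_all add: ideal_mpoly_ring_iff)
    show "nonface_ideal \<subseteq> Idl\<^bsub>mpoly_ring TYPE('k) V\<^esub> ?G"
    proof
      fix f :: "('v, 'k) mpoly" assume f: "f \<in> nonface_ideal"
      show "f \<in> Idl\<^bsub>mpoly_ring TYPE('k) V\<^esub> ?G"
      proof (rule polys_ideal_of_monomials[OF J])
        fix m assume m: "m \<in> Poly_Mapping.keys f"
        then have mV: "Poly_Mapping.keys m \<subseteq> V" "Poly_Mapping.keys m \<notin> \<Delta>"
          using f by (auto simp: nonface_ideal_def polys_def)
        then obtain u v where uv: "u \<in> Poly_Mapping.keys m" "v \<in> Poly_Mapping.keys m" "{u, v} \<in> E"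
          using indepI[OF mV(1)] by blast
        let ?m = "m - Poly_Mapping.single u 1"
        have "v \<in> Poly_Mapping.keys ?m"
          using uv adj_neq[OF uv(3)] by (simp add: in_keys_iff lookup_minus lookup_single)
        then have eqm: "monomial m = (indet u * indet v * monomial (?m - Poly_Mapping.single v 1) :: ('v, 'k) mpoly)"
          using indet_monomial[OF uv(1)] indet_monomial[of v ?m] by (metis mult.assoc)
        have gm: "indet u * indet v \<in> Idl\<^bsub>mpoly_ring TYPE('k) V\<^esub> ?G"
          using R.genideal_self[OF GS] uv(3) by blast
        have pm: "monomial (?m - Poly_Mapping.single v 1) \<in> (polys V :: ('v, 'k) mpoly set)"
          unfolding polys_monomial_mem
          using mV(1) keys_minus_nat[of m "Poly_Mapping.single u 1"] keys_minus_nat[of ?m "Poly_Mapping.single v 1"]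
          by blast
        show "monomial m \<in> Idl\<^bsub>mpoly_ring TYPE('k) V\<^esub> ?G"
          unfolding eqm by (rule polys.ideal_mult_right[OF J pm gm])
      qed
    qed
  qed
qed

lemma nonface_sub_var_prime: "F \<in> \<Delta> \<Longrightarrow> nonface_ideal \<subseteq> var_prime V F"
  using indep_subset by (auto simp: nonface_ideal_def var_prime_def)

lemma prime_avoids_indep:
  assumes P: "polys.is_prime V P" "nonface_ideal \<subseteq> P"
  shows "{v \<in> V. indet v \<notin> P} \<in> \<Delta>"
proof (rule indepI)
  fix u v assume uv: "u \<in> {v \<in> V. indet v \<notin> P}" "v \<in> {v \<in> V. indet v \<notin> P}"
  show "{u, v} \<notin> E"
  proof
    assume "{u, v} \<in> E"
    then have "indet u * indet v \<in> P" using edge_in_nonface_ideal P(2) by blast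
    then have "indet u \<in> P \<or> indet v \<in> P"
      using uv by (intro polys.prime_cases[OF P(1)]) (auto intro: polys_indet)
    then show False using uv by blast
  qed
qed blast

text \<open>The variables outside the bottom prime form an independent set, and
  \<open>chain_length_le\<close> bounds the length by their number. So chains over \<open>J\<close>
  are controlled by the independent sets none of whose variables lies in \<open>J\<close>.\<close>

lemma prime_chain_le_indep:
  assumes "polys.prime_chain V J M d" "nonface_ideal \<subseteq> J"
  obtains W where "W \<in> \<Delta>" "d \<le> card W" "\<And>v. v \<in> W \<Longrightarrow> indet v \<notin> J"
proof -
  from assms obtain Q where Q: "\<And>i. i \<le> d \<Longrightarrow> polys.is_prime V (Q i)" "\<And>i. i < d \<Longrightarrow> Q i \<subset> Q (Suc i)" "J \<subseteq> Q 0"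
    by (auto simp: polys.prime_chain_def)
  have "d \<le> card {v \<in> V. indet v \<notin> Q 0}"
    by (rule chain_length_le[where Q = Q, OF finV]) (use Q in auto)
  moreover have "{v \<in> V. indet v \<notin> Q 0} \<in> \<Delta>"
    using Q(1)[of 0] Q(3) assms(2) by (intro prime_avoids_indep) auto
  ultimately show ?thesis using that Q(3) by blast
qed

text \<open>A prime over the edge ideal contains all variables outside some independent set, hence
  at least \<open>card V - a\<close> of them, and adding these one at a time gives a chain of primes
  below it. For height \<open>n\<close> and \<open>2 * n\<close> vertices this bounds the size of a
  facet from below.\<close>

lemma ideal_height_ge:
  assumes F: "\<And>F. F \<in> \<Delta> \<Longrightarrow> card F \<le> a"
  shows "enat (card V - a) \<le> ideal_height (mpoly_ring TYPE('k::field) V) (edge_ideal TYPE('k) V E)"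
  unfolding ideal_height_def
proof (rule Inf_greatest)
  let ?R = "mpoly_ring TYPE('k) V"
  fix x assume "x \<in> {prime_height ?R P |P. primeideal P ?R \<and> edge_ideal TYPE('k) V E \<subseteq> P}"
  then obtain P where P: "x = prime_height ?R P" "polys.is_prime V P" "nonface_ideal \<subseteq> P"
    unfolding edge_ideal_eq primeideal_mpoly_ring_iff by blast
  let ?W = "{v \<in> V. indet v \<notin> P}"
  have "card ?W \<le> a" using F prime_avoids_indep[OF P(2,3)] by blast
  then have "card V - a \<le> card (V - ?W)" using finV by (subst card_Diff_subset) auto
  then have "enat (card V - a) \<le> enat (card (V - ?W))" by simp
  also have "\<dots> \<le> x" unfolding P(1) prime_height_def
  proof (rule Sup_upper, rule CollectI, intro exI[of _ "card (V - ?W)"] conjI refl)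
    have "var_prime V ?W \<subseteq> P" using polys.prime_ideal[OF P(2)] by (intro var_prime_least) auto
    from var_prime_chain[OF finV _ _ P(2) this, of V]
    show "\<exists>Q. (\<forall>i\<le>card (V - ?W). primeideal (Q i) ?R) \<and> (\<forall>i<card (V - ?W). Q i \<subset> Q (Suc i)) \<and> Q (card (V - ?W)) = P"
      unfolding primeideal_mpoly_ring_iff by blast
  qed
  finally show "enat (card V - a) \<le> x" .
qed

lemma nonface_quotient: "poly_quotient V nonface_ideal"
  using finV nonface_ideal_ideal by unfold_locales

lemma cohen_macaulay_graph_eq:
  "cohen_macaulay_graph TYPE('k::field) V E \<longleftrightarrow> cohen_macaulay_ring (mpoly_ring TYPE('k) V Quot nonface_ideal)"
  by (simp add: cohen_macaulay_graph_def edge_ideal_eq)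

end

context matched_graph
begin

lemma indep_card_le: "F \<in> \<Delta> \<Longrightarrow> card F \<le> n"
proof -
  assume F: "F \<in> \<Delta>"
  then obtain H where "facet \<Delta> H" "F \<subseteq> H" by (rule facet_extends)
  then show ?thesis using card_mono[of H F] facet_card indep_finite[OF facet_indep] by metis
qed

text \<open>The ideal of polynomials without constant term is at the top of a chain of length
  \<open>n\<close>, so it contains a regular sequence of length at least \<open>n\<close>, and
  \<open>chain_of_disconnection\<close> yields a chain of length at least \<open>n - 1\<close> over
  the two components. The variables outside its bottom prime form an independent set that avoids the
  four vertices of two matching edges, so the length is at most \<open>n - 2\<close>.\<close>

theorem cohen_macaulay_imp_antisymmetric:
  assumes CM: "cohen_macaulay_graph TYPE('k::field) V E"
  shows "antisymmetric"
  unfolding antisymmetric_def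
proof (intro allI impI, rule ccontr)
  fix x y assume xy: "below x y" "below y x" "x \<noteq> y"
  have Yxy: "x \<in> Y" "y \<in> Y" and e: "{p x, y} \<in> E" "{p y, x} \<in> E" using xy by (auto simp: below_def)
  define I where "I = (nonface_ideal :: ('a, 'k) mpoly set)"
  define M where "M = (var_prime V {} :: ('a, 'k) mpoly set)"
  note Ii = nonface_ideal_ideal[where 'k = 'k, folded I_def]
  have M: "maximal_ideal V M" unfolding M_def by (rule var_prime_empty_maximal)
  have MP: "polys.is_prime V M" unfolding M_def by (rule var_prime_prime[OF finV])
  have IM: "I \<subseteq> M" unfolding I_def M_def by (rule nonface_sub_var_prime) (rule indepI; simp)
  interpret pq: poly_quotient V I unfolding I_def by (rule nonface_quotient)
  interpret L: localized_subring "polys V" M by (rule pq.localized[OF MP])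
  have "\<exists>Q :: nat \<Rightarrow> ('a, 'k) mpoly set. (\<forall>i\<le>n. polys.is_prime V (Q i)) \<and> (\<forall>i<n. Q i \<subset> Q (Suc i)) \<and>
      var_prime V Y \<subseteq> Q 0 \<and> Q n = M"
    using var_prime_chain[OF finV _ Y_V MP, of "{}"] card_Y by (simp add: M_def)
  moreover have "I \<subseteq> var_prime V Y" unfolding I_def by (rule nonface_sub_var_prime[OF Y_indep])
  ultimately have "polys.prime_chain V I M n" unfolding polys.prime_chain_def by blast
  moreover have "cohen_macaulay_ring (mpoly_ring TYPE('k) V Quot I)"
    using CM cohen_macaulay_graph_eq[where 'k = 'k] by (simp add: I_def)
  ultimately obtain zs where zs: "regular_mod V I zs" "set zs \<subseteq> M" "n \<le> length zs"
    using pq.cohen_macaulay_regular_sequence[OF _ M IM] by blast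
  \<comment> \<open>The edge ideal plus the ideal generated by the variables in \<open>C\<close>,
    again described by supports.\<close>
  define D where "D = (\<lambda>C. {f \<in> polys V. \<forall>m\<in>Poly_Mapping.keys f. Poly_Mapping.keys m \<notin> \<Delta> \<or>
      Poly_Mapping.keys m \<inter> C \<noteq> {}} :: ('a, 'k) mpoly set)"
  have Di: "polys.is_ideal V (D C)" for C
    unfolding polys.is_ideal_def
  proof (intro conjI ballI)
    fix a b :: "('a, 'k) mpoly" assume ab: "a \<in> D C" "b \<in> D C"
    then show "a + b \<in> D C" using Poly_Mapping.keys_add[of a b] by (fastforce simp: D_def)
  next
    fix s a :: "('a, 'k) mpoly" assume sa: "s \<in> polys V" "a \<in> D C"
    have "Poly_Mapping.keys m \<notin> \<Delta> \<or> Poly_Mapping.keys m \<inter> C \<noteq> {}" if m: "m \<in> Poly_Mapping.keys (s * a)" for m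
    proof -
      obtain u w where "m = u + w" "w \<in> Poly_Mapping.keys a" using m keys_mult[of s a] by blast
      then show ?thesis using sa(2) indep_subset[of "Poly_Mapping.keys m" "Poly_Mapping.keys w"]
        by (auto simp: D_def keys_add_nat)
    qed
    then show "s * a \<in> D C" using sa by (auto simp: D_def)
  qed (auto simp: D_def)
  have ID: "I \<subseteq> D C" for C by (auto simp: I_def D_def nonface_ideal_def)
  let ?A = "L.loc (D {x, y})" and ?B = "L.loc (D {p x, p y})"
  \<comment> \<open>An independent set cannot meet both \<open>{x, y}\<close> and
    \<open>{p x, p y}\<close>: all four pairs are edges.\<close>
  have DD: "D {x, y} \<inter> D {p x, p y} \<subseteq> I"
  proof
    fix f assume f: "f \<in> D {x, y} \<inter> D {p x, p y}"
    have "Poly_Mapping.keys m \<notin> \<Delta>" if m: "m \<in> Poly_Mapping.keys f" for m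
    proof
      assume i: "Poly_Mapping.keys m \<in> \<Delta>"
      then have "x \<in> Poly_Mapping.keys m \<or> y \<in> Poly_Mapping.keys m" "p x \<in> Poly_Mapping.keys m \<or> p y \<in> Poly_Mapping.keys m"
        using f m by (auto simp: D_def)
      then show False using e p_edge[OF Yxy(1)] p_edge[OF Yxy(2)] indepD[OF i] by blast
    qed
    then show "f \<in> I" using f by (auto simp: I_def D_def nonface_ideal_def)
  qed
  have AB: "?A \<inter> ?B = L.loc I"
  proof
    show "L.loc I \<subseteq> ?A \<inter> ?B" using L.loc_mono[OF ID] by blast
    show "?A \<inter> ?B \<subseteq> L.loc I"
    proof
      fix r assume r: "r \<in> ?A \<inter> ?B"
      then obtain s where s: "s \<in> polys V - M" "r \<in> polys V" "s * r \<in> D {x, y}" by (auto elim: L.locE)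
      obtain t where t: "t \<in> polys V - M" "t * r \<in> D {p x, p y}" using r by (auto elim: L.locE)
      have "t * (s * r) \<in> D {x, y}" using polys.ideal_mult[OF Di _ s(3), of t] t(1) by blast
      moreover have "s * (t * r) \<in> D {p x, p y}" using polys.ideal_mult[OF Di _ t(2), of s] s(1) by blast
      moreover have "t * (s * r) = (s * t) * r" "s * (t * r) = (s * t) * r" by (simp_all add: mult_ac)
      ultimately have "(s * t) * r \<in> I" using DD by auto
      then show "r \<in> L.loc I" using L.nonM_mult[OF s(1) t(1)] s(2) by (intro L.locI)
    qed
  qed
  have varD: "(indet v :: ('a, 'k) mpoly) \<in> D C" if "v \<in> V" "v \<in> C" for v C
    using that polys_indet[OF that(1)] by (auto simp: D_def indet_def)
  \<comment> \<open>The prime of the face \<open>{v}\<close> contains the edge ideal, but neither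
    the variable \<open>v\<close> nor any element outside \<open>M\<close>, whose constant term is
    nonzero.\<close>
  have not_loc: "indet v \<notin> L.loc I" if v: "v \<in> V" for v
  proof
    assume "indet v \<in> L.loc I"
    then obtain s where s: "s \<in> polys V - M" "s * indet v \<in> I" by (elim L.locE)
    have "{v} \<in> \<Delta>" using v adj_neq[of v v] by (intro indepI) auto
    then have "s * indet v \<in> var_prime V {v}" using s(2) nonface_sub_var_prime unfolding I_def by blast
    then have "s \<in> var_prime V {v} \<or> (indet v :: ('a, 'k) mpoly) \<in> var_prime V {v}"
      by (rule polys.prime_cases[OF var_prime_prime[OF finV]]) (use s(1) polys_indet[OF v] in auto)
    moreover have "(indet v :: ('a, 'k) mpoly) \<notin> var_prime V {v}" by (simp add: indet_in_var_prime[OF v])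
    moreover have "s \<notin> var_prime V {v}" using s(1) by (auto simp: M_def var_prime_def intro!: bexI[of _ 0])
    ultimately show False by blast
  qed
  have V4: "x \<in> V" "y \<in> V" "p x \<in> V" "p y \<in> V" using Yxy Y_V p_V by auto
  have loc_D: "D C \<subseteq> L.loc (D C)" for C by (rule L.loc_sub[OF Di])
  have "?A \<noteq> L.loc I" using varD[OF V4(1)] not_loc[OF V4(1)] loc_D by blast
  moreover have "?B \<noteq> L.loc I" using varD[OF V4(3)] not_loc[OF V4(3)] loc_D by blast
  moreover have "L.loc_regular (L.loc I) zs"
    using zs by (intro L.loc_regular_of_regular[OF Ii]) (auto simp: regular_mod_def)
  ultimately have "polys.prime_chain V (?A \<union> ?B) M (length zs - 1)"
    using L.chain_of_disconnection[OF L.loc_saturated[OF Ii] L.loc_saturated[OF Di] L.loc_saturated[OF Di] AB] zs(2) by blast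
  moreover have "nonface_ideal \<subseteq> ?A \<union> ?B" using ID loc_D by (auto simp: I_def)
  ultimately obtain W where W: "W \<in> \<Delta>" "length zs - 1 \<le> card W" "\<And>v. v \<in> W \<Longrightarrow> indet v \<notin> ?A \<union> ?B"
    by (rule prime_chain_le_indep) (rule that, assumption+)
  have notW: "v \<notin> W" if "v \<in> V" "v \<in> {x, y} \<or> v \<in> {p x, p y}" for v
  proof -
    have "(indet v :: ('a, 'k) mpoly) \<in> ?A \<union> ?B"
      using that(2) subsetD[OF loc_D varD[OF that(1)]] by blast
    then show ?thesis using W(3)[of v] by blast
  qed
  have "x \<notin> W" "y \<notin> W" "p x \<notin> W" "p y \<notin> W"
    using notW[OF V4(1)] notW[OF V4(2)] notW[OF V4(3)] notW[OF V4(4)] by simp_all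
  then have "{v \<in> Y. v \<in> W \<or> p v \<in> W} \<subseteq> Y - {x, y}" by auto
  then have "card W \<le> card (Y - {x, y})"
    unfolding indep_transversal[OF W(1)] using finY by (intro card_mono) auto
  also have "\<dots> = n - 2" using Yxy xy(3) card_Y finY by (subst card_Diff_subset) auto
  finally have "length zs - 1 \<le> n - 2" using W(2) by simp
  moreover have "card {x, y} \<le> n" using card_mono[OF finY, of "{x, y}"] Yxy card_Y by simp
  then have "2 \<le> n" using xy(3) by simp
  ultimately show False using zs(3) by simp
qed

end

section \<open>Shellable graphs are Cohen--Macaulay\<close>

definition set_expo :: "'v set \<Rightarrow> 'v \<Rightarrow>\<^sub>0 nat" where
  "set_expo A = (\<Sum>v\<in>A. Poly_Mapping.single v 1)"

lemma lookup_set_expo: "finite A \<Longrightarrow> Poly_Mapping.lookup (set_expo A) v = (if v \<in> A then 1 else 0)"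
  by (simp add: set_expo_def lookup_sum lookup_single when_def)

lemma keys_set_expo: "finite A \<Longrightarrow> Poly_Mapping.keys (set_expo A) = A"
  by (auto simp: in_keys_iff lookup_set_expo split: if_splits)

lemma total_deg_sum_expo: "finite A \<Longrightarrow> total_deg (sum f A) = (\<Sum>i\<in>A. total_deg (f i))"
  by (induction A rule: finite_induct) (simp_all add: total_deg_add)

definition low_deg :: "nat \<Rightarrow> ('v, 'k::field) mpoly set" where
  "low_deg k = {f. \<forall>m\<in>Poly_Mapping.keys f. total_deg m < k}"

lemma low_deg_0: "0 \<in> low_deg k"
  by (simp add: low_deg_def)

lemma low_deg_add: "f \<in> low_deg k \<Longrightarrow> g \<in> low_deg k \<Longrightarrow> f + g \<in> low_deg k"
  using Poly_Mapping.keys_add[of f g] by (fastforce simp: low_deg_def)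

lemma low_deg_mult:
  assumes "\<And>m. m \<in> Poly_Mapping.keys f \<Longrightarrow> total_deg m \<le> k" "g \<in> low_deg l"
  shows "f * g \<in> low_deg (k + l)"
  unfolding low_deg_def
proof (intro CollectI ballI)
  fix m assume "m \<in> Poly_Mapping.keys (f * g)"
  then obtain x y where "m = x + y" "x \<in> Poly_Mapping.keys f" "y \<in> Poly_Mapping.keys g"
    using keys_mult[of f g] by blast
  then show "total_deg m < k + l"
    using assms(1)[of x] assms(2) by (auto simp: total_deg_add low_deg_def intro: add_le_less_mono)
qed

text \<open>\<open>f\<close> has the leading monomial \<open>m\<close> modulo the prime \<open>P\<close>.\<close>

definition leads :: "'v set \<Rightarrow> ('v, 'k::field) mpoly set \<Rightarrow> ('v \<Rightarrow>\<^sub>0 nat) \<Rightarrow> ('v, 'k) mpoly \<Rightarrow> bool" where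
  "leads V P m f \<longleftrightarrow> Poly_Mapping.keys m \<subseteq> V \<and>
     (\<exists>l\<in>polys V. l \<in> low_deg (total_deg m) \<and> f - (monomial m + l) \<in> P)"

lemma leads_mem:
  assumes P: "polys.is_ideal V P" and l: "leads V P m f" shows "f \<in> polys V"
proof -
  obtain l where l: "l \<in> polys V" "f - (monomial m + l) \<in> P" "Poly_Mapping.keys m \<subseteq> V"
    using l by (auto simp: leads_def)
  have "f - (monomial m + l) + (monomial m + l) \<in> polys V"
    using polys.ideal_sub[OF P l(2)] l by (intro polys.add_mem) (auto simp: polys_monomial_mem)
  then show ?thesis by simp
qed

lemma leads_mult:
  assumes P: "polys.is_ideal V P" and f: "leads V P m f" and g: "leads V P m' g"
  shows "leads V P (m + m') (f * g)"
proof -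
  obtain l where l: "l \<in> polys V" "l \<in> low_deg (total_deg m)" "f - (monomial m + l) \<in> P" "Poly_Mapping.keys m \<subseteq> V"
    using f by (auto simp: leads_def)
  obtain l' where l': "l' \<in> polys V" "l' \<in> low_deg (total_deg m')" "g - (monomial m' + l') \<in> P" "Poly_Mapping.keys m' \<subseteq> V"
    using g by (auto simp: leads_def)
  have mV: "monomial m + l \<in> polys V" using l by (intro polys.add_mem) (auto simp: polys_monomial_mem)
  have mm: "monomial m \<in> polys V" "monomial m' \<in> polys V" using l l' by (auto simp: polys_monomial_mem)
  define k where "k = monomial m * l' + (monomial m' * l + l * l')"
  have "k \<in> polys V" unfolding k_def by (intro polys.add_mem polys.mult_mem mm l(1) l'(1))
  moreover have "k \<in> low_deg (total_deg (m + m'))"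
    unfolding k_def total_deg_add
  proof (intro low_deg_add)
    show "monomial m * l' \<in> low_deg (total_deg m + total_deg m')"
      using l'(2) by (intro low_deg_mult) auto
    show "monomial m' * l \<in> low_deg (total_deg m + total_deg m')"
      using low_deg_mult[of "monomial m'" "total_deg m'" l "total_deg m"] l(2) by (simp add: add.commute)
    show "l * l' \<in> low_deg (total_deg m + total_deg m')"
      using l(2) l'(2) by (intro low_deg_mult) (auto simp: low_deg_def less_imp_le)
  qed
  moreover have "f * g - (monomial (m + m') + k) \<in> P"
  proof -
    have "f * g - (monomial (m + m') + k) = g * (f - (monomial m + l)) + (monomial m + l) * (g - (monomial m' + l'))"
      by (simp add: k_def monomial_add algebra_simps)
    also have "\<dots> \<in> P"
      using polys.ideal_mult[OF P leads_mem[OF P g] l(3)] polys.ideal_mult[OF P mV l'(3)]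
      by (rule polys.ideal_add[OF P])
    finally show ?thesis .
  qed
  ultimately show ?thesis using l(4) l'(4) by (auto simp: leads_def keys_add_nat)
qed

lemma leads_one: "polys.is_ideal V P \<Longrightarrow> leads V P 0 1"
  by (auto simp: leads_def low_deg_0 polys.ideal_zero intro!: bexI[of _ 0])

lemma leads_power:
  assumes P: "polys.is_ideal V P" and f: "leads V P (Poly_Mapping.single v j) f"
  shows "leads V P (Poly_Mapping.single v (j * k)) (f ^ k)"
proof (induction k)
  case (Suc k)
  have "Poly_Mapping.single v (j * Suc k) = Poly_Mapping.single v j + Poly_Mapping.single v (j * k)"
    by (simp flip: single_add)
  then show ?case using leads_mult[OF P f Suc] by simp
qed (simp add: leads_one[OF P])

lemma leads_prod:
  assumes "finite A" "polys.is_ideal V P" "\<And>i. i \<in> A \<Longrightarrow> leads V P (m i) (f i)"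
  shows "leads V P (sum m A) (prod f A)"
  using assms by (induction A rule: finite_induct) (simp_all add: leads_one leads_mult)

text \<open>This is for the leading monomial of \<open>h y\<close>, a monic polynomial in
  \<open>\<theta> y\<close>.\<close>

lemma leads_add_low:
  assumes P: "polys.is_ideal V P" and f: "leads V P m f"
    and g: "\<And>i. i \<in> A \<Longrightarrow> leads V P (m' i) (g i) \<and> total_deg (m' i) < total_deg m"
  shows "leads V P m (f + (\<Sum>i\<in>A. Const (c i) * g i))"
  using g
proof (induction A rule: infinite_finite_induct)
  case (insert i A)
  then obtain l where l: "l \<in> polys V" "l \<in> low_deg (total_deg m)" "f + (\<Sum>i\<in>A. Const (c i) * g i) - (monomial m + l) \<in> P"
    "Poly_Mapping.keys m \<subseteq> V"
    by (auto simp: leads_def)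
  obtain l' where l': "l' \<in> polys V" "l' \<in> low_deg (total_deg (m' i))" "g i - (monomial (m' i) + l') \<in> P"
    "Poly_Mapping.keys (m' i) \<subseteq> V" "total_deg (m' i) < total_deg m"
    using insert.prems[of i] by (auto simp: leads_def)
  have kc: "total_deg x \<le> 0" if "x \<in> Poly_Mapping.keys (Const (c i) :: ('a, 'b) mpoly)" for x
    using that keys_Const[of "c i"] by auto
  have low: "monomial (m' i) + l' \<in> low_deg (total_deg m)"
    using l'(2,5) by (intro low_deg_add) (auto simp: low_deg_def)
  have "l + Const (c i) * (monomial (m' i) + l') \<in> polys V"
    using l l' by (intro polys.add_mem polys.mult_mem) (auto simp: polys_monomial_mem)
  moreover have "l + Const (c i) * (monomial (m' i) + l') \<in> low_deg (total_deg m)"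
    using low_deg_add[OF l(2)] low_deg_mult[of "Const (c i)" 0, OF _ low] kc by simp
  moreover have "f + (\<Sum>i\<in>insert i A. Const (c i) * g i) - (monomial m + (l + Const (c i) * (monomial (m' i) + l'))) \<in> P"
  proof -
    have "f + (\<Sum>i\<in>insert i A. Const (c i) * g i) - (monomial m + (l + Const (c i) * (monomial (m' i) + l')))
        = (f + (\<Sum>i\<in>A. Const (c i) * g i) - (monomial m + l)) + Const (c i) * (g i - (monomial (m' i) + l'))"
      using insert.hyps by (simp add: algebra_simps)
    then show ?thesis using polys.ideal_add[OF P l(3) polys.ideal_mult[OF P polys_Const l'(3), of "c i"]] by metis
  qed
  ultimately show ?case using l(4) by (auto simp: leads_def)
qed (use f in auto)

lemma pv_span_mult_image:
  fixes r :: "('v, 'k::field) mpoly"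
  assumes "\<And>s. s \<in> A \<Longrightarrow> s * r \<in> pv.span B" "x \<in> pv.span A"
  shows "x * r \<in> pv.span B"
  using assms(2)
proof (induction rule: pv.span_induct_alt)
  case base
  then show ?case by (simp add: pv.span_zero)
next
  case (step c a y)
  then show ?case using pv.span_add[OF pv.span_scale[OF assms(1)[OF step(1)], of c] step(2)]
    by (simp add: distrib_right mult.assoc)
qed

text \<open>The coordinates of \<open>x\<close> with respect to \<open>C\<close> vanish outside
  \<open>A\<close> and outside \<open>B\<close>.\<close>

lemma pv_span_disjoint:
  fixes C :: "('v, 'k::field) mpoly set"
  assumes C: "pv.independent C" "A \<subseteq> C" "B \<subseteq> C" "A \<inter> B = {}" and x: "x \<in> pv.span A" "x \<in> pv.span B"
  shows "x = 0"
proof -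
  have "pv.representation C x = pv.representation A x" "pv.representation C x = pv.representation B x"
    using pv.representation_extend[OF C(1) x(1) C(2)] pv.representation_extend[OF C(1) x(2) C(3)] by auto
  then have "pv.representation A x v = 0" for v
    using pv.representation_ne_zero[of A x v] pv.representation_ne_zero[of B x v] C(4) by (metis IntI empty_iff)
  then show ?thesis
    using pv.sum_nonzero_representation_eq[OF pv.independent_mono[OF C(1,2)] x(1)] by simp
qed

section \<open>Spanning: a basis of the edge ring adapted to the polynomials
  \<open>h y\<close>\<close>

locale shelled_graph = matched_graph V E n Y p
  for V :: "'v set" and E n Y p +
  fixes Fs :: "'v set list" and d :: "'v \<Rightarrow> nat" and c :: "'v \<Rightarrow> nat \<Rightarrow> 'k::field"
  assumes Fs: "set Fs = {F. facet \<Delta> F}"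
    and shelling: "\<And>i j. i < length Fs \<Longrightarrow> j < i \<Longrightarrow> \<exists>v\<in>Fs ! i - Fs ! j. \<exists>k<i. Fs ! i - Fs ! k = {v}"
    and d_pos: "\<And>y. y \<in> Y \<Longrightarrow> 1 \<le> d y"
begin

abbreviation I :: "('v, 'k) mpoly set" where "I \<equiv> nonface_ideal"

definition \<theta> :: "'v \<Rightarrow> ('v, 'k) mpoly" where
  "\<theta> y = indet y + indet (p y)"

definition h :: "'v \<Rightarrow> ('v, 'k) mpoly" where
  "h y = \<theta> y ^ d y + (\<Sum>k<d y. Const (c y k) * \<theta> y ^ k)"

text \<open>Up to lower powers \<open>q y k\<close> is \<open>\<theta> y ^ k\<close>, so these
  elements form another basis of the polynomials in \<open>\<theta> y\<close>, one in which
  multiplication by \<open>h y\<close> shifts the index by \<open>d y\<close>.\<close>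

definition q :: "'v \<Rightarrow> nat \<Rightarrow> ('v, 'k) mpoly" where
  "q y k = h y ^ (k div d y) * \<theta> y ^ (k mod d y)"

text \<open>The restriction set known from shellings: the smallest face of \<open>Fs ! j\<close>
  that lies in no earlier facet.\<close>

definition restriction :: "nat \<Rightarrow> 'v set" where
  "restriction j = {v \<in> Fs ! j. \<exists>k<j. Fs ! j - Fs ! k = {v}}"

text \<open>Indexed by exponents for the \<open>\<theta> y\<close> and by a facet, which contributes
  the squarefree monomial of its restriction. For indices in \<open>\<Lambda>\<close> the classes of
  these elements form a basis of \<open>S/I\<close> over \<open>K\<close>.\<close>

definition b :: "('v \<Rightarrow>\<^sub>0 nat) \<times> nat \<Rightarrow> ('v, 'k) mpoly" where
  "b \<alpha> = (\<Prod>y\<in>Y. q y (Poly_Mapping.lookup (fst \<alpha>) y)) * monomial (set_expo (restriction (snd \<alpha>)))"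

definition \<Lambda> :: "(('v \<Rightarrow>\<^sub>0 nat) \<times> nat) set" where
  "\<Lambda> = {(\<delta>, j). Poly_Mapping.keys \<delta> \<subseteq> Y \<and> j < length Fs}"

lemma I_ideal: "polys.is_ideal V I" by (rule nonface_ideal_ideal)

lemma facet_nth: "j < length Fs \<Longrightarrow> facet \<Delta> (Fs ! j)"
  using Fs nth_mem by blast

lemma nth_indep: "j < length Fs \<Longrightarrow> Fs ! j \<in> \<Delta>"
  by (rule facet_indep[OF facet_nth])

lemma restriction_sub: "restriction j \<subseteq> Fs ! j"
  by (auto simp: restriction_def)

lemma restriction_fin: "j < length Fs \<Longrightarrow> finite (restriction j)"
  using restriction_sub finite_subset indep_finite[OF nth_indep] by blast

lemma restriction_V: "j < length Fs \<Longrightarrow> restriction j \<subseteq> V"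
  using restriction_sub indep_V[OF nth_indep] by blast

lemma restriction_not_sub: "i < length Fs \<Longrightarrow> j < i \<Longrightarrow> \<not> restriction i \<subseteq> Fs ! j"
  using shelling[of i j] by (auto simp: restriction_def)

lemma keys_restriction: "j < length Fs \<Longrightarrow> Poly_Mapping.keys (set_expo (restriction j)) = restriction j"
  by (rule keys_set_expo[OF restriction_fin])

text \<open>Take the first facet that contains \<open>A\<close>: a vertex of its restriction outside
  \<open>A\<close> would put \<open>A\<close> into an earlier facet. Together with
  \<open>restriction_not_sub\<close> this partitions the complex into the intervals from
  \<open>restriction k\<close> to \<open>Fs ! k\<close>.\<close>

lemma first_facet:
  assumes "A \<in> \<Delta>" obtains k where "k < length Fs" "A \<subseteq> Fs ! k" "restriction k \<subseteq> A"
proof -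
  obtain F where "facet \<Delta> F" "A \<subseteq> F" using facet_extends[OF assms] .
  then have ex: "\<exists>k. k < length Fs \<and> A \<subseteq> Fs ! k" using Fs by (metis in_set_conv_nth mem_Collect_eq)
  define k where "k = (LEAST k. k < length Fs \<and> A \<subseteq> Fs ! k)"
  have k: "k < length Fs" "A \<subseteq> Fs ! k" using LeastI_ex[OF ex] by (auto simp: k_def)
  have "restriction k \<subseteq> A"
  proof
    fix v assume "v \<in> restriction k"
    then obtain l where l: "l < k" "Fs ! k - Fs ! l = {v}" by (auto simp: restriction_def)
    show "v \<in> A"
    proof (rule ccontr)
      assume "v \<notin> A"
      have "x \<in> Fs ! l" if "x \<in> A" for x
      proof (rule ccontr)
        assume "x \<notin> Fs ! l"
        then have "x \<in> Fs ! k - Fs ! l" using that k(2) by blast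
        then show False using l(2) \<open>v \<notin> A\<close> that by simp
      qed
      then have "A \<subseteq> Fs ! l" by blast
      then show False using not_less_Least[of l "\<lambda>k. k < length Fs \<and> A \<subseteq> Fs ! k"] l(1) k(1) by (simp add: k_def)
    qed
  qed
  then show ?thesis using that k by blast
qed

lemma \<theta>_mem: "y \<in> Y \<Longrightarrow> \<theta> y \<in> polys V"
  unfolding \<theta>_def using Y_V p_V(1) by (intro polys.add_mem polys_indet) auto

lemma h_mem: "y \<in> Y \<Longrightarrow> h y \<in> polys V"
  unfolding h_def by (intro polys.add_mem polys.sum_mem polys.mult_mem polys_Const polys.power_mem \<theta>_mem)

lemma q_mem: "y \<in> Y \<Longrightarrow> q y k \<in> polys V"
  unfolding q_def by (intro polys.mult_mem polys.power_mem \<theta>_mem h_mem)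

lemma b_mem: "\<alpha> \<in> \<Lambda> \<Longrightarrow> b \<alpha> \<in> polys V"
  unfolding b_def
  by (intro polys.mult_mem polys.prod_mem q_mem)
    (auto simp: \<Lambda>_def polys_monomial_mem keys_restriction dest: subsetD[OF restriction_V])

lemma q_0: "q y 0 = 1"
  by (simp add: q_def)

lemma h_q: "y \<in> Y \<Longrightarrow> h y * q y k = q y (k + d y)"
  using d_pos[of y] by (simp add: q_def mult.assoc)

text \<open>Multiplication by \<open>\<theta> y\<close> raises the index by one, except when the
  power of \<open>\<theta> y\<close> reaches \<open>d y\<close>; then it is rewritten by the
  definition of \<open>h y\<close>.\<close>

lemma \<theta>_q: assumes y: "y \<in> Y" shows "\<theta> y * q y k \<in> pv.span (range (q y))"
proof (cases "Suc (k mod d y) = d y")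
  case False
  have "k mod d y < d y" using d_pos[OF y] by simp
  then have "Suc k mod d y = Suc (k mod d y)" "Suc k div d y = k div d y"
    using False by (auto simp: mod_Suc div_Suc)
  then have "\<theta> y * q y k = q y (Suc k)" by (simp add: q_def mult_ac)
  then show ?thesis by (simp add: pv.span_base)
next
  case True
  let ?a = "k div d y"
  have qa: "q y (?a * d y + i) = h y ^ ?a * \<theta> y ^ i" if "i < d y" for i
    using that by (simp add: q_def)
  have "h y ^ Suc ?a = q y (Suc ?a * d y)" using d_pos[OF y] by (simp add: q_def)
  moreover have "\<theta> y * q y k = h y ^ ?a * \<theta> y ^ d y"
    unfolding q_def using True by (metis mult.left_commute power_Suc)
  moreover have "h y ^ ?a * \<theta> y ^ d y = h y ^ Suc ?a - (\<Sum>i<d y. Const (c y i) * (h y ^ ?a * \<theta> y ^ i))"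
  proof -
    have "\<theta> y ^ d y = h y - (\<Sum>i<d y. Const (c y i) * \<theta> y ^ i)" by (simp add: h_def)
    then show ?thesis by (simp add: right_diff_distrib sum_distrib_left mult_ac)
  qed
  ultimately have "\<theta> y * q y k = q y (Suc ?a * d y) - (\<Sum>i<d y. Const (c y i) * q y (?a * d y + i))"
    using qa by simp
  then show ?thesis by (auto intro!: pv.span_diff pv.span_sum pv.span_scale intro: pv.span_base)
qed

text \<open>Isolates the factor that belongs to \<open>y\<close>, so that multiplication by
  \<open>\<theta> y\<close> or \<open>h y\<close> concerns a single exponent.\<close>

lemma b_update:
  assumes y: "y \<in> Y" and l: "(\<delta>, j) \<in> \<Lambda>"
  obtains r where "\<And>k. q y k * r = b (Poly_Mapping.update y k \<delta>, j)"
    "\<And>k. (Poly_Mapping.update y k \<delta>, j) \<in> \<Lambda>" "b (\<delta>, j) = q y (Poly_Mapping.lookup \<delta> y) * r"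
proof -
  define r where "r = (\<Prod>x\<in>Y - {y}. q x (Poly_Mapping.lookup \<delta> x)) * monomial (set_expo (restriction j))"
  have rb: "q y k * r = b (Poly_Mapping.update y k \<delta>, j)" for k
  proof -
    have "(\<Prod>x\<in>Y. q x (Poly_Mapping.lookup (Poly_Mapping.update y k \<delta>) x)) =
        q y k * (\<Prod>x\<in>Y - {y}. q x (Poly_Mapping.lookup \<delta> x))"
    proof -
      have "(\<Prod>x\<in>Y - {y}. q x (Poly_Mapping.lookup (Poly_Mapping.update y k \<delta>) x)) =
          (\<Prod>x\<in>Y - {y}. q x (Poly_Mapping.lookup \<delta> x))"
        by (rule prod.cong) (simp_all add: lookup_update eq_commute[of y])
      then show ?thesis by (subst prod.remove[OF finY y]) (simp add: lookup_update)
    qed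
    then show ?thesis by (simp add: b_def r_def mult.assoc)
  qed
  have "Poly_Mapping.update y (Poly_Mapping.lookup \<delta> y) \<delta> = \<delta>"
    by (intro poly_mapping_eqI) (simp add: lookup_update)
  then have "b (\<delta>, j) = q y (Poly_Mapping.lookup \<delta> y) * r" using rb[of "Poly_Mapping.lookup \<delta> y"] by simp
  moreover have "(Poly_Mapping.update y k \<delta>, j) \<in> \<Lambda>" for k
    using l y by (auto simp: \<Lambda>_def in_keys_iff lookup_update subset_iff split: if_splits)
  ultimately show ?thesis using that rb by blast
qed

definition spanned :: "(('v \<Rightarrow>\<^sub>0 nat) \<times> nat) set \<Rightarrow> ('v, 'k) mpoly set" where
  "spanned L = {f. \<exists>g\<in>pv.span (b ` L). f - g \<in> I}"

lemma spanned_add: "f \<in> spanned L \<Longrightarrow> g \<in> spanned L \<Longrightarrow> f + g \<in> spanned L"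
proof -
  assume "f \<in> spanned L" "g \<in> spanned L"
  then obtain f' g' where "f' \<in> pv.span (b ` L)" "g' \<in> pv.span (b ` L)" "f - f' \<in> I" "g - g' \<in> I"
    by (auto simp: spanned_def)
  moreover from this have "(f + g) - (f' + g') \<in> I"
    using polys.ideal_add[OF I_ideal, of "f - f'" "g - g'"] by (simp add: algebra_simps)
  ultimately show ?thesis unfolding spanned_def by (blast intro: pv.span_add)
qed

lemma spanned_Const: "f \<in> spanned L \<Longrightarrow> Const a * f \<in> spanned L"
proof -
  assume "f \<in> spanned L"
  then obtain f' where "f' \<in> pv.span (b ` L)" "f - f' \<in> I" by (auto simp: spanned_def)
  moreover from this have "Const a * f - Const a * f' \<in> I"
    using polys.ideal_mult[OF I_ideal polys_Const, of "f - f'" a] by (simp add: algebra_simps)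
  ultimately show ?thesis unfolding spanned_def by (blast intro: pv.span_scale)
qed

lemma spanned_diff: "f \<in> spanned L \<Longrightarrow> g \<in> spanned L \<Longrightarrow> f - g \<in> spanned L"
  using spanned_add[of f L "Const (- 1) * g"] spanned_Const[of g L "- 1"] by (simp add: Const_uminus)

lemma spanned_I: "f \<in> I \<Longrightarrow> f \<in> spanned L"
  by (auto simp: spanned_def intro!: bexI[of _ 0] pv.span_zero)

lemma spanned_base: "\<alpha> \<in> L \<Longrightarrow> b \<alpha> \<in> spanned L"
  using polys.ideal_zero[OF I_ideal] by (auto simp: spanned_def intro!: bexI[of _ "b \<alpha>"] pv.span_base)

lemma spanned_sum: "(\<And>i. i \<in> A \<Longrightarrow> f i \<in> spanned L) \<Longrightarrow> sum f A \<in> spanned L"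
  by (induction A rule: infinite_finite_induct)
    (auto intro: spanned_add spanned_I polys.ideal_zero[OF I_ideal])

lemma spanned_mono: "L \<subseteq> L' \<Longrightarrow> spanned L \<subseteq> spanned L'"
  using pv.span_mono[of "b ` L" "b ` L'"] by (auto simp: spanned_def)

lemma spanned_mult:
  assumes r: "r \<in> polys V" "\<And>\<alpha>. \<alpha> \<in> L \<Longrightarrow> b \<alpha> * r \<in> pv.span (b ` L')" and f: "f \<in> spanned L"
  shows "r * f \<in> spanned L'"
proof -
  obtain g where g: "g \<in> pv.span (b ` L)" "f - g \<in> I" using f by (auto simp: spanned_def)
  have "g * r \<in> pv.span (b ` L')" by (rule pv_span_mult_image[OF _ g(1)]) (use r(2) in auto)
  moreover have "r * f - g * r \<in> I"
    using polys.ideal_mult[OF I_ideal r(1) g(2)] by (simp add: algebra_simps)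
  ultimately show ?thesis unfolding spanned_def by blast
qed

definition \<Lambda>_from :: "nat \<Rightarrow> (('v \<Rightarrow>\<^sub>0 nat) \<times> nat) set" where
  "\<Lambda>_from j = {(\<delta>, k). (\<delta>, k) \<in> \<Lambda> \<and> j \<le> k}"

lemma \<theta>_spanned: assumes y: "y \<in> Y" and f: "f \<in> spanned (\<Lambda>_from j)" shows "\<theta> y * f \<in> spanned (\<Lambda>_from j)"
proof (rule spanned_mult[OF \<theta>_mem[OF y] _ f])
  fix \<alpha> assume "\<alpha> \<in> \<Lambda>_from j"
  then obtain \<delta> k where l: "\<alpha> = (\<delta>, k)" "(\<delta>, k) \<in> \<Lambda>" "j \<le> k" by (auto simp: \<Lambda>_from_def)
  obtain r where r: "\<And>i. q y i * r = b (Poly_Mapping.update y i \<delta>, k)"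
    "\<And>i. (Poly_Mapping.update y i \<delta>, k) \<in> \<Lambda>" "b (\<delta>, k) = q y (Poly_Mapping.lookup \<delta> y) * r"
    using b_update[OF y l(2)] by blast
  have "\<theta> y * q y (Poly_Mapping.lookup \<delta> y) * r \<in> pv.span (b ` \<Lambda>_from j)"
  proof (rule pv_span_mult_image[OF _ \<theta>_q[OF y]])
    fix s assume "s \<in> range (q y)"
    then obtain i where "s = q y i" by blast
    then have "s * r = b (Poly_Mapping.update y i \<delta>, k)" using r(1) by simp
    then show "s * r \<in> pv.span (b ` \<Lambda>_from j)"
      using r(2)[of i] l(3) by (auto simp: \<Lambda>_from_def intro!: pv.span_base)
  qed
  then show "b \<alpha> * \<theta> y \<in> pv.span (b ` \<Lambda>_from j)" unfolding l(1) r(3) by (simp add: mult_ac)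
qed

text \<open>Outer induction from the last facet backwards, inner induction on the degree. If the
  support lies in \<open>Fs ! j\<close> and a variable \<open>v\<close> can be removed without
  losing the restriction, write \<open>v = \<theta> y - w\<close> with the other end
  \<open>w\<close> of its matching edge. The first term is settled by the smaller degree; the second
  has a support not contained in \<open>Fs ! j\<close> and belongs to a later facet or to
  \<open>I\<close>.\<close>

lemma monomial_spanned:
  assumes "j < length Fs" "Poly_Mapping.keys \<mu> \<subseteq> V" "restriction j \<subseteq> Poly_Mapping.keys \<mu>"
  shows "monomial \<mu> \<in> spanned (\<Lambda>_from j)"
  using assms
proof (induction "length Fs - j" arbitrary: j \<mu> rule: less_induct)
  case outer: less
  have later: "monomial \<mu> \<in> spanned (\<Lambda>_from j)"
    if m: "Poly_Mapping.keys \<mu> \<subseteq> V" "restriction j \<subseteq> Poly_Mapping.keys \<mu>" "\<not> Poly_Mapping.keys \<mu> \<subseteq> Fs ! j" for \<mu>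
  proof (cases "Poly_Mapping.keys \<mu> \<in> \<Delta>")
    case False
    then show ?thesis using monomial_nonface[OF m(1)] spanned_I by blast
  next
    case True
    then obtain k where k: "k < length Fs" "Poly_Mapping.keys \<mu> \<subseteq> Fs ! k" "restriction k \<subseteq> Poly_Mapping.keys \<mu>"
      by (rule first_facet)
    have "\<not> k < j" using restriction_not_sub[OF outer.prems(1)] m(2) k(2) by blast
    moreover have "k \<noteq> j" using k(2) m(3) by blast
    ultimately have jk: "j < k" by simp
    then have "monomial \<mu> \<in> spanned (\<Lambda>_from k)" using outer.hyps[of k \<mu>] k m(1) by auto
    moreover have "\<Lambda>_from k \<subseteq> \<Lambda>_from j" using jk by (auto simp: \<Lambda>_from_def)
    ultimately show ?thesis using spanned_mono by blast
  qed
  show ?case using outer.prems(2,3)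
  proof (induction "total_deg \<mu>" arbitrary: \<mu> rule: less_induct)
    case less
    show ?case
    proof (cases "Poly_Mapping.keys \<mu> \<subseteq> Fs ! j")
      case False
      then show ?thesis using later less.prems by blast
    next
      case True
      show ?thesis
      proof (cases "\<exists>v\<in>Poly_Mapping.keys \<mu>. restriction j \<subseteq> Poly_Mapping.keys (\<mu> - Poly_Mapping.single v 1)")
        case True': True
        then obtain v where v: "v \<in> Poly_Mapping.keys \<mu>" "restriction j \<subseteq> Poly_Mapping.keys (\<mu> - Poly_Mapping.single v 1)" by blast
        let ?\<nu> = "\<mu> - Poly_Mapping.single v 1"
        have vV: "v \<in> V" using v(1) less.prems by blast
        have "\<exists>y w. y \<in> Y \<and> w \<in> V \<and> w \<notin> Fs ! j \<and> \<theta> y = indet v + indet w"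
          using vV
        proof (cases rule: V_cases)
          case 1
          then show ?thesis using facet_exactly_one[OF facet_nth[OF outer.prems(1)] 1] p_V(1)[OF 1] v(1) True
            by (intro exI[of _ v] exI[of _ "p v"]) (auto simp: \<theta>_def)
        next
          case (2 y)
          then show ?thesis using facet_exactly_one[OF facet_nth[OF outer.prems(1)] 2(1)] Y_V v(1) True
            by (intro exI[of _ y] exI[of _ y]) (auto simp: \<theta>_def add.commute)
        qed
        then obtain y w where yw: "y \<in> Y" "w \<in> V" "w \<notin> Fs ! j" "\<theta> y = indet v + indet w" by blast
        have \<nu>V: "Poly_Mapping.keys ?\<nu> \<subseteq> V" using keys_minus_nat[of \<mu> "Poly_Mapping.single v 1"] less.prems by blast
        have "\<mu> = Poly_Mapping.single v 1 + ?\<nu>"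
          using v(1) by (intro poly_mapping_eqI) (auto simp: lookup_add lookup_minus lookup_single when_def in_keys_iff)
        then have "total_deg \<mu> = total_deg (Poly_Mapping.single v (1::nat)) + total_deg ?\<nu>" by (metis total_deg_add)
        then have "total_deg ?\<nu> < total_deg \<mu>" by simp
        then have "monomial ?\<nu> \<in> spanned (\<Lambda>_from j)" using less.hyps \<nu>V v(2) by blast
        then have 1: "\<theta> y * monomial ?\<nu> \<in> spanned (\<Lambda>_from j)" by (rule \<theta>_spanned[OF yw(1)])
        have 2: "monomial (Poly_Mapping.single w 1 + ?\<nu>) \<in> spanned (\<Lambda>_from j)"
          using yw \<nu>V v(2) by (intro later) (auto simp: keys_add_nat)
        have "monomial \<mu> = indet v * (monomial ?\<nu> :: ('v, 'k) mpoly)" by (rule indet_monomial[OF v(1)])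
        also have "\<dots> = \<theta> y * monomial ?\<nu> - monomial (Poly_Mapping.single w 1 + ?\<nu>)"
          by (simp add: yw(4) monomial_add indet_def distrib_right)
        finally show ?thesis using spanned_diff[OF 1 2] by simp
      next
        case False
        \<comment> \<open>No variable can be removed, so \<open>\<mu>\<close> is the squarefree
          exponent of the restriction itself.\<close>
        have "\<mu> = set_expo (restriction j)"
        proof (rule poly_mapping_eqI)
          fix v
          show "Poly_Mapping.lookup \<mu> v = Poly_Mapping.lookup (set_expo (restriction j)) v"
          proof (cases "v \<in> Poly_Mapping.keys \<mu>")
            case True
            then obtain w where w: "w \<in> restriction j" "w \<notin> Poly_Mapping.keys (\<mu> - Poly_Mapping.single v 1)"
              using False by blast
            moreover have "w \<in> Poly_Mapping.keys \<mu>" using w(1) less.prems by blast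
            ultimately have "w = v" "Poly_Mapping.lookup \<mu> v = 1"
              using True by (auto simp: in_keys_iff lookup_minus lookup_single when_def split: if_splits)
            then show ?thesis using w(1) lookup_set_expo[OF restriction_fin[OF outer.prems(1)]] by simp
          next
            case F: False
            then have "v \<notin> restriction j" using less.prems by blast
            then show ?thesis using F lookup_set_expo[OF restriction_fin[OF outer.prems(1)]] by (simp add: in_keys_iff)
          qed
        qed
        then have "monomial \<mu> = b (0, j)" by (simp add: b_def q_0)
        moreover have "(0, j) \<in> \<Lambda>_from j" using outer.prems(1) by (simp add: \<Lambda>_from_def \<Lambda>_def)
        ultimately show ?thesis using spanned_base by metis
      qed
    qed
  qed
qed

lemma polys_spanned: assumes f: "f \<in> polys V" shows "f \<in> spanned \<Lambda>"
proof -
  have "monomial m \<in> spanned \<Lambda>" if "m \<in> Poly_Mapping.keys f" for m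
  proof -
    have mV: "Poly_Mapping.keys m \<subseteq> V" using f that by (auto simp: polys_def)
    show ?thesis
    proof (cases "Poly_Mapping.keys m \<in> \<Delta>")
      case True
      then obtain k where k: "k < length Fs" "restriction k \<subseteq> Poly_Mapping.keys m" by (rule first_facet)
      have "\<Lambda>_from k \<subseteq> \<Lambda>" by (auto simp: \<Lambda>_from_def)
      then show ?thesis using monomial_spanned[OF k(1) mV k(2)] spanned_mono by blast
    qed (use monomial_nonface[OF mV] spanned_I in blast)
  qed
  then have "(\<Sum>m\<in>Poly_Mapping.keys f. Const (Poly_Mapping.lookup f m) * monomial m) \<in> spanned \<Lambda>"
    by (intro spanned_sum spanned_Const)
  then show ?thesis using poly_sum_monos[of f] by simp
qed

section \<open>Linear independence of the basis modulo the edge ideal\<close>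

definition tip :: "'v set \<Rightarrow> 'v \<Rightarrow> 'v" where
  "tip F y = (if y \<in> F then y else p y)"

text \<open>A facet contains exactly one end of each matching edge; modulo its prime the other end
  vanishes and \<open>\<theta> y\<close> becomes the variable of the end in the facet.\<close>

lemma \<theta>_leads:
  assumes F: "facet \<Delta> F" and y: "y \<in> Y"
  shows "leads V (var_prime V F) (Poly_Mapping.single (tip F y) 1) (\<theta> y)"
proof -
  have yV: "y \<in> V" "p y \<in> V" using y Y_V p_V by auto
  have "\<theta> y - (monomial (Poly_Mapping.single (tip F y) 1) + 0) \<in> var_prime V F"
    using facet_exactly_one[OF F y] indet_in_var_prime[OF yV(1)] indet_in_var_prime[OF yV(2)]
    by (auto simp: \<theta>_def tip_def indet_def)
  then show ?thesis
    unfolding leads_def using yV by (intro conjI bexI[of _ 0]) (auto simp: tip_def low_deg_0)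
qed

lemma \<theta>_power_leads:
  assumes "facet \<Delta> F" "y \<in> Y"
  shows "leads V (var_prime V F) (Poly_Mapping.single (tip F y) k) (\<theta> y ^ k)"
  using leads_power[OF var_prime_ideal \<theta>_leads[OF assms], of k] by simp

lemma h_leads:
  assumes F: "facet \<Delta> F" "y \<in> Y"
  shows "leads V (var_prime V F) (Poly_Mapping.single (tip F y) (d y)) (h y)"
  unfolding h_def
  by (rule leads_add_low[OF var_prime_ideal \<theta>_power_leads[OF F], where m' = "Poly_Mapping.single (tip F y)"])
    (use \<theta>_power_leads[OF F] in auto)

lemma q_leads:
  assumes F: "facet \<Delta> F" "y \<in> Y"
  shows "leads V (var_prime V F) (Poly_Mapping.single (tip F y) k) (q y k)"
proof -
  have "leads V (var_prime V F) (Poly_Mapping.single (tip F y) (d y * (k div d y)) + Poly_Mapping.single (tip F y) (k mod d y)) (q y k)"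
    unfolding q_def by (intro leads_mult[OF var_prime_ideal] leads_power[OF var_prime_ideal] h_leads F \<theta>_power_leads)
  then show ?thesis by (simp flip: single_add)
qed

definition tip_expo :: "'v set \<Rightarrow> ('v \<Rightarrow>\<^sub>0 nat) \<Rightarrow> 'v \<Rightarrow>\<^sub>0 nat" where
  "tip_expo F \<delta> = (\<Sum>y\<in>Y. Poly_Mapping.single (tip F y) (Poly_Mapping.lookup \<delta> y))"

lemma tip_inj: "x \<in> Y \<Longrightarrow> y \<in> Y \<Longrightarrow> tip F x = tip F y \<Longrightarrow> x = y"
  using p_inj p_V(2) by (auto simp: tip_def split: if_splits)

lemma lookup_tip_expo: assumes "y \<in> Y" shows "Poly_Mapping.lookup (tip_expo F \<delta>) (tip F y) = Poly_Mapping.lookup \<delta> y"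
proof -
  have "Poly_Mapping.lookup (tip_expo F \<delta>) (tip F y) = (\<Sum>x\<in>Y. if x = y then Poly_Mapping.lookup \<delta> y else 0)"
    unfolding tip_expo_def lookup_sum using tip_inj[OF _ assms]
    by (intro sum.cong) (auto simp: lookup_single when_def)
  then show ?thesis using finY assms by simp
qed

lemma tip_expo_inj:
  assumes "Poly_Mapping.keys \<delta> \<subseteq> Y" "Poly_Mapping.keys \<delta>' \<subseteq> Y" "tip_expo F \<delta> = tip_expo F \<delta>'"
  shows "\<delta> = \<delta>'"
proof (rule poly_mapping_eqI)
  fix y
  show "Poly_Mapping.lookup \<delta> y = Poly_Mapping.lookup \<delta>' y"
  proof (cases "y \<in> Y")
    case True
    then show ?thesis using lookup_tip_expo[OF True, of F] assms(3) by metis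
  next
    case False
    then have "y \<notin> Poly_Mapping.keys \<delta>" "y \<notin> Poly_Mapping.keys \<delta>'" using assms by auto
    then show ?thesis by (simp add: in_keys_iff)
  qed
qed

lemma total_deg_tip_expo: "Poly_Mapping.keys \<delta> \<subseteq> Y \<Longrightarrow> total_deg (tip_expo F \<delta>) = total_deg \<delta>"
  unfolding tip_expo_def by (simp add: total_deg_sum_expo[OF finY] total_deg_sum[OF finY])

lemma keys_tip_expo: assumes F: "facet \<Delta> F" shows "Poly_Mapping.keys (tip_expo F \<delta>) \<subseteq> F"
proof -
  have "tip F y \<in> F" if "y \<in> Y" for y using facet_exactly_one[OF F that] by (simp add: tip_def)
  then have "Poly_Mapping.lookup (tip_expo F \<delta>) v = 0" if "v \<notin> F" for v
    using that unfolding tip_expo_def lookup_sum by (intro sum.neutral) (auto simp: lookup_single when_def)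
  then show ?thesis by (auto simp: in_keys_iff)
qed

text \<open>Reduce a relation modulo the prime of the first facet that occurs in it: the terms of the
  later facets vanish there, and the terms of the facet itself have different leading monomials.\<close>

lemma b_independent_mod:
  assumes L: "finite L" "L \<subseteq> \<Lambda>" and rel: "(\<Sum>\<alpha>\<in>L. Const (u \<alpha>) * b \<alpha>) \<in> I" and a: "\<alpha> \<in> L"
  shows "u \<alpha> = 0"
proof (rule ccontr)
  assume "u \<alpha> \<noteq> 0"
  define N where "N = {\<alpha> \<in> L. u \<alpha> \<noteq> 0}"
  have "\<alpha> \<in> N" using a \<open>u \<alpha> \<noteq> 0\<close> by (simp add: N_def)
  then have "N \<noteq> {}" by blast
  moreover have "finite N" "N \<subseteq> \<Lambda>" using L by (auto simp: N_def)
  ultimately have N: "finite N" "N \<noteq> {}" "N \<subseteq> \<Lambda>" by simp_all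
  define j where "j = Min (snd ` N)"
  define N' where "N' = {\<alpha> \<in> N. snd \<alpha> = j}"
  have jN: "j \<in> snd ` N" unfolding j_def using N by (intro Min_in) auto
  have N'ne: "finite N'" "N' \<noteq> {}" using jN N by (auto simp: N'_def)
  \<comment> \<open>At a term of largest degree, the lower-order parts of the other terms have
    smaller degree and cannot reach its leading monomial.\<close>
  define D where "D = Max (total_deg ` fst ` N')"
  have "D \<in> total_deg ` fst ` N'" unfolding D_def using N'ne by (intro Max_in) auto
  then obtain \<beta> where \<beta>: "\<beta> \<in> N'" "total_deg (fst \<beta>) = D" by auto
  have Dmax: "total_deg (fst \<gamma>) \<le> D" if "\<gamma> \<in> N'" for \<gamma> unfolding D_def using N'ne that by (intro Max_ge) auto
  have jl: "j < length Fs" using jN N(3) by (auto simp: \<Lambda>_def)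
  define F where "F = Fs ! j"
  have F: "facet \<Delta> F" unfolding F_def by (rule facet_nth[OF jl])
  define P where "P = (var_prime V F :: ('v, 'k) mpoly set)"
  have Pp: "polys.is_prime V P" unfolding P_def by (rule var_prime_prime[OF finV])
  note Pi = polys.prime_ideal[OF Pp]
  let ?e = "\<lambda>j. monomial (set_expo (restriction j)) :: ('v, 'k) mpoly"
  let ?q = "\<lambda>\<alpha>. \<Prod>y\<in>Y. q y (Poly_Mapping.lookup (fst \<alpha>) y)"
  have qS: "?q \<alpha> \<in> polys V" for \<alpha> by (intro polys.prod_mem q_mem)
  have eP: "?e k \<in> P \<longleftrightarrow> \<not> restriction k \<subseteq> F" if "k < length Fs" for k
    using restriction_V[OF that] by (simp add: P_def var_prime_def polys_monomial_mem keys_restriction[OF that])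
  have late: "Const (u \<alpha>) * b \<alpha> \<in> P" if "\<alpha> \<in> L - N'" for \<alpha>
  proof (cases "u \<alpha> = 0")
    case True
    then show ?thesis using polys.ideal_zero[OF Pi] by simp
  next
    case False
    then have aN: "\<alpha> \<in> N" "snd \<alpha> \<noteq> j" using that by (auto simp: N_def N'_def)
    have "j \<le> snd \<alpha>" unfolding j_def using N aN by (intro Min_le) auto
    moreover have sl: "snd \<alpha> < length Fs" using aN N by (auto simp: \<Lambda>_def)
    ultimately have "?e (snd \<alpha>) \<in> P" using eP[OF sl] restriction_not_sub[OF sl, of j] aN by (simp add: F_def)
    then have "b \<alpha> \<in> P" unfolding b_def by (rule polys.ideal_mult[OF Pi qS])
    then show ?thesis by (rule polys.ideal_mult[OF Pi polys_Const])
  qed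
  have "(\<Sum>\<alpha>\<in>L. Const (u \<alpha>) * b \<alpha>) \<in> P"
    using rel nonface_sub_var_prime[OF facet_indep[OF F]] by (auto simp: P_def)
  moreover have "(\<Sum>\<alpha>\<in>L. Const (u \<alpha>) * b \<alpha>) = (\<Sum>\<alpha>\<in>L - N'. Const (u \<alpha>) * b \<alpha>) + (\<Sum>\<alpha>\<in>N'. Const (u \<alpha>) * b \<alpha>)"
    using L by (intro sum.subset_diff) (auto simp: N_def N'_def)
  moreover have "(\<Sum>\<alpha>\<in>L - N'. Const (u \<alpha>) * b \<alpha>) \<in> P" by (rule polys.ideal_sum[OF Pi late])
  ultimately have "(\<Sum>\<alpha>\<in>N'. Const (u \<alpha>) * b \<alpha>) \<in> P"
    using polys.ideal_diff[OF Pi, of "_ + _"] by fastforce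
  moreover have "(\<Sum>\<alpha>\<in>N'. Const (u \<alpha>) * b \<alpha>) = (\<Sum>\<alpha>\<in>N'. Const (u \<alpha>) * ?q \<alpha>) * ?e j"
    unfolding sum_distrib_right by (intro sum.cong) (auto simp: b_def N'_def mult.assoc)
  ultimately have "(\<Sum>\<alpha>\<in>N'. Const (u \<alpha>) * ?q \<alpha>) * ?e j \<in> P" by simp
  \<comment> \<open>The restriction lies in the facet, so its monomial is outside the prime and can
    be cancelled.\<close>
  moreover have "?e j \<notin> P" using eP[OF jl] restriction_sub by (simp add: F_def)
  moreover have "(\<Sum>\<alpha>\<in>N'. Const (u \<alpha>) * ?q \<alpha>) \<in> polys V" by (intro polys.sum_mem polys.mult_mem polys_Const qS)
  moreover have "?e j \<in> polys V" using restriction_V[OF jl] by (simp add: polys_monomial_mem keys_restriction[OF jl])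
  ultimately have sP: "(\<Sum>\<alpha>\<in>N'. Const (u \<alpha>) * ?q \<alpha>) \<in> P" using polys.prime_cases[OF Pp] by blast
  let ?m = "tip_expo F (fst \<beta>)"
  have kd: "Poly_Mapping.keys (fst \<gamma>) \<subseteq> Y" if "\<gamma> \<in> N'" for \<gamma>
  proof -
    have "\<gamma> \<in> \<Lambda>" using that N(3) by (auto simp: N'_def)
    then show ?thesis by (auto simp: \<Lambda>_def)
  qed
  have lk: "Poly_Mapping.lookup (?q \<gamma>) ?m = (if \<gamma> = \<beta> then 1 else 0)" if g: "\<gamma> \<in> N'" for \<gamma>
  proof -
    have "leads V P (tip_expo F (fst \<gamma>)) (?q \<gamma>)"
      unfolding tip_expo_def P_def by (intro leads_prod[OF finY var_prime_ideal] q_leads F)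
    then obtain l where l: "l \<in> low_deg (total_deg (tip_expo F (fst \<gamma>)))" "?q \<gamma> - (monomial (tip_expo F (fst \<gamma>)) + l) \<in> P"
      by (auto simp: leads_def)
    have "?m \<notin> Poly_Mapping.keys (?q \<gamma> - (monomial (tip_expo F (fst \<gamma>)) + l))"
      using l(2) keys_tip_expo[OF F] unfolding P_def var_prime_def by blast
    then have "Poly_Mapping.lookup (?q \<gamma>) ?m = Poly_Mapping.lookup (monomial (tip_expo F (fst \<gamma>)) + l) ?m"
      by (simp add: in_keys_iff lookup_minus)
    moreover have "?m \<notin> Poly_Mapping.keys l"
    proof
      assume "?m \<in> Poly_Mapping.keys l"
      then have "total_deg ?m < total_deg (tip_expo F (fst \<gamma>))" using l(1) by (auto simp: low_deg_def)
      then show False using total_deg_tip_expo[OF kd[OF g], of F] total_deg_tip_expo[OF kd[OF \<beta>(1)], of F] \<beta>(2) Dmax[OF g] by simp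
    qed
    moreover have "tip_expo F (fst \<gamma>) = ?m \<longleftrightarrow> \<gamma> = \<beta>"
    proof
      assume "tip_expo F (fst \<gamma>) = ?m"
      then have "fst \<gamma> = fst \<beta>" using tip_expo_inj[OF kd[OF g] kd[OF \<beta>(1)]] by blast
      moreover have "snd \<gamma> = snd \<beta>" using g \<beta>(1) by (simp add: N'_def)
      ultimately show "\<gamma> = \<beta>" by (rule prod_eqI)
    qed simp
    ultimately show ?thesis by (simp add: lookup_add in_keys_iff monomial_def lookup_single when_def)
  qed
  have "Poly_Mapping.lookup (\<Sum>\<gamma>\<in>N'. Const (u \<gamma>) * ?q \<gamma>) ?m = (\<Sum>\<gamma>\<in>N'. u \<gamma> * Poly_Mapping.lookup (?q \<gamma>) ?m)"
    unfolding lookup_sum Const_def mult_map_scale_conv_mult[symmetric]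
    by (intro sum.cong refl) (simp add: map.rep_eq when_def)
  also have "\<dots> = (\<Sum>\<gamma>\<in>N'. if \<gamma> = \<beta> then u \<beta> else 0)" using lk by (intro sum.cong) auto
  also have "\<dots> = u \<beta>" using N'ne \<beta>(1) by simp
  finally have "Poly_Mapping.lookup (\<Sum>\<gamma>\<in>N'. Const (u \<gamma>) * ?q \<gamma>) ?m = u \<beta>" .
  moreover have "?m \<notin> Poly_Mapping.keys (\<Sum>\<gamma>\<in>N'. Const (u \<gamma>) * ?q \<gamma>)"
    using sP keys_tip_expo[OF F] unfolding P_def var_prime_def by blast
  ultimately have "u \<beta> = 0" by (simp add: in_keys_iff)
  then show False using \<beta>(1) by (simp add: N'_def N_def)
qed

lemma b_inj: "inj_on b \<Lambda>"
proof (rule inj_onI, rule ccontr)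
  fix \<alpha> \<beta> assume ab: "\<alpha> \<in> \<Lambda>" "\<beta> \<in> \<Lambda>" "b \<alpha> = b \<beta>" "\<alpha> \<noteq> \<beta>"
  let ?u = "\<lambda>\<gamma>. if \<gamma> = \<alpha> then 1 else - 1 :: 'k"
  have "(\<Sum>\<gamma>\<in>{\<alpha>, \<beta>}. Const (?u \<gamma>) * b \<gamma>) = 0" using ab by (simp add: Const_uminus)
  then have "?u \<alpha> = 0" using b_independent_mod[of "{\<alpha>, \<beta>}" ?u \<alpha>] ab polys.ideal_zero[OF I_ideal] by simp
  then show False by simp
qed

lemma span_b_expand:
  assumes "x \<in> pv.span (b ` \<Lambda>)"
  obtains L u where "finite L" "L \<subseteq> \<Lambda>" "x = (\<Sum>\<alpha>\<in>L. Const (u \<alpha>) * b \<alpha>)"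
proof -
  obtain T w where T: "finite T" "T \<subseteq> b ` \<Lambda>" "x = (\<Sum>a\<in>T. Const (w a) * a)"
    using assms unfolding pv.span_explicit by blast
  define L where "L = {\<alpha> \<in> \<Lambda>. b \<alpha> \<in> T}"
  have TL: "T = b ` L" using T(2) by (auto simp: L_def)
  have inj: "inj_on b L" using b_inj by (rule inj_on_subset) (auto simp: L_def)
  have "finite L" using T(1) TL inj by (simp add: finite_image_iff)
  moreover have "x = (\<Sum>\<alpha>\<in>L. Const (w (b \<alpha>)) * b \<alpha>)" unfolding T(3) TL by (simp add: sum.reindex[OF inj])
  ultimately show ?thesis using that[of L "\<lambda>\<alpha>. w (b \<alpha>)"] by (auto simp: L_def)
qed

lemma span_b_I: assumes "x \<in> pv.span (b ` \<Lambda>)" "x \<in> I" shows "x = 0"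
proof -
  obtain L u where L: "finite L" "L \<subseteq> \<Lambda>" "x = (\<Sum>\<alpha>\<in>L. Const (u \<alpha>) * b \<alpha>)"
    using span_b_expand[OF assms(1)] .
  then have "u \<alpha> = 0" if "\<alpha> \<in> L" for \<alpha> using b_independent_mod[OF L(1,2) _ that] assms(2) by blast
  then show ?thesis using L(3) by simp
qed

lemma b_independent: "pv.independent (b ` \<Lambda>)"
  unfolding pv.dependent_explicit
proof (intro notI, elim exE conjE bexE)
  fix T w v assume T: "finite T" "T \<subseteq> b ` \<Lambda>" "(\<Sum>v\<in>T. Const (w v) * v) = 0" "v \<in> T" "w v \<noteq> 0"
  define L where "L = {\<alpha> \<in> \<Lambda>. b \<alpha> \<in> T}"
  have TL: "T = b ` L" using T(2) by (auto simp: L_def)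
  have inj: "inj_on b L" using b_inj by (rule inj_on_subset) (auto simp: L_def)
  have fin: "finite L" using T(1) TL inj by (simp add: finite_image_iff)
  have "(\<Sum>\<alpha>\<in>L. Const (w (b \<alpha>)) * b \<alpha>) = 0" using T(3) unfolding TL by (simp add: sum.reindex[OF inj])
  then have "w (b \<alpha>) = 0" if "\<alpha> \<in> L" for \<alpha>
    using b_independent_mod[OF fin, of "\<lambda>\<alpha>. w (b \<alpha>)" \<alpha>] that polys.ideal_zero[OF I_ideal] by (simp add: L_def)
  then show False using T(4,5) TL by auto
qed

text \<open>Indices of the basis elements with a factor \<open>h y\<close> for some \<open>y\<close>
  in \<open>T\<close>; by \<open>foldl_h\<close> they span the ideal of these \<open>h y\<close>
  modulo \<open>I\<close>.\<close>

definition \<Lambda>_div :: "'v set \<Rightarrow> (('v \<Rightarrow>\<^sub>0 nat) \<times> nat) set" where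
  "\<Lambda>_div T = {\<alpha> \<in> \<Lambda>. \<exists>y\<in>T. d y \<le> Poly_Mapping.lookup (fst \<alpha>) y}"

lemma h_b:
  assumes y: "y \<in> Y" and l: "(\<delta>, j) \<in> \<Lambda>"
  shows "b (\<delta>, j) * h y = b (Poly_Mapping.update y (Poly_Mapping.lookup \<delta> y + d y) \<delta>, j)"
    "(Poly_Mapping.update y (Poly_Mapping.lookup \<delta> y + d y) \<delta>, j) \<in> \<Lambda>"
proof -
  obtain r where r: "\<And>i. q y i * r = b (Poly_Mapping.update y i \<delta>, j)"
    "\<And>i. (Poly_Mapping.update y i \<delta>, j) \<in> \<Lambda>" "b (\<delta>, j) = q y (Poly_Mapping.lookup \<delta> y) * r"
    using b_update[OF y l] by blast
  have "b (\<delta>, j) * h y = (h y * q y (Poly_Mapping.lookup \<delta> y)) * r" unfolding r(3) by (simp add: mult_ac)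
  then show "b (\<delta>, j) * h y = b (Poly_Mapping.update y (Poly_Mapping.lookup \<delta> y + d y) \<delta>, j)"
    unfolding h_q[OF y] r(1) .
  show "(Poly_Mapping.update y (Poly_Mapping.lookup \<delta> y + d y) \<delta>, j) \<in> \<Lambda>" by (rule r(2))
qed

lemma h_b_span:
  assumes y: "y \<in> Y" and a: "\<alpha> \<in> \<Lambda>" and A: "\<And>\<delta> j. \<alpha> = (\<delta>, j) \<Longrightarrow>
    (Poly_Mapping.update y (Poly_Mapping.lookup \<delta> y + d y) \<delta>, j) \<in> \<Lambda> \<Longrightarrow>
    (Poly_Mapping.update y (Poly_Mapping.lookup \<delta> y + d y) \<delta>, j) \<in> A"
  shows "b \<alpha> * h y \<in> pv.span (b ` A)"
proof -
  obtain \<delta> j where dj: "\<alpha> = (\<delta>, j)" by (cases \<alpha>)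
  show ?thesis using h_b[OF y a[unfolded dj]] A[OF dj] unfolding dj by (auto intro!: pv.span_base)
qed

text \<open>A basis element whose exponent at \<open>y\<close> is at least \<open>d y\<close> has
  the factor \<open>h y\<close>, and multiplication of any basis element by \<open>h y\<close>
  produces such an element.\<close>

lemma foldl_h:
  assumes "set ys \<subseteq> Y"
  shows "foldl (polys.add_principal V) I (map h ys) = {f \<in> polys V. f \<in> spanned (\<Lambda>_div (set ys))}"
  using assms
proof (induction ys rule: rev_induct)
  case Nil
  show ?case using polys.ideal_sub[OF I_ideal] by (auto simp: spanned_def \<Lambda>_div_def)
next
  case (snoc y ys)
  interpret pq: poly_quotient V I by (rule nonface_quotient)
  have y: "y \<in> Y" "set ys \<subseteq> Y" using snoc.prems by auto
  let ?J = "foldl (polys.add_principal V) I (map h (ys @ [y]))"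
  let ?Jys = "foldl (polys.add_principal V) I (map h ys)"
  have hV: "set (map h (ys @ [y])) \<subseteq> polys V" using snoc.prems h_mem by auto
  note J = pq.foldl_add_principal[OF hV]
  have Jeq: "?J = polys.add_principal V ?Jys (h y)" by simp
  show ?case
  proof
    show "?J \<subseteq> {f \<in> polys V. f \<in> spanned (\<Lambda>_div (set (ys @ [y])))}"
    proof
      fix f assume f: "f \<in> ?J"
      then obtain a r where ar: "f = a + h y * r" "a \<in> ?Jys" "r \<in> polys V"
        unfolding Jeq polys.add_principal_def by blast
      have "\<Lambda>_div (set ys) \<subseteq> \<Lambda>_div (set (ys @ [y]))" by (auto simp: \<Lambda>_div_def)
      then have "a \<in> spanned (\<Lambda>_div (set (ys @ [y])))" using ar(2) snoc.IH[OF y(2)] spanned_mono by blast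
      moreover have "h y * r \<in> spanned (\<Lambda>_div (set (ys @ [y])))"
        by (rule spanned_mult[OF h_mem[OF y(1)] h_b_span[OF y(1)] polys_spanned[OF ar(3)]])
          (auto simp: \<Lambda>_div_def lookup_update)
      ultimately show "f \<in> {f \<in> polys V. f \<in> spanned (\<Lambda>_div (set (ys @ [y])))}"
        using ar(1) spanned_add polys.ideal_sub[OF J(1) f] by blast
    qed
    show "{f \<in> polys V. f \<in> spanned (\<Lambda>_div (set (ys @ [y])))} \<subseteq> ?J"
    proof
      fix f assume "f \<in> {f \<in> polys V. f \<in> spanned (\<Lambda>_div (set (ys @ [y])))}"
      then obtain g where g: "g \<in> pv.span (b ` \<Lambda>_div (set (ys @ [y])))" "f - g \<in> I" by (auto simp: spanned_def)
      have bJ: "b \<alpha> \<in> ?J" if al: "\<alpha> \<in> \<Lambda>_div (set (ys @ [y]))" for \<alpha>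
      proof -
        obtain \<delta> j where dj: "\<alpha> = (\<delta>, j)" by (cases \<alpha>)
        obtain x where x: "x \<in> set (ys @ [y])" "d x \<le> Poly_Mapping.lookup \<delta> x" "(\<delta>, j) \<in> \<Lambda>"
          using al by (auto simp: \<Lambda>_div_def dj)
        have xY: "x \<in> Y" using x(1) snoc.prems by auto
        obtain r where r: "\<And>i. q x i * r = b (Poly_Mapping.update x i \<delta>, j)"
          "\<And>i. (Poly_Mapping.update x i \<delta>, j) \<in> \<Lambda>" "b (\<delta>, j) = q x (Poly_Mapping.lookup \<delta> x) * r"
          using b_update[OF xY x(3)] by blast
        have "b \<alpha> = h x * (q x (Poly_Mapping.lookup \<delta> x - d x) * r)"
          unfolding dj r(3) using h_q[OF xY, of "Poly_Mapping.lookup \<delta> x - d x"] x(2) by (simp add: mult.assoc[symmetric])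
        moreover have "q x (Poly_Mapping.lookup \<delta> x - d x) * r \<in> polys V" unfolding r(1) by (rule b_mem[OF r(2)])
        moreover have "h x \<in> ?J" using J(3) x(1) by auto
        ultimately show ?thesis using polys.ideal_mult_right[OF J(1)] by simp
      qed
      have "g \<in> ?J" using g(1)
      proof (induction rule: pv.span_induct_alt)
        case base
        then show ?case by (rule polys.ideal_zero[OF J(1)])
      next
        case (step c0 a0 y0)
        then have "Const c0 * a0 \<in> ?J" using bJ by (intro polys.ideal_mult[OF J(1) polys_Const]) blast
        then show ?case using step(2) by (rule polys.ideal_add[OF J(1)])
      qed
      then show "f \<in> ?J" using g(2) J(2) polys.ideal_diff_iff[OF J(1), of f g] by blast
    qed
  qed
qed

lemma h_nonzero: assumes y: "y \<in> Y" shows "h y \<noteq> 0"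
proof
  assume "h y = 0"
  have n: "leads V (var_prime V Y) (Poly_Mapping.single (tip Y y) (d y)) (h y)" by (rule h_leads[OF Y y])
  then obtain l where l: "l \<in> low_deg (d y)" "h y - (monomial (Poly_Mapping.single y (d y)) + l) \<in> var_prime V Y"
    using y by (auto simp: leads_def tip_def)
  let ?m = "Poly_Mapping.single y (d y)"
  have "?m \<notin> Poly_Mapping.keys l" using l(1) by (auto simp: low_deg_def)
  then have "?m \<in> Poly_Mapping.keys (h y - (monomial ?m + l))"
    by (simp add: \<open>h y = 0\<close> in_keys_iff lookup_minus lookup_add monomial_def)
  then show False using l(2) y by (auto simp: var_prime_def split: if_splits)
qed

text \<open>For \<open>y\<close> outside \<open>T\<close>, multiplication by \<open>h y\<close> maps
  basis elements to basis elements, exactly and not only modulo \<open>I\<close>, and preserves both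
  \<open>\<Lambda>_div T\<close> and its complement. If \<open>h y * f\<close> is spanned by
  \<open>\<Lambda>_div T\<close> modulo \<open>I\<close>, the part \<open>f1\<close> of
  \<open>f\<close> over the complement satisfies \<open>f1 * h y = 0\<close>, and the polynomial
  ring is a domain.\<close>

lemma h_regular:
  assumes ys: "distinct ys" "set ys \<subseteq> Y" shows "regular_mod V I (map h ys)"
  unfolding regular_mod_def
proof (intro conjI allI impI)
  show "set (map h ys) \<subseteq> polys V" using ys h_mem by auto
  fix i assume "i < length (map h ys)"
  then have i: "i < length ys" by simp
  define T where "T = set (take i ys)"
  define y where "y = ys ! i"
  have T: "T \<subseteq> Y" "set (take i ys) \<subseteq> Y" using ys(2) set_take_subset[of i ys] by (auto simp: T_def)
  have y: "y \<in> Y" "y \<notin> T"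
    using subsetD[OF ys(2) nth_mem[OF i]] ys(1) i
    by (auto simp: y_def T_def in_set_conv_nth nth_eq_iff_index_eq)
  have J: "foldl (polys.add_principal V) I (take i (map h ys)) = {f \<in> polys V. f \<in> spanned (\<Lambda>_div T)}"
    unfolding take_map T_def by (rule foldl_h[OF T(2)])
  have "f \<in> spanned (\<Lambda>_div T)" if f: "f \<in> polys V" and hf: "h y * f \<in> spanned (\<Lambda>_div T)" for f
  proof -
    let ?A = "\<Lambda> - \<Lambda>_div T" and ?B = "\<Lambda>_div T"
    obtain f0 where f0: "f0 \<in> pv.span (b ` \<Lambda>)" "f - f0 \<in> I" using polys_spanned[OF f] by (auto simp: spanned_def)
    have "b ` \<Lambda> = b ` ?A \<union> b ` ?B" by (auto simp: \<Lambda>_div_def)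
    then obtain f1 f2 where f12: "f1 \<in> pv.span (b ` ?A)" "f2 \<in> pv.span (b ` ?B)" "f0 = f1 + f2"
      using f0(1) pv.span_Un[of "b ` ?A" "b ` ?B"] by auto
    have A: "f1 * h y \<in> pv.span (b ` ?A)"
    proof (rule pv_span_mult_image[OF _ f12(1)])
      fix s assume "s \<in> b ` ?A"
      then obtain \<alpha> where al: "\<alpha> \<in> ?A" "s = b \<alpha>" by blast
      show "s * h y \<in> pv.span (b ` ?A)" unfolding al(2)
        using al(1) y by (intro h_b_span) (auto simp: \<Lambda>_div_def lookup_update)
    qed
    have B: "f2 * h y \<in> pv.span (b ` ?B)"
    proof (rule pv_span_mult_image[OF _ f12(2)])
      fix s assume "s \<in> b ` ?B"
      then obtain \<alpha> where al: "\<alpha> \<in> ?B" "s = b \<alpha>" by blast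
      show "s * h y \<in> pv.span (b ` ?B)" unfolding al(2)
        using al(1) y by (intro h_b_span) (auto simp: \<Lambda>_div_def lookup_update)
    qed
    obtain g where g: "g \<in> pv.span (b ` ?B)" "h y * f - g \<in> I" using hf by (auto simp: spanned_def)
    have sub: "pv.span (b ` ?A) \<subseteq> pv.span (b ` \<Lambda>)" "pv.span (b ` ?B) \<subseteq> pv.span (b ` \<Lambda>)"
      by (intro pv.span_mono; auto simp: \<Lambda>_div_def)+
    have "f1 * h y - (g - f2 * h y) = (h y * f - g) - h y * (f - f0)"
      by (simp add: f12(3) algebra_simps)
    also have "\<dots> \<in> I" using g(2) polys.ideal_mult[OF I_ideal h_mem[OF y(1)] f0(2)] by (rule polys.ideal_diff[OF I_ideal])
    finally have "f1 * h y - (g - f2 * h y) \<in> I" .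
    moreover have gB: "g - f2 * h y \<in> pv.span (b ` ?B)" using g(1) B by (rule pv.span_diff)
    then have "f1 * h y - (g - f2 * h y) \<in> pv.span (b ` \<Lambda>)"
      by (rule pv.span_diff[OF subsetD[OF sub(1) A] subsetD[OF sub(2)]])
    \<comment> \<open>The span of the basis elements meets \<open>I\<close> only in 0, so the
      congruence is an equality of polynomials.\<close>
    ultimately have eq: "f1 * h y = g - f2 * h y" using span_b_I by fastforce
    have "f1 * h y = 0"
    proof (rule pv_span_disjoint[OF b_independent _ _ _ A])
      show "b ` ?A \<subseteq> b ` \<Lambda>" "b ` ?B \<subseteq> b ` \<Lambda>" by (auto simp: \<Lambda>_div_def)
      show "b ` ?A \<inter> b ` ?B = {}"
      proof -
        have "b ` ?A \<inter> b ` ?B = b ` (?A \<inter> ?B)"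
          by (rule inj_on_image_Int[OF b_inj, symmetric]) (auto simp: \<Lambda>_div_def)
        then show ?thesis by auto
      qed
      show "f1 * h y \<in> pv.span (b ` ?B)" unfolding eq by (rule gB)
    qed
    moreover have "f1 \<in> polys V"
    proof -
      obtain L u where L: "finite L" "L \<subseteq> \<Lambda>" "f1 = (\<Sum>\<alpha>\<in>L. Const (u \<alpha>) * b \<alpha>)"
        using span_b_expand[OF subsetD[OF sub(1) f12(1)]] .
      show ?thesis unfolding L(3) using L(2) by (intro polys.sum_mem polys.mult_mem polys_Const b_mem) auto
    qed
    ultimately have "f1 = 0" using polys_no_zero_divisors[OF finV _ h_mem[OF y(1)]] h_nonzero[OF y(1)] by blast
    then show ?thesis using f0(2) f12 by (auto simp: spanned_def)
  qed
  then show "polys.nonzerodivisor_on V (foldl (polys.add_principal V) I (take i (map h ys))) (map h ys ! i)"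
    unfolding J polys.nonzerodivisor_on_def using i by (simp add: y_def)
qed

end

lemma (in poly_quotient) maximal_poly_ideal:
  assumes M: "maximal_ideal V M" "I \<subseteq> M" shows "maximal_poly_ideal V M"
proof unfold_locales
  show "finite V" by (rule finV)
  show P: "polys.is_prime V M" by (rule maximal_prime[OF M])
  note Mi = polys.prime_ideal[OF P]
  fix f assume f: "f \<in> polys V - M"
  have "polys.is_ideal V (polys.add_principal V M f)" using polys.add_principal_ideal[OF Mi] f by blast
  moreover have "M \<subseteq> polys.add_principal V M f" by (rule polys.add_principal_sub)
  moreover have "f \<in> polys.add_principal V M f" by (rule polys.add_principal_self[OF Mi])
  ultimately have "polys.add_principal V M f = polys V" using M(1) f unfolding maximal_ideal_def by blast
  then have "1 \<in> polys.add_principal V M f" by simp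
  then obtain a r where ar: "1 = a + f * r" "a \<in> M" "r \<in> polys V" unfolding polys.add_principal_def by blast
  then have "f * r - 1 = - a" by (simp add: algebra_simps)
  then have "f * r - 1 \<in> M" using polys.ideal_uminus[OF Mi ar(2)] by simp
  then show "\<exists>g\<in>polys V. f * g - 1 \<in> M" using ar(3) by blast
qed

theorem (in matched_graph) shellable_imp_cohen_macaulay:
  assumes sh: "shellable_complex \<Delta>" shows "cohen_macaulay_graph TYPE('k::field) V E"
  unfolding cohen_macaulay_graph_eq
proof -
  define J where "J = (nonface_ideal :: ('a, 'k) mpoly set)"
  interpret pq: poly_quotient V J unfolding J_def by (rule nonface_quotient)
  show "cohen_macaulay_ring (mpoly_ring TYPE('k) V Quot nonface_ideal)"
    unfolding J_def[symmetric]
  proof (rule pq.cohen_macaulayI[where n = n])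
    fix M :: "('a, 'k) mpoly set" and k assume "polys.prime_chain V J M k"
    then show "k \<le> n"
      by (rule prime_chain_le_indep) (auto simp: J_def dest!: indep_card_le)
  next
    fix M :: "('a, 'k) mpoly set" assume M: "maximal_ideal V M" "J \<subseteq> M"
    interpret mx: maximal_poly_ideal V M by (rule pq.maximal_poly_ideal[OF M])
    obtain Fs where Fs: "set Fs = {F. facet \<Delta> F}"
      "\<forall>i<length Fs. \<forall>j<i. \<exists>v\<in>Fs ! i - Fs ! j. \<exists>k<i. Fs ! i - Fs ! k = {v}"
      using sh by (auto simp: shellable_complex_def)
    let ?t = "\<lambda>y. indet y + indet (p y) :: ('a, 'k) mpoly"
    have "\<exists>dc. 1 \<le> fst dc \<and> ?t y ^ fst dc + (\<Sum>k<fst dc. Const (snd dc k) * ?t y ^ k) \<in> M" if y: "y \<in> Y" for y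
    proof -
      have "?t y \<in> polys V" using Y_V p_V(1)[OF y] y by (intro polys.add_mem polys_indet) auto
      then obtain d c where "1 \<le> d" "?t y ^ d + (\<Sum>k<d. Const (c k) * ?t y ^ k) \<in> M" by (rule mx.algebraic_mod_maximal)
      then show ?thesis by (intro exI[of _ "(d, c)"]) simp
    qed
    then have "\<forall>y\<in>Y. \<exists>dc. 1 \<le> fst dc \<and> ?t y ^ fst dc + (\<Sum>k<fst dc. Const (snd dc k) * ?t y ^ k) \<in> M" by blast
    from bchoice[OF this] obtain dc where dc: "\<forall>y\<in>Y. 1 \<le> fst (dc y) \<and>
        ?t y ^ fst (dc y) + (\<Sum>k<fst (dc y). Const (snd (dc y) k) * ?t y ^ k) \<in> M" by blast
    \<comment> \<open>The parameters are the degree and the coefficients of a monic equation for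
      \<open>?t y\<close> modulo \<open>M\<close>, so that \<open>sg.h y\<close> lies in
      \<open>M\<close>.\<close>
    interpret sg: shelled_graph V E n Y p Fs "\<lambda>y. fst (dc y)" "\<lambda>y. snd (dc y)"
      using Fs dc by unfold_locales auto
    obtain ys where ys: "set ys = Y" "distinct ys" using finite_distinct_list[OF finY] by blast
    have "regular_mod V J (map sg.h ys)" unfolding J_def by (rule sg.h_regular) (use ys in auto)
    moreover have "set (map sg.h ys) \<subseteq> M" using dc ys by (auto simp: sg.h_def sg.\<theta>_def)
    moreover have "length (map sg.h ys) = n" using ys distinct_card[of ys] card_Y by simp
    ultimately show "\<exists>zs. regular_mod V J zs \<and> set zs \<subseteq> M \<and> length zs = n" by blast
  qed
qed

theorem theorem0p2:
  fixes V :: "'v set" and E :: "'v set set" and n :: nat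
  assumes "simple_graph V E"
    and "unmixed_graph V E"
    and "card V = 2 * n"
    and "no_isolated_vertex V E"
    and "ideal_height (mpoly_ring TYPE('k::field) V) (edge_ideal TYPE('k) V E) = enat n"
  shows "(cohen_macaulay_graph TYPE('k) V E \<longleftrightarrow>
            strongly_connected_complex (independence_complex V E)) \<and>
         (strongly_connected_complex (independence_complex V E) \<longleftrightarrow>
            (\<exists>!M. perfect_matching V E M)) \<and>
         ((\<exists>!M. perfect_matching V E M) \<longleftrightarrow>
            shellable_complex (independence_complex V E))"
proof -
  interpret graph V E using assms(1) by unfold_locales
  interpret wc: well_covered_graph V E
    using assms(4) unmixed_facets[OF assms(2)] by unfold_locales
  have "{} \<in> \<Delta>" by (rule indepI) auto
  then obtain Y where Y: "facet \<Delta> Y" by (rule facet_extends)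
  \<comment> \<open>With \<open>card V = 2 * n\<close> this reads
    \<open>2 * n - card Y \<le> n\<close>, hence \<open>n \<le> card Y\<close>.\<close>
  have "enat (card V - card Y) \<le> enat n"
    using ideal_height_ge[where 'k = 'k, OF wc.indep_card_le[OF _ Y]] unfolding assms(5) .
  then have "card V \<le> 2 * card Y" using assms(3) by simp
  then obtain p where p: "bij_betw p Y (V - Y)" "\<And>y. y \<in> Y \<Longrightarrow> {y, p y} \<in> E" "card V = 2 * card Y"
    by (rule wc.matching_exists[OF Y]) (rule that)
  interpret mg: matched_graph V E n Y p
  proof unfold_locales
    show "card F = n" if "facet \<Delta> F" for F using wc.facets_card[OF that Y] p(3) assms(3) by simp
  qed (rule Y p(1) p(2), assumption?)+
  have sc: "shellable_complex \<Delta>" "strongly_connected_complex \<Delta>" if "mg.antisymmetric"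
    using mg.antisymmetric_imp_shellable[OF that] by (auto intro: mg.shellable_imp_strongly_connected)
  have "cohen_macaulay_graph TYPE('k) V E \<longleftrightarrow> mg.antisymmetric"
    by (rule iffI[OF mg.cohen_macaulay_imp_antisymmetric mg.shellable_imp_cohen_macaulay[OF sc(1)]])
  moreover have "strongly_connected_complex \<Delta> \<longleftrightarrow> mg.antisymmetric"
    by (rule iffI[OF mg.strongly_connected_imp_antisymmetric sc(2)])
  moreover have "(\<exists>!M. perfect_matching V E M) \<longleftrightarrow> mg.antisymmetric"
    by (rule iffI[OF mg.unique_matching_imp_antisymmetric mg.antisymmetric_imp_unique_matching])
  moreover have "shellable_complex \<Delta> \<longleftrightarrow> mg.antisymmetric"
    by (rule iffI[OF mg.strongly_connected_imp_antisymmetric[OF mg.shellable_imp_strongly_connected] sc(1)])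
  ultimately show ?thesis by simp
qed

end
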